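(* Let $F_2$ be the free group on $\gamma_1,\gamma_2$. (1) $\mathbb C[X_{SO(4,\mathbb C)}(F_2)]$ is generated as a $\mathcal T_{SO(4,\mathbb C)}(F_2)$-module by $$1,\quad Q_4(\gamma_i,\gamma_j)\ \text{ for } 1\le i\le j\le 2,$$ and by $$Q_4(\gamma_1\gamma_2,\gamma_1\gamma_2),\quad Q_4(\gamma_1\gamma_2^{-1},\gamma_1\gamma_2^{-1}),\quad Q_4(\gamma_1\gamma_2^{-1},\gamma_2),\quad Q_4(\gamma_2\gamma_1^{-1},\gamma_1).$$ (2) $\mathbb C[X_{SO(4,\mathbb C)}(F_2)]$ is generated as an $\mathcal{FT}_{SO(4,\mathbb C)}(F_2)$-module by $$1,\quad Q_4(\gamma_1,\gamma_2),\quad Q_4(\gamma_1\gamma_2^{-1},\gamma_2),\quad Q_4(\gamma_2\gamma_1^{-1},\gamma_1).$$ (3) None of the four generators in part (2) can be expressed as a linear combination of the others with coefficients in $\mathcal{FT}_{SO(4,\mathbb C)}(F_2)$. Consequently, $\mathcal{FT}_{SO(4,\mathbb C)}(F_2)\subsetneq\mathbb C[X_{SO(4,\mathbb C)}(F_2)]$.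
   Context: $SO(4,\mathbb C)=\{A\in M(4,\mathbb C): AA^T=I,\ \det A=1\}$. For a reductive algebraic group $G$ over $\mathbb C$ and a group $\Gamma$ generated by $\gamma_1,\dots,\gamma_N$, $Hom(\Gamma,G)$ is viewed as an algebraic subset of $G^N$, $G$ acts on it by conjugation, and $X_G(\Gamma)=Hom(\Gamma,G)//G$ is the categorical quotient, so $\mathbb C[X_G(\Gamma)]=\mathbb C[Hom(\Gamma,G)]^G$. For a (finite-dimensional algebraic) representation $\phi_V:G\to GL(V)$ and $\gamma\in\Gamma$, put $\tau_{\gamma,V}([\rho])=\mathrm{tr}(\phi_V(\rho(\gamma)))$, a regular function on $X_G(\Gamma)$. For a matrix group $G\subset GL(d,\mathbb C)$, the trace algebra $\mathcal T_G(\Gamma)$ is the $\mathbb C$-subalgebra of $\mathbb C[X_G(\Gamma)]$ generated by $\tau_\gamma=\tau_{\gamma,\mathbb C^d}$ for all $\gamma\in\Gamma$; the full trace algebra $\mathcal{FT}_G(\Gamma)$ is the $\mathbb C$-subalgebra generated by $\tau_{\gamma,V}$ for all $\gamma\in\Gamma$ and all representations $V$ of $G$. $Q_4:M(4,\mathbb C)^2\to\mathbb C$ is $$Q_4(A,B)=\sum_{\sigma\in S_4}\mathrm{sgn}(\sigma)\,(A_{\sigma(1),\sigma(2)}-A_{\sigma(2),\sigma(1)})(B_{\sigma(3),\sigma(4)}-B_{\sigma(4),\sigma(3)}).$$ For $g_1,g_2\in\Gamma$, $Q_4(g_1,g_2)\in\mathbb C[X_{SO(4,\mathbb C)}(\Gamma)]$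 is the function induced by the conjugation-invariant function $\rho\mapsto Q_4(\rho(g_1),\rho(g_2))$. *)

theory Defs
  imports "Jordan_Normal_Form.Determinant" "HOL-Algebra.Group" "HOL-Library.FuncSet"
begin

section \<open>Free groups\<close>

text \<open>A letter \<open>(x, True)\<close> stands for the generator \<open>x\<close> and \<open>(x, False)\<close> for its inverse. The
  free group consists of the reduced words; the product reduces the concatenation, one letter of
  the left factor at a time.\<close>

type_synonym 'a letter = "'a \<times> bool"

definition inv_letter :: "'a letter \<Rightarrow> 'a letter" where
  "inv_letter l = (fst l, \<not> snd l)"

fun push :: "'a letter \<Rightarrow> 'a letter list \<Rightarrow> 'a letter list" where
  "push l [] = [l]"
| "push l (m # w) = (if m = inv_letter l then w else l # m # w)"

fun reduced :: "'a letter list \<Rightarrow> bool" where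
  "reduced [] \<longleftrightarrow> True"
| "reduced [l] \<longleftrightarrow> True"
| "reduced (l # m # w) \<longleftrightarrow> m \<noteq> inv_letter l \<and> reduced (m # w)"

definition free_group :: "'a set \<Rightarrow> 'a letter list monoid" where
  "free_group S = \<lparr>carrier = {w. reduced w \<and> fst ` set w \<subseteq> S},
                   mult = (\<lambda>u v. foldr push u v), one = []\<rparr>"

definition free_gen :: "'a \<Rightarrow> 'a letter list" where
  "free_gen x = [(x, True)]"

lemma inv_letter_inv_letter [simp]: "inv_letter (inv_letter l) = l"
  by (simp add: inv_letter_def)

lemma inv_letter_neq [simp]: "inv_letter l \<noteq> l" "l \<noteq> inv_letter l"
  by (auto simp: inv_letter_def prod_eq_iff)

lemma fst_inv_letter [simp]: "fst (inv_letter l) = fst l"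
  by (simp add: inv_letter_def)

lemma reduced_Cons: "reduced (l # w) \<longleftrightarrow> reduced w \<and> (w = [] \<or> hd w \<noteq> inv_letter l)"
  by (cases w) auto

lemma reduced_push: "reduced w \<Longrightarrow> reduced (push l w)"
  by (cases w) (auto simp: reduced_Cons)

lemma push_push_inv: "reduced w \<Longrightarrow> push l (push (inv_letter l) w) = w"
proof (cases w)
  case (Cons m v)
  assume "reduced w"
  then show ?thesis using Cons by (cases v) auto
qed simp

lemma set_push: "set (push l w) \<subseteq> insert l (set w)"
  by (cases w) auto

lemma reduced_foldr_push: "reduced v \<Longrightarrow> reduced (foldr push u v)"
  by (induction u) (auto simp: reduced_push)

lemma set_foldr_push: "set (foldr push u v) \<subseteq> set u \<union> set v"
  by (induction u) (use set_push in fastforce)+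

lemma foldr_push_push:
  assumes "reduced w"
  shows "foldr push (push l u) w = push l (foldr push u w)"
proof (cases u)
  case (Cons m v)
  show ?thesis
  proof (cases "m = inv_letter l")
    case True
    then show ?thesis
      using Cons push_push_inv[OF reduced_foldr_push[OF assms], of l v] by simp
  qed (simp add: Cons)
qed simp

lemma foldr_push_assoc:
  "reduced w \<Longrightarrow> foldr push (foldr push u v) w = foldr push u (foldr push v w)"
  by (induction u) (auto simp: foldr_push_push)

lemma foldr_push_Nil: "reduced u \<Longrightarrow> foldr push u [] = u"
proof (induction u)
  case (Cons l u)
  then show ?case by (cases u) (auto simp: reduced_Cons)
qed simp

definition inv_word :: "'a letter list \<Rightarrow> 'a letter list" where
  "inv_word w = rev (map inv_letter w)"

lemma foldr_push_cancel: "reduced v \<Longrightarrow> foldr push (inv_word w) (foldr push w v) = v"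
proof (induction w arbitrary: v)
  case (Cons l w)
  have "push (inv_letter l) (push l (foldr push w v)) = foldr push w v"
    using push_push_inv[OF reduced_foldr_push[OF Cons.prems], of "inv_letter l" w] by simp
  then show ?case using Cons by (simp add: inv_word_def)
qed (simp add: inv_word_def)

lemma group_free_group: "group (free_group S)"
proof (rule groupI)
  fix w assume w: "w \<in> carrier (free_group S)"
  let ?v = "foldr push (inv_word w) []"
  have "set ?v \<subseteq> inv_letter ` set w"
    using set_foldr_push[of "inv_word w" "[]"] by (simp add: inv_word_def)
  then have "?v \<in> carrier (free_group S)"
    using w by (fastforce simp: free_group_def reduced_foldr_push)
  moreover have "?v \<otimes>\<^bsub>free_group S\<^esub> w = \<one>\<^bsub>free_group S\<^esub>"
  proof -
    have red: "reduced w" using w by (simp add: free_group_def)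
    have "foldr push ?v w = foldr push (inv_word w) (foldr push w [])"
      using foldr_push_assoc[OF red, of "inv_word w" "[]"] foldr_push_Nil[OF red] by simp
    then show ?thesis
      using foldr_push_cancel[of "[]" w] by (simp add: free_group_def)
  qed
  ultimately show "\<exists>v\<in>carrier (free_group S). v \<otimes>\<^bsub>free_group S\<^esub> w = \<one>\<^bsub>free_group S\<^esub>"
    by blast
next
  fix u v assume "u \<in> carrier (free_group S)" "v \<in> carrier (free_group S)"
  then show "u \<otimes>\<^bsub>free_group S\<^esub> v \<in> carrier (free_group S)"
    using set_foldr_push[of u v] by (fastforce simp: free_group_def reduced_foldr_push)
qed (auto simp: free_group_def foldr_push_assoc)


section \<open>Matrix groups\<close>

text \<open>Matrix indices start at 0.\<close>

definition SO :: "nat \<Rightarrow> complex mat monoid" where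
  "SO n = \<lparr>carrier = {A \<in> carrier_mat n n. A * transpose_mat A = 1\<^sub>m n \<and> det A = 1},
           mult = (*), one = 1\<^sub>m n\<rparr>"

definition GL :: "nat \<Rightarrow> complex mat monoid" where
  "GL n = units_of (ring_mat TYPE(complex) n ())"

definition mat_trace :: "complex mat \<Rightarrow> complex" where
  "mat_trace A = (\<Sum>i<dim_row A. A $$ (i, i))"

lemma group_SO: "group (SO n)"
proof (rule groupI)
  fix A assume A: "A \<in> carrier (SO n)"
  then have c: "A \<in> carrier_mat n n" and o: "A * transpose_mat A = 1\<^sub>m n" and d: "det A = 1"
    by (auto simp: SO_def)
  have "transpose_mat A * A = 1\<^sub>m n"
    using mat_mult_left_right_inverse[OF c _ o] c by simp
  then show "\<exists>B\<in>carrier (SO n). B \<otimes>\<^bsub>SO n\<^esub> A = \<one>\<^bsub>SO n\<^esub>"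
    using c d by (intro bexI[of _ "transpose_mat A"]) (auto simp: SO_def det_transpose)
next
  fix A B assume "A \<in> carrier (SO n)" "B \<in> carrier (SO n)"
  then have c: "A \<in> carrier_mat n n" "B \<in> carrier_mat n n"
    and o: "A * transpose_mat A = 1\<^sub>m n" "B * transpose_mat B = 1\<^sub>m n"
    and d: "det A = 1" "det B = 1"
    by (auto simp: SO_def)
  have "(A * B) * transpose_mat (A * B) = A * (B * transpose_mat B) * transpose_mat A"
    using c by (simp add: transpose_mult[of _ n n _ n] assoc_mult_mat[of _ n n _ n _ n])
  also have "\<dots> = 1\<^sub>m n" using c o by simp
  finally show "A \<otimes>\<^bsub>SO n\<^esub> B \<in> carrier (SO n)"
    using c d by (simp add: SO_def det_mult[of _ n])
qed (auto simp: SO_def assoc_mult_mat[of _ n n _ n _ n])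


section \<open>Algebras of functions\<close>

text \<open>A function on a set \<open>X\<close> is represented by its extension to the whole type that is
  \<open>undefined\<close> outside \<open>X\<close>, so that equality of functions is equality on \<open>X\<close>.\<close>

text \<open>The unital \<open>\<complex>\<close>-algebra of functions on \<open>X\<close> generated by the restrictions to \<open>X\<close> of the
  functions in \<open>F\<close>. If \<open>F\<close> consists of coordinate functions, these are the polynomial functions.\<close>

inductive_set generated_alg :: "'x set \<Rightarrow> ('x \<Rightarrow> complex) set \<Rightarrow> ('x \<Rightarrow> complex) set"
  for X :: "'x set" and F :: "('x \<Rightarrow> complex) set" where
  const: "(\<lambda>x\<in>X. c) \<in> generated_alg X F"
| gen: "f \<in> F \<Longrightarrow> restrict f X \<in> generated_alg X F"
| add: "f \<in> generated_alg X F \<Longrightarrow> g \<in> generated_alg X F \<Longrightarrow> (\<lambda>x\<in>X. f x + g x) \<in> generated_alg X F"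
| mult: "f \<in> generated_alg X F \<Longrightarrow> g \<in> generated_alg X F \<Longrightarrow> (\<lambda>x\<in>X. f x * g x) \<in> generated_alg X F"

text \<open>The linear combinations of elements of \<open>M\<close> with coefficients in \<open>R\<close>.\<close>

definition module_span ::
  "'x set \<Rightarrow> ('x \<Rightarrow> complex) set \<Rightarrow> ('x \<Rightarrow> complex) set \<Rightarrow> ('x \<Rightarrow> complex) set" where
  "module_span X R M =
     {(\<lambda>x\<in>X. \<Sum>m\<in>N. a m x * m x) | N a. finite N \<and> N \<subseteq> M \<and> (\<forall>m\<in>N. a m \<in> R)}"


section \<open>Character varieties\<close>

text \<open>Generators of the coordinate ring of \<open>GL(d, \<complex>)\<close>. The regular functions on a Zariski closed
  subset of a power of \<open>GL(d, \<complex>)\<close> are the restrictions of the polynomials in these. On \<open>SO(d, \<complex>)\<close>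
  the inverse determinant is constant and adds nothing.\<close>

definition GL_coords :: "nat \<Rightarrow> (complex mat \<Rightarrow> complex) set" where
  "GL_coords d = {(\<lambda>A. A $$ (i, j)) | i j. i < d \<and> j < d} \<union> {\<lambda>A. inverse (det A)}"

text \<open>Below, \<open>G\<close> is a Zariski closed subgroup of \<open>GL(d, \<complex>)\<close>, \<open>\<Gamma>\<close> is a group, and \<open>S\<close> is a finite
  set of generators of \<open>\<Gamma>\<close>.\<close>

definition Hom :: "('a, 'b) monoid_scheme \<Rightarrow> complex mat monoid \<Rightarrow> ('a \<Rightarrow> complex mat) set" where
  "Hom \<Gamma> G = hom \<Gamma> G \<inter> extensional (carrier \<Gamma>)"

text \<open>The coordinate ring of \<open>Hom \<Gamma> G\<close>, which is embedded in \<open>G\<^sup>N\<close> by evaluation at the elements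
  of \<open>S\<close>.\<close>

definition coord_ring_Hom ::
  "nat \<Rightarrow> complex mat monoid \<Rightarrow> ('a, 'b) monoid_scheme \<Rightarrow> 'a set \<Rightarrow> (('a \<Rightarrow> complex mat) \<Rightarrow> complex) set"
  where
  "coord_ring_Hom d G \<Gamma> S =
     generated_alg (Hom \<Gamma> G) {(\<lambda>\<rho>. p (\<rho> s)) | p s. p \<in> GL_coords d \<and> s \<in> S}"

definition conj_rep ::
  "complex mat monoid \<Rightarrow> ('a, 'b) monoid_scheme \<Rightarrow> complex mat \<Rightarrow> ('a \<Rightarrow> complex mat) \<Rightarrow> 'a \<Rightarrow> complex mat"
  where
  "conj_rep G \<Gamma> A \<rho> = (\<lambda>\<gamma>\<in>carrier \<Gamma>. A \<otimes>\<^bsub>G\<^esub> \<rho> \<gamma> \<otimes>\<^bsub>G\<^esub> inv\<^bsub>G\<^esub> A)"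

text \<open>The coordinate ring of the character variety \<open>X\<^sub>G(\<Gamma>) = Hom(\<Gamma>, G) // G\<close>, i.e. the ring of
  invariants. A function on \<open>X\<^sub>G(\<Gamma>)\<close> is thus identified with its pullback to \<open>Hom(\<Gamma>, G)\<close>.\<close>

definition coord_ring_X ::
  "nat \<Rightarrow> complex mat monoid \<Rightarrow> ('a, 'b) monoid_scheme \<Rightarrow> 'a set \<Rightarrow> (('a \<Rightarrow> complex mat) \<Rightarrow> complex) set"
  where
  "coord_ring_X d G \<Gamma> S =
     {f \<in> coord_ring_Hom d G \<Gamma> S. \<forall>A\<in>carrier G. \<forall>\<rho>\<in>Hom \<Gamma> G. f (conj_rep G \<Gamma> A \<rho>) = f \<rho>}"

text \<open>Algebraic representations of \<open>G\<close> on \<open>\<complex>\<^sup>n\<close>; every finite-dimensional one is isomorphic to one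
  of these, and traces do not depend on the choice of a basis.\<close>

definition algebraic_rep ::
  "nat \<Rightarrow> complex mat monoid \<Rightarrow> nat \<Rightarrow> (complex mat \<Rightarrow> complex mat) \<Rightarrow> bool" where
  "algebraic_rep d G n \<phi> \<longleftrightarrow> \<phi> \<in> hom G (GL n) \<and>
     (\<forall>i<n. \<forall>j<n. (\<lambda>A\<in>carrier G. \<phi> A $$ (i, j)) \<in> generated_alg (carrier G) (GL_coords d))"

definition trace_alg ::
  "complex mat monoid \<Rightarrow> ('a, 'b) monoid_scheme \<Rightarrow> (('a \<Rightarrow> complex mat) \<Rightarrow> complex) set" where
  "trace_alg G \<Gamma> = generated_alg (Hom \<Gamma> G) {(\<lambda>\<rho>. mat_trace (\<rho> \<gamma>)) | \<gamma>. \<gamma> \<in> carrier \<Gamma>}"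

definition full_trace_alg ::
  "nat \<Rightarrow> complex mat monoid \<Rightarrow> ('a, 'b) monoid_scheme \<Rightarrow> (('a \<Rightarrow> complex mat) \<Rightarrow> complex) set" where
  "full_trace_alg d G \<Gamma> =
     generated_alg (Hom \<Gamma> G)
       {(\<lambda>\<rho>. mat_trace (\<phi> (\<rho> \<gamma>))) | \<phi> n \<gamma>. algebraic_rep d G n \<phi> \<and> \<gamma> \<in> carrier \<Gamma>}"


section \<open>The functions \<open>Q\<^sub>4\<close> on the character variety of the free group of rank two\<close>

definition Q4 :: "complex mat \<Rightarrow> complex mat \<Rightarrow> complex" where
  "Q4 A B = (\<Sum>\<sigma> | \<sigma> permutes {0..<4}. of_int (sign \<sigma>) *
     (A $$ (\<sigma> 0, \<sigma> 1) - A $$ (\<sigma> 1, \<sigma> 0)) * (B $$ (\<sigma> 2, \<sigma> 3) - B $$ (\<sigma> 3, \<sigma> 2)))"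

definition F2 :: "nat letter list monoid" where
  "F2 = free_group {1, 2}"

definition \<gamma> :: "nat \<Rightarrow> nat letter list" where
  "\<gamma> i = free_gen i"

definition Q4_fun ::
  "nat letter list \<Rightarrow> nat letter list \<Rightarrow> (nat letter list \<Rightarrow> complex mat) \<Rightarrow> complex" where
  "Q4_fun g h = (\<lambda>\<rho>\<in>Hom F2 (SO 4). Q4 (\<rho> g) (\<rho> h))"

definition one_fun :: "(nat letter list \<Rightarrow> complex mat) \<Rightarrow> complex" where
  "one_fun = (\<lambda>\<rho>\<in>Hom F2 (SO 4). 1)"

end

theory Submission
  imports Defs "HOL-Computational_Algebra.Polynomial"
begin

text \<open>The idea is to lift everything to the double cover \<open>SL\<^sub>2 \<times> SL\<^sub>2 \<rightarrow> SO(4)\<close>. Identify \<open>\<complex>\<^sup>4\<close> with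
  \<open>M(2, \<complex>)\<close> so that the quadratic form becomes the determinant; then \<open>(A, B)\<close> acts by
  \<open>X \<mapsto> A X B\<^sup>-\<^sup>1\<close>. A representation of \<open>F\<^sub>2\<close> in \<open>SO(4)\<close> lifts to two pairs \<open>(A\<^sub>1, A\<^sub>2)\<close> and \<open>(B\<^sub>1, B\<^sub>2)\<close>
  in \<open>SL\<^sub>2\<close>, and conjugation acts on the two pairs independently. Put \<open>x = tr A\<^sub>1\<close>, \<open>y = tr A\<^sub>2\<close>,
  \<open>z = tr (A\<^sub>1 A\<^sub>2)\<close>, and write \<open>x'\<close>, \<open>y'\<close>, \<open>z'\<close> for the traces of the second pair. By the theorem
  of Fricke and Vogt (\<open>SL2_invariants\<close>) an invariant function is a polynomial in these six traces.
  The lift is unique up to the signs of the generators, so the polynomial is even: it is invariant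
  under changing the signs of \<open>x, z, x', z'\<close>, and of \<open>y, z, y', z'\<close>.

  The trace of the image of \<open>(A, B)\<close> is \<open>tr A tr B\<close>, which is symmetric in the two factors, and in
  lifted form \<open>Q\<^sub>4(g, h) = 4 (tr A\<^sub>g tr A\<^sub>h tr (B\<^sub>g B\<^sub>h) - tr B\<^sub>g tr B\<^sub>h tr (A\<^sub>g A\<^sub>h))\<close> is antisymmetric
  (\<open>Q4_pi_mat\<close>). In the coordinates \<open>x \<plusminus> x'\<close>, \<open>y \<plusminus> y'\<close>, \<open>z \<plusminus> z'\<close> an even polynomial is a
  combination of even monomials. Those of even degree in the differences are polynomials in traces
  of words (\<open>trace_alg_symmetric\<close>), and those of odd degree are combinations of the functions \<open>Q\<^sub>4\<close>
  with such coefficients (\<open>antisymmetric_in_span\<close>). This is part (1).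

  For part (2), the squares \<open>(tr A\<^sub>g)\<^sup>2\<close> belong to the full trace algebra, since
  \<open>(A, B) \<mapsto> (X \<mapsto> A X A\<^sup>-\<^sup>1)\<close> is an algebraic representation of \<open>SO(4)\<close> (\<open>adjoint_rep\<close>). Up to a
  factor, \<open>Q\<^sub>4(g, g)\<close> is the difference of \<open>(tr B\<^sub>g)\<^sup>2\<close> and \<open>(tr A\<^sub>g)\<^sup>2\<close>, so the generators of this
  form become superfluous.

  For part (3), the character of any representation at \<open>g\<close> is an even polynomial in \<open>tr A\<^sub>g\<close> and
  \<open>tr B\<^sub>g\<close> (\<open>class_function_lift\<close>). Take a line through the origin in the space of the six traces
  on which \<open>(x, y, z')\<close> is proportional to \<open>(1, 1, 1)\<close> and the other traces vanish, and the line
  obtained by exchanging the two triples of traces. The coefficients of \<open>t\<^sup>3\<close> of a function of the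
  full trace algebra along the two lines agree (\<open>balanced_rep_traces\<close>), whereas those of
  \<open>Q\<^sub>4(\<gamma>\<^sub>1, \<gamma>\<^sub>2) = 4 (x y z' - x' y' z)\<close> are opposite, and the other two mixed generators vanish
  there. Analogous lines serve for the latter two (\<open>not_in_span\<close>).\<close>

section \<open>Two by two matrices\<close>

text \<open>The elements of \<open>M(2, \<complex>)\<close> form a type of their own, so that products need no dimension
  side conditions and polynomial identities between matrices reduce to identities in their
  entries.\<close>

datatype m2 = M2 (e11: complex) (e12: complex) (e21: complex) (e22: complex)

instantiation m2 :: ring_1
begin

definition "0 = M2 0 0 0 0"
definition "1 = M2 1 0 0 1"
definition "A + B = M2 (e11 A + e11 B) (e12 A + e12 B) (e21 A + e21 B) (e22 A + e22 B)"
definition "- A = M2 (- e11 A) (- e12 A) (- e21 A) (- e22 A)"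
definition "A - B = M2 (e11 A - e11 B) (e12 A - e12 B) (e21 A - e21 B) (e22 A - e22 B)"
definition "A * B = M2 (e11 A * e11 B + e12 A * e21 B) (e11 A * e12 B + e12 A * e22 B)
                       (e21 A * e11 B + e22 A * e21 B) (e21 A * e12 B + e22 A * e22 B)"

instance
  by standard (auto simp: zero_m2_def one_m2_def plus_m2_def uminus_m2_def minus_m2_def times_m2_def
      algebra_simps intro: m2.expand)

end

text \<open>The adjugate is the inverse on \<open>SL\<^sub>2\<close>. Being linear in the entries, it keeps everything
  below polynomial.\<close>

definition adj :: "m2 \<Rightarrow> m2" where
  "adj A = M2 (e22 A) (- e12 A) (- e21 A) (e11 A)"

definition tr :: "m2 \<Rightarrow> complex" where
  "tr A = e11 A + e22 A"

definition dt :: "m2 \<Rightarrow> complex" where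
  "dt A = e11 A * e22 A - e12 A * e21 A"

lemmas m2_simps = zero_m2_def one_m2_def plus_m2_def uminus_m2_def minus_m2_def times_m2_def
  adj_def tr_def dt_def

lemma m2_eqI: "e11 A = e11 B \<Longrightarrow> e12 A = e12 B \<Longrightarrow> e21 A = e21 B \<Longrightarrow> e22 A = e22 B \<Longrightarrow> A = B"
  by (rule m2.expand) simp

lemma dt_mult: "dt (A * B) = dt A * dt B"
  by (simp add: m2_simps algebra_simps)

lemma dt_one [simp]: "dt 1 = 1"
  by (simp add: m2_simps)

lemma dt_adj [simp]: "dt (adj A) = dt A"
  by (simp add: m2_simps algebra_simps)

lemma tr_adj [simp]: "tr (adj A) = tr A"
  by (simp add: m2_simps algebra_simps)

lemma adj_adj [simp]: "adj (adj A) = A"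
  by (simp add: m2_simps)

lemma adj_one [simp]: "adj 1 = 1"
  by (simp add: m2_simps)

lemma tr_one [simp]: "tr 1 = 2"
  by (simp add: m2_simps)

lemma adj_mult: "adj (A * B) = adj B * adj A"
  by (simp add: m2_simps algebra_simps)

lemma tr_commute: "tr (A * B) = tr (B * A)"
  by (simp add: m2_simps algebra_simps)

lemma mult_adj: "dt A = 1 \<Longrightarrow> A * adj A = 1"
  by (simp add: m2_simps algebra_simps)

lemma adj_mult_self: "dt A = 1 \<Longrightarrow> adj A * A = 1"
  by (simp add: m2_simps algebra_simps)

lemma mult_adj_cancel: "dt A = 1 \<Longrightarrow> A * (adj A * B) = B" "dt A = 1 \<Longrightarrow> adj A * (A * B) = B"
  by (simp_all add: mult.assoc[symmetric] mult_adj adj_mult_self)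

lemma tr_conj: "dt G = 1 \<Longrightarrow> tr (G * A * adj G) = tr A"
  by (metis adj_mult_self mult.assoc mult.left_neutral tr_commute)

lemma conj_mult: "dt G = 1 \<Longrightarrow> (G * A * adj G) * (G * B * adj G) = G * (A * B) * adj G"
  by (simp add: mult.assoc mult_adj_cancel)

text \<open>Products of four elementary matrices, alternately upper and lower triangular, exhaust
  \<open>SL\<^sub>2\<close>. This makes \<open>SL\<^sub>2\<close> a polynomial image of an affine space, which serves twice: to join any
  two points by a polynomial curve, and to see that \<open>SL\<^sub>2\<close> is generated by squares.\<close>

definition upper :: "complex \<Rightarrow> m2" where "upper a = M2 1 a 0 1"
definition lower :: "complex \<Rightarrow> m2" where "lower a = M2 1 0 a 1"

definition elem_prod :: "complex \<Rightarrow> complex \<Rightarrow> complex \<Rightarrow> complex \<Rightarrow> m2" where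
  "elem_prod a b c d = upper a * lower b * (upper c * lower d)"

lemma dt_upper [simp]: "dt (upper a) = 1" and dt_lower [simp]: "dt (lower a) = 1"
  by (simp_all add: upper_def lower_def m2_simps)

lemma dt_elem_prod [simp]: "dt (elem_prod a b c d) = 1"
  by (simp add: elem_prod_def dt_mult)

lemma elem_prod_surj:
  assumes "dt A = 1"
  obtains a b c d where "A = elem_prod a b c d"
proof -
  obtain p q r s where A: "A = M2 p q r s" by (cases A)
  have d: "p * s - q * r = 1" using assms by (simp add: A m2_simps)
  show thesis
  proof (cases "r = 0")
    case False
    have "A = elem_prod ((p - 1) / r) r ((s - 1) / r) 0"
      using False d by (auto simp: A elem_prod_def upper_def lower_def m2_simps field_simps)
    then show thesis by (rule that)
  next
    case True
    \<comment> \<open>Here the last factor is used to make the lower left entry nonzero.\<close>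
    then have ps: "p * s = 1" and "s \<noteq> 0" using d by auto
    have "A = elem_prod ((p + q - 1) / s) s ((s - 1) / s) (- 1)"
      using True \<open>s \<noteq> 0\<close> ps
      by (auto simp: A elem_prod_def upper_def lower_def m2_simps field_simps)
    then show thesis by (rule that)
  qed
qed

lemma singular_kernel:
  assumes "p * s = q * (r::complex)"
  obtains v w where "v \<noteq> 0 \<or> w \<noteq> 0" "p * v + q * w = 0" "r * v + s * w = 0"
proof -
  consider "p \<noteq> 0 \<or> q \<noteq> 0" | "r \<noteq> 0 \<or> s \<noteq> 0" | "p = 0" "q = 0" "r = 0" "s = 0" by blast
  then show thesis
  proof cases
    case 1 then show thesis using assms by (intro that[of q "- p"]) (auto simp: algebra_simps)
  next
    case 2 then show thesis using assms by (intro that[of s "- r"]) (auto simp: algebra_simps)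
  next
    case 3 then show thesis by (intro that[of 1 0]) auto
  qed
qed

definition scale_m2 :: "complex \<Rightarrow> m2 \<Rightarrow> m2" where
  "scale_m2 c A = M2 (c * e11 A) (c * e12 A) (c * e21 A) (c * e22 A)"

lemma scale_m2_mult: "scale_m2 c A * B = scale_m2 c (A * B)" "A * scale_m2 c B = scale_m2 c (A * B)"
  by (simp_all add: scale_m2_def m2_simps algebra_simps)

lemma dt_scale_m2: "dt (scale_m2 c A) = c\<^sup>2 * dt A"
  by (simp add: scale_m2_def m2_simps power2_eq_square algebra_simps)

lemma normalise_dt:
  assumes "dt A \<noteq> 0"
  obtains c where "dt (scale_m2 c A) = 1"
proof -
  obtain c where "c\<^sup>2 = inverse (dt A)" using power2_csqrt by metis
  then have "dt (scale_m2 c A) = inverse (dt A) * dt A"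
    by (metis (no_types) dt_scale_m2)
  then show thesis using assms by (intro that) simp
qed

section \<open>The double cover of \<open>SO(4)\<close>\<close>

text \<open>\<open>\<complex>\<^sup>4\<close> is identified with \<open>M(2, \<complex>)\<close> in such a way that the standard quadratic form becomes
  the determinant. The standard basis goes to the quaternion units.\<close>

definition vec2 :: "(nat \<Rightarrow> complex) \<Rightarrow> m2" where
  "vec2 v = M2 (v 0 + \<i> * v 1) (v 2 + \<i> * v 3) (- v 2 + \<i> * v 3) (v 0 - \<i> * v 1)"

definition quat :: "nat \<Rightarrow> m2" where
  "quat i = vec2 (\<lambda>j. if j = i then 1 else 0)"

definition coord :: "m2 \<Rightarrow> nat \<Rightarrow> complex" where
  "coord X i = tr (X * adj (quat i)) / 2"

lemma sum4: "(\<Sum>i<4. f i) = f 0 + f (Suc 0) + f 2 + f (3::nat)" "(\<Sum>i=0..<4. f i) = f 0 + f (Suc 0) +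
    f 2 + f (3::nat)"
  by (simp_all add: numeral_eq_Suc)

lemma less4: "i < 4 \<longleftrightarrow> i = 0 \<or> i = Suc 0 \<or> i = 2 \<or> i = (3::nat)"
  by auto

lemma quat_simps: "quat 0 = 1" "quat (Suc 0) = M2 \<i> 0 0 (-\<i>)" "quat 2 = M2 0 1 (-1) 0" "quat 3 = M2
    0 \<i> \<i> 0"
  by (simp_all add: quat_def vec2_def m2_simps)

lemma coord_simps: "coord X 0 = (e11 X + e22 X) / 2" "coord X (Suc 0) = (e11 X - e22 X) / (2 * \<i>)"
    "coord X 2 = (e12 X - e21 X) / 2" "coord X 3 = (e12 X + e21 X) / (2 * \<i>)"
  by (simp_all add: coord_def quat_simps m2_simps field_simps)

lemma vec2_coord: "vec2 (coord X) = X"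
  by (rule m2_eqI) (simp_all add: vec2_def coord_simps field_simps)

lemma coord_vec2: "i < 4 \<Longrightarrow> coord (vec2 v) i = v i"
  by (auto simp: less4 vec2_def coord_simps)

text \<open>The matrix of \<open>X \<mapsto> A X adj(B)\<close>. It preserves the determinant if \<open>A\<close> and \<open>B\<close> have
  determinant one, and so lies in \<open>SO(4)\<close>.\<close>

definition pi_mat :: "m2 \<Rightarrow> m2 \<Rightarrow> complex mat" where
  "pi_mat A B = mat 4 4 (\<lambda>(i, j). coord (A * quat j * adj B) i)"

lemma pi_mat_carrier [simp]: "pi_mat A B \<in> carrier_mat 4 4"
  "dim_row (pi_mat A B) = 4" "dim_col (pi_mat A B) = 4"
  by (simp_all add: pi_mat_def)

lemma pi_mat_index: "i < 4 \<Longrightarrow> j < 4 \<Longrightarrow> pi_mat A B $$ (i, j) = coord (A * quat j * adj B) i"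
  by (simp add: pi_mat_def)

lemma coord_linear:
  assumes "i < 4"
  shows "(\<Sum>j<4. coord (A * quat j * adj B) i * v j) = coord (A * vec2 v * adj B) i"
  using assms
  by (auto simp: less4 sum4 quat_simps coord_simps
      vec2_def m2_simps field_simps)

lemma pi_mat_mult: "pi_mat A B * pi_mat C D = pi_mat (A * C) (B * D)"
proof (rule eq_matI)
  fix i j assume "i < dim_row (pi_mat (A * C) (B * D))" "j < dim_col (pi_mat (A * C) (B * D))"
  then have ij: "i < 4" "j < 4" by auto
  have "(pi_mat A B * pi_mat C D) $$ (i, j)
      = (\<Sum>k<4. coord (A * quat k * adj B) i * coord (C * quat j * adj D) k)"
    using ij by (simp add: scalar_prod_def pi_mat_def lessThan_atLeast0)
  also have "\<dots> = coord (A * (C * quat j * adj D) * adj B) i"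
    using coord_linear[OF ij(1)] by (simp add: vec2_coord)
  also have "\<dots> = coord (A * C * quat j * adj (B * D)) i"
    by (simp add: adj_mult mult.assoc)
  finally show "(pi_mat A B * pi_mat C D) $$ (i, j) = pi_mat (A * C) (B * D) $$ (i, j)"
    using ij by (simp add: pi_mat_index mult.assoc)
qed auto

lemma pi_mat_one: "pi_mat 1 1 = 1\<^sub>m 4"
  by (rule eq_matI) (auto simp: pi_mat_index quat_def coord_vec2)

text \<open>Multiplication by \<open>adj A\<close> is adjoint to multiplication by \<open>A\<close> for the bilinear form
  \<open>tr (X adj Y) / 2\<close>, which corresponds to the standard one.\<close>

lemma pi_mat_transpose: "transpose_mat (pi_mat A B) = pi_mat (adj A) (adj B)"
proof -
  have "tr (A * quat i * adj B * adj (quat j)) = tr (adj A * quat j * B * adj (quat i))" for i j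
  proof -
    have "tr (A * quat i * adj B * adj (quat j)) = tr (adj (A * quat i * adj B * adj (quat j)))" by
        simp
    also have "\<dots> = tr (quat j * B * adj (quat i) * adj A)" by (simp add: adj_mult mult.assoc)
    also have "\<dots> = tr (adj A * (quat j * B * adj (quat i)))" by (rule tr_commute)
    finally show ?thesis by (simp add: mult.assoc)
  qed
  then show ?thesis
    by (intro eq_matI) (auto simp: pi_mat_index coord_def)
qed

lemma mat_trace_pi_mat: "mat_trace (pi_mat A B) = tr A * tr B"
  by (simp add: mat_trace_def sum4 pi_mat_index quat_simps coord_simps
      m2_simps field_simps)

lemma pi_mat_orthogonal:
  assumes "dt A = 1" "dt B = 1"
  shows "pi_mat A B * transpose_mat (pi_mat A B) = 1\<^sub>m 4"
  using assms by (simp add: pi_mat_transpose pi_mat_mult mult_adj pi_mat_one)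

text \<open>The determinant of an orthogonal matrix is a sign, and elementary matrices are squares, so
  the images of products of elementary matrices have determinant one.\<close>

lemma det_pi_mat:
  assumes "dt A = 1" "dt B = 1"
  shows "det (pi_mat A B) = 1"
proof -
  have mult: "det (pi_mat (A * C) (B * D)) = det (pi_mat A B) * det (pi_mat C D)" for A B C D
    by (simp add: pi_mat_mult[symmetric] det_mult[of _ 4])
  have sq: "det (pi_mat A B) * det (pi_mat A B) = 1" if "dt A = 1" "dt B = 1" for A B
    using arg_cong[OF pi_mat_orthogonal[OF that], of det]
    by (simp add: det_mult[of _ 4] det_transpose[of _ 4])
  have up: "upper a = upper (a / 2) * upper (a / 2)" and low: "lower a = lower (a / 2) * lower (a /
      2)" for a
    by (simp_all add: upper_def lower_def m2_simps)
  have "det (pi_mat (upper a) (upper b)) = 1" "det (pi_mat (lower a) (lower b)) = 1" for a b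
    by (subst up, subst (2) up, simp add: mult sq) (subst low, subst (2) low, simp add: mult sq)
  then have "det (pi_mat (elem_prod a b c d) (elem_prod a' b' c' d')) = 1" for a b c d a' b' c' d'
    by (simp add: elem_prod_def mult)
  then show ?thesis using elem_prod_surj[OF assms(1)] elem_prod_surj[OF assms(2)] by metis
qed

lemma pi_mat_SO: "dt A = 1 \<Longrightarrow> dt B = 1 \<Longrightarrow> pi_mat A B \<in> carrier (SO 4)"
  by (simp add: SO_def pi_mat_orthogonal det_pi_mat)


section \<open>Surjectivity of the double cover\<close>

lemma dt_vec2: "dt (vec2 v) = (\<Sum>i<4. v i * v i)"
  by (simp add: vec2_def dt_def sum4 algebra_simps)

lemma tr_adj_vec2: "tr (adj (vec2 u) * vec2 v) = 2 * (\<Sum>i<4. u i * v i)"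
  by (simp add: vec2_def m2_simps sum4 algebra_simps)

text \<open>A case of the Skolem-Noether theorem: orthonormal imaginary quaternions \<open>I\<close>, \<open>J\<close>, \<open>K\<close> are
  conjugate to the standard units, up to the sign of \<open>K\<close>. An eigenvector of \<open>I\<close> for the eigenvalue
  \<open>\<i>\<close>, followed by its image under \<open>- J\<close>, gives the columns of the conjugating matrix.\<close>

lemma quaternion_frame:
  assumes I: "tr I = 0" "dt I = 1" and J: "tr J = 0" "dt J = 1" and K: "tr K = 0" "dt K = 1"
    and o: "tr (adj I * J) = 0" "tr (adj I * K) = 0" "tr (adj J * K) = 0"
  obtains p c where "dt p = 1" "I * p = p * quat 1" "J * p = p * quat 2" "K * p = scale_m2 c (p *
      quat 3)" "c\<^sup>2 = 1"
proof -
  obtain a b c where I': "I = M2 a b c (- a)"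
    using I(1) by (cases I) (auto simp: m2_simps add_eq_0_iff)
  have I2: "- (a * a) - b * c = 1" using I(2) by (simp add: I' m2_simps)
  have "(a - \<i>) * (- a - \<i>) = b * c" using I2 by (simp add: algebra_simps)
  then obtain v w where vw: "v \<noteq> 0 \<or> w \<noteq> 0" and "(a - \<i>) * v + b * w = 0" "c * v + (- a - \<i>) * w =
      0"
    by (rule singular_kernel)
  then have ev: "a * v + b * w = \<i> * v" "c * v - a * w = \<i> * w" by (auto simp: algebra_simps)
  obtain k l m where J': "J = M2 k l m (- k)"
    using J(1) by (cases J) (auto simp: m2_simps add_eq_0_iff)
  have J2: "- (k * k) - l * m = 1" using J(2) by (simp add: J' m2_simps)
  have eq: "- (b * m) - c * l = 2 * (a * k)" using o(1) by (simp add: I' J' m2_simps)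
  have "2 * a * k + b * m + c * l = 2 * (a * k) - (- (b * m) - c * l)" by simp
  also have "\<dots> = 0" unfolding eq by simp
  finally have IJ: "2 * a * k + b * m + c * l = 0" .
  define q where "q = M2 v (- (k * v + l * w)) w (- (m * v - k * w))"
  have J2': "k * k + l * m = - 1" using J2 by (metis add_uminus_conv_diff minus_add_distrib
      minus_minus)
  have "k * (k * v + l * w) + l * (m * v - k * w) = (k * k + l * m) * v"
    "m * (k * v + l * w) - k * (m * v - k * w) = (k * k + l * m) * w" by (simp_all add:
        algebra_simps)
  then have Jq1: "k * (k * v + l * w) + l * (m * v - k * w) = - v" "m * (k * v + l * w) - k * (m * v
      - k * w) = - w"
    by (simp_all add: J2')
  have "a * (k * v + l * w) + b * (m * v - k * w) + (k * (a * v + b * w) + l * (c * v - a * w))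
      = (2 * a * k + b * m + c * l) * v"
    "c * (k * v + l * w) - a * (m * v - k * w) + (m * (a * v + b * w) - k * (c * v - a * w))
      = (2 * a * k + b * m + c * l) * w" by (simp_all add: algebra_simps)
  then have Iq2: "a * (k * v + l * w) + b * (m * v - k * w) = - (\<i> * (k * v + l * w))"
      "c * (k * v + l * w) - a * (m * v - k * w) = - (\<i> * (m * v - k * w))"
    unfolding IJ ev by (simp_all add: algebra_simps eq_neg_iff_add_eq_0 add_eq_0_iff)
  define x y where "x = - (k * v + l * w)" and "y = - (m * v - k * w)"
  have q: "q = M2 v x w y" by (simp add: q_def x_def y_def)
  have "k * x + l * y = - (k * (k * v + l * w) + l * (m * v - k * w))"
    "m * x - k * y = - (m * (k * v + l * w) - k * (m * v - k * w))"
    by (simp_all add: x_def y_def algebra_simps)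
  then have Jxy: "k * x + l * y = v" "m * x - k * y = w" unfolding Jq1 by simp_all
  have Jq: "J * q = q * quat 2"
    using Jxy by (intro m2_eqI) (simp_all add: J' q quat_simps m2_simps, simp_all add: x_def y_def)
  have "a * x + b * y = - (a * (k * v + l * w) + b * (m * v - k * w))"
    "c * x - a * y = - (c * (k * v + l * w) - a * (m * v - k * w))"
    by (simp_all add: x_def y_def algebra_simps)
  moreover have "\<i> * (k * v + l * w) = - (\<i> * x)" "\<i> * (m * v - k * w) = - (\<i> * y)"
    by (simp_all add: x_def y_def algebra_simps)
  ultimately have Ixy: "a * x + b * y = - (\<i> * x)" "c * x - a * y = - (\<i> * y)"
    unfolding Iq2 by simp_all
  have Iq: "I * q = q * quat 1"
    using ev Ixy by (intro m2_eqI) (simp_all add: I' q quat_simps m2_simps mult.commute)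
  have "dt q \<noteq> 0"
  proof
    \<comment> \<open>The columns of \<open>q\<close> are eigenvectors of \<open>I\<close> for the distinct eigenvalues \<open>\<i>\<close> and \<open>-\<i>\<close>.\<close>
    assume "dt q = 0"
    then have "v * (- (m * v - k * w)) = (- (k * v + l * w)) * w"
      by (simp add: q_def m2_simps)
    then obtain \<alpha> \<beta> where nz: "\<alpha> \<noteq> 0 \<or> \<beta> \<noteq> 0"
      and "v * \<alpha> + (- (k * v + l * w)) * \<beta> = 0" "w * \<alpha> + (- (m * v - k * w)) * \<beta> = 0"
      by (rule singular_kernel)
    then have eq: "\<alpha> * v = \<beta> * (k * v + l * w)" "\<alpha> * w = \<beta> * (m * v - k * w)"
      by (simp_all add: algebra_simps)
    have "\<i> * (\<alpha> * v) = \<alpha> * (a * v + b * w)" "\<i> * (\<alpha> * w) = \<alpha> * (c * v - a * w)"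
      using ev by (simp_all add: algebra_simps)
    then have "\<i> * (\<alpha> * v) = a * (\<alpha> * v) + b * (\<alpha> * w)" "\<i> * (\<alpha> * w) = c * (\<alpha> * v) - a * (\<alpha> * w)"
      by (simp_all add: algebra_simps)
    then have "\<i> * (\<alpha> * v) = \<beta> * (a * (k * v + l * w) + b * (m * v - k * w))"
      "\<i> * (\<alpha> * w) = \<beta> * (c * (k * v + l * w) - a * (m * v - k * w))"
      unfolding eq by (simp_all add: algebra_simps)
    then have "\<i> * (\<alpha> * v) = - (\<i> * (\<beta> * (k * v + l * w)))" "\<i> * (\<alpha> * w) = - (\<i> * (\<beta> * (m * v - k *
        w)))"
      unfolding Iq2 by (simp_all add: algebra_simps)
    then have z: "\<alpha> * v = 0" "\<alpha> * w = 0" "\<beta> * (k * v + l * w) = 0" "\<beta> * (m * v - k * w) = 0"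
      using eq by auto
    then have "\<alpha> = 0" using vw by auto
    then have "k * v + l * w = 0" "m * v - k * w = 0" using nz z by auto
    then show False using vw Jq1 by simp
  qed
  then obtain e where e: "dt (scale_m2 e q) = 1" by (rule normalise_dt)
  define p where "p = scale_m2 e q"
  have p: "dt p = 1" "I * p = p * quat 1" "J * p = p * quat 2"
    using e Iq Jq by (simp_all add: p_def scale_m2_mult)
  \<comment> \<open>\<open>K\<close> becomes orthogonal to the units other than the last, hence a multiple of that one.\<close>
  define K' where "K' = adj p * K * p"
  have Ip: "I = p * quat 1 * adj p" and Jp: "J = p * quat 2 * adj p"
    using p by (metis mult.assoc mult_adj mult.right_neutral)+
  have "tr (adj (quat 1) * K') = 0" "tr (adj (quat 2) * K') = 0"
    using o(2,3) p(1) unfolding Ip Jp K'_def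
    by (simp_all add: adj_mult mult.assoc tr_commute[of p])
  moreover have "tr K' = 0"
    using K(1) p(1) by (simp add: K'_def tr_commute[of _ p] mult.assoc[symmetric] mult_adj)
  ultimately have "e11 K' = 0" "e22 K' = 0" "e12 K' = e21 K'"
    by (simp_all add: quat_simps m2_simps complex_eq_iff)
  then have K'c: "K' = scale_m2 (- \<i> * e12 K') (quat 3)"
    by (intro m2_eqI) (simp_all add: quat_simps scale_m2_def mult_ac)
  have "dt K' = 1" using K(2) p(1) by (simp add: K'_def dt_mult)
  then have "(- \<i> * e12 K')\<^sup>2 = 1"
    by (subst (asm) K'c) (simp add: dt_scale_m2, simp add: quat_simps m2_simps)
  moreover have "K * p = scale_m2 (- \<i> * e12 K') (p * quat 3)"
    using p(1) unfolding scale_m2_mult(2)[symmetric] K'c[symmetric]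
    by (simp add: K'_def mult.assoc mult_adj_cancel)
  ultimately show thesis using that p by blast
qed

text \<open>After a translation by the image \<open>q\<close> of the unit quaternion, a rotation fixes \<open>1\<close> and
  carries the imaginary units to an orthonormal frame, so by the preceding lemma it is a
  conjugation up to a sign of the last unit. That sign is the determinant.\<close>

lemma pi_mat_surj:
  assumes "R \<in> carrier (SO 4)"
  obtains A B where "dt A = 1" "dt B = 1" "R = pi_mat A B"
proof -
  have R: "R \<in> carrier_mat 4 4" and RRt: "R * transpose_mat R = 1\<^sub>m 4" and detR: "det R = 1"
    using assms by (auto simp: SO_def)
  have "transpose_mat R * R = 1\<^sub>m 4"
    using mat_mult_left_right_inverse[OF R _ RRt] R by simp
  then have RtR: "(transpose_mat R * R) $$ (i, j) = (1\<^sub>m 4 :: complex mat) $$ (i, j)" for i j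
    by simp
  have orth: "(\<Sum>k<4. R $$ (k, i) * R $$ (k, j)) = (if i = j then 1 else 0)" if "i < 4" "j < 4" for i
      j
    using RtR[of i j] R that by (simp add: scalar_prod_def lessThan_atLeast0)
  define W where "W j = vec2 (\<lambda>i. R $$ (i, j))" for j
  define q where "q = W 0"
  have q: "dt q = 1" by (simp add: q_def W_def dt_vec2 orth)
  have t0: "tr (adj q * W j) = 0" if "j < 4" "j \<noteq> 0" for j
    using that by (simp add: q_def W_def tr_adj_vec2 orth)
  have d: "dt (adj q * W j) = 1" if "j < 4" for j
    using that q by (simp add: dt_mult) (simp add: W_def dt_vec2 orth)
  have o: "tr (adj (adj q * W i) * (adj q * W j)) = 0" if "i < 4" "j < 4" "i \<noteq> j" for i j
  proof -
    have "adj (adj q * W i) * (adj q * W j) = adj (W i) * W j"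
      using q by (simp add: adj_mult mult.assoc mult_adj_cancel)
    then show ?thesis using that by (simp add: W_def tr_adj_vec2 orth)
  qed
  obtain p c where p: "dt p = 1" "adj q * W 1 * p = p * quat 1" "adj q * W 2 * p = p * quat 2"
      "adj q * W 3 * p = scale_m2 c (p * quat 3)" "c\<^sup>2 = 1"
    by (rule quaternion_frame[of "adj q * W 1" "adj q * W 2" "adj q * W 3"]) (simp_all add: t0 d o)
  define \<epsilon> where "\<epsilon> j = (if j = 3 then c else 1)" for j :: nat
  have "W j = scale_m2 (\<epsilon> j) (q * p * quat j * adj p)" if "j < 4" for j
  proof -
    have "W j = q * (adj q * W j * p) * adj p"
      using q p(1) by (simp add: mult.assoc mult_adj mult_adj_cancel)
    also have "adj q * W j * p = scale_m2 (\<epsilon> j) (p * quat j)"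
      using that p q by (auto simp: less4 \<epsilon>_def quat_simps scale_m2_def q_def adj_mult_self)
    finally show ?thesis by (simp add: scale_m2_mult mult.assoc)
  qed
  then have W: "coord (W j) i = coord (q * p * quat j * adj p) i * \<epsilon> j" if "j < 4" for i j
    using that by (simp add: coord_def scale_m2_mult) (simp add: scale_m2_def tr_def algebra_simps)
  define D where "D = mat 4 4 (\<lambda>(i, j). if i = j then \<epsilon> j else 0)"
  have "R = pi_mat (q * p) p * D"
  proof (rule eq_matI)
    fix i j assume "i < dim_row (pi_mat (q * p) p * D)" "j < dim_col (pi_mat (q * p) p * D)"
    then have ij: "i < 4" "j < 4" by (auto simp: D_def)
    have "(pi_mat (q * p) p * D) $$ (i, j) = (\<Sum>k<4. pi_mat (q * p) p $$ (i, k) * D $$ (k, j))"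
      using ij by (simp add: scalar_prod_def lessThan_atLeast0 D_def)
    also have "\<dots> = (\<Sum>k<4. if k = j then pi_mat (q * p) p $$ (i, k) * \<epsilon> j else 0)"
      using ij by (intro sum.cong) (auto simp: D_def)
    also have "\<dots> = R $$ (i, j)"
      using ij W[of j i] by (simp add: pi_mat_index W_def coord_vec2)
    finally show "R $$ (i, j) = (pi_mat (q * p) p * D) $$ (i, j)" by simp
  qed (use R in \<open>auto simp: D_def\<close>)
  moreover have "det (pi_mat (q * p) p) = 1"
    using q p(1) by (intro det_pi_mat) (simp_all add: dt_mult)
  moreover have "det D = c"
  proof -
    have "det D = prod_list (diag_mat D)"
      by (rule det_upper_triangular[of _ 4]) (auto simp: D_def)
    also have "\<dots> = c"
      by (simp add: diag_mat_def D_def \<epsilon>_def numeral_eq_Suc)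
    finally show ?thesis .
  qed
  ultimately have "c = 1" using detR by (simp add: det_mult[of _ 4] D_def)
  then have "D = 1\<^sub>m 4" by (intro eq_matI) (auto simp: D_def \<epsilon>_def)
  then have "R = pi_mat (q * p) p" using \<open>R = pi_mat (q * p) p * D\<close> by simp
  then show thesis using q p(1) by (intro that) (simp_all add: dt_mult)
qed

section \<open>The function \<open>Q\<^sub>4\<close> on the double cover\<close>

lemma Q4_expand:
  "Q4 A B = 4 *
    ((A $$ (0, 1) - A $$ (1, 0)) * (B $$ (2, 3) - B $$ (3, 2))
   - (A $$ (0, 2) - A $$ (2, 0)) * (B $$ (1, 3) - B $$ (3, 1))
   + (A $$ (0, 3) - A $$ (3, 0)) * (B $$ (1, 2) - B $$ (2, 1))
   + (A $$ (1, 2) - A $$ (2, 1)) * (B $$ (0, 3) - B $$ (3, 0))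
   - (A $$ (1, 3) - A $$ (3, 1)) * (B $$ (0, 2) - B $$ (2, 0))
   + (A $$ (2, 3) - A $$ (3, 2)) * (B $$ (0, 1) - B $$ (1, 0)))"
proof -
  have S: "{0..<4} = {0, 1, 2, 3::nat}" by auto
  have f: "finite {1, 2, 3::nat}" "0 \<notin> {1, 2, 3::nat}" "finite {2, 3::nat}" "1 \<notin> {2, 3::nat}"
    "finite {3::nat}" "2 \<notin> {3::nat}" by auto
  show ?thesis
    unfolding Q4_def S sum_over_permutations_insert[OF f(1,2)] sum_over_permutations_insert[OF
        f(3,4)]
      sum_over_permutations_insert[OF f(5,6)] permutes_sing
    by (simp add: sign_swap_id permutation_swap_id sign_compose transpose_def permutation_compose)
      (simp add: algebra_simps)
qed

text \<open>In lifted form \<open>Q\<^sub>4\<close> is a difference of two terms that are exchanged when the two factors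
  of the double cover are exchanged: the skew part of \<open>pi_mat A B\<close> is a pair of traceless
  matrices, and \<open>Q\<^sub>4\<close> is, up to a constant, the difference of the trace forms of the two
  components.\<close>

lemma Q4_pi_mat:
  "Q4 (pi_mat A B) (pi_mat C D) = 4 * (tr A * tr C * tr (B * D) - tr B * tr D * tr (A * C))"
  unfolding Q4_expand
  by (simp add: pi_mat_index quat_simps coord_simps) (simp add: m2_simps field_simps)

section \<open>Polynomial functions\<close>

text \<open>Polynomial functions on the whole type are easier to combine than the restricted functions
  of \<open>generated_alg X F\<close>, which are exactly their restrictions.\<close>

abbreviation polys :: "('x \<Rightarrow> complex) set \<Rightarrow> ('x \<Rightarrow> complex) set" where
  "polys \<equiv> generated_alg UNIV"

lemma restrict_to_UNIV [simp]: "restrict f UNIV = f"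
  by (simp add: restrict_def)

lemma polys_const: "(\<lambda>x. c) \<in> polys F"
  using generated_alg.const[of c UNIV F] by simp

lemma polys_gen: "f \<in> F \<Longrightarrow> f \<in> polys F"
  using generated_alg.gen[of f F UNIV] by simp

lemma polys_add: "f \<in> polys F \<Longrightarrow> g \<in> polys F \<Longrightarrow> (\<lambda>x. f x + g x) \<in> polys F"
  using generated_alg.add[of f UNIV F g] by simp

lemma polys_mult: "f \<in> polys F \<Longrightarrow> g \<in> polys F \<Longrightarrow> (\<lambda>x. f x * g x) \<in> polys F"
  using generated_alg.mult[of f UNIV F g] by simp

lemma polys_uminus: "f \<in> polys F \<Longrightarrow> (\<lambda>x. - f x) \<in> polys F"
  using polys_mult[OF polys_const[of "- 1"]] by simp

lemma polys_diff: "f \<in> polys F \<Longrightarrow> g \<in> polys F \<Longrightarrow> (\<lambda>x. f x - g x) \<in> polys F"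
  using polys_add[OF _ polys_uminus, of f F g] by simp

lemma polys_power: "f \<in> polys F \<Longrightarrow> (\<lambda>x. f x ^ n) \<in> polys F"
  by (induction n) (auto intro: polys_const polys_mult)

lemma polys_divide_const: "f \<in> polys F \<Longrightarrow> (\<lambda>x. f x / c) \<in> polys F"
  using polys_mult[OF _ polys_const[of "inverse c"]] by (simp add: divide_inverse)

lemmas polys_intros = polys_const polys_gen polys_add polys_mult polys_uminus polys_diff polys_power
  polys_divide_const

lemma polys_induct [consumes 1, case_names const gen add mult]:
  assumes "f \<in> polys F"
    and "\<And>c. P (\<lambda>x. c)" and "\<And>f. f \<in> F \<Longrightarrow> P f"
    and "\<And>f g. f \<in> polys F \<Longrightarrow> g \<in> polys F \<Longrightarrow> P f \<Longrightarrow> P g \<Longrightarrow> P (\<lambda>x. f x + g x)"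
    and "\<And>f g. f \<in> polys F \<Longrightarrow> g \<in> polys F \<Longrightarrow> P f \<Longrightarrow> P g \<Longrightarrow> P (\<lambda>x. f x * g x)"
  shows "P f"
  using assms(1) by (induction rule: generated_alg.induct) (use assms(2-) in simp_all)

lemma generated_alg_iff: "f \<in> generated_alg X F \<longleftrightarrow> (\<exists>g\<in>polys F. f = restrict g X)"
proof
  show "\<exists>g\<in>polys F. f = restrict g X" if "f \<in> generated_alg X F"
    using that
  proof induction
    case (add f g)
    then obtain f' g' where *: "f' \<in> polys F" "g' \<in> polys F" "f = restrict f' X" "g = restrict g' X"
      by blast
    then have "(\<lambda>x\<in>X. f x + g x) = (\<lambda>x\<in>X. f' x + g' x)" by (auto simp: restrict_def fun_eq_iff)
    then show ?case using polys_add[OF *(1,2)] by auto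
  next
    case (mult f g)
    then obtain f' g' where *: "f' \<in> polys F" "g' \<in> polys F" "f = restrict f' X" "g = restrict g' X"
      by blast
    then have "(\<lambda>x\<in>X. f x * g x) = (\<lambda>x\<in>X. f' x * g' x)" by (auto simp: restrict_def fun_eq_iff)
    then show ?case using polys_mult[OF *(1,2)] by auto
  qed (blast intro: polys_const polys_gen)+
  show "f \<in> generated_alg X F" if "\<exists>g\<in>polys F. f = restrict g X"
  proof -
    from that obtain g where g: "g \<in> polys F" "f = restrict g X" by blast
    from g(1) have "restrict g X \<in> generated_alg X F"
    proof (induction rule: polys_induct)
      case (add f g)
      then have "(\<lambda>x\<in>X. restrict f X x + restrict g X x) \<in> generated_alg X F"
        by (blast intro: generated_alg.add)
      also have "(\<lambda>x\<in>X. restrict f X x + restrict g X x) = (\<lambda>x\<in>X. f x + g x)"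
        by (auto simp: restrict_def fun_eq_iff)
      finally show ?case .
    next
      case (mult f g)
      then have "(\<lambda>x\<in>X. restrict f X x * restrict g X x) \<in> generated_alg X F"
        by (blast intro: generated_alg.mult)
      also have "(\<lambda>x\<in>X. restrict f X x * restrict g X x) = (\<lambda>x\<in>X. f x * g x)"
        by (auto simp: restrict_def fun_eq_iff)
      finally show ?case .
    next
      case (const c)
      show ?case by (rule generated_alg.const)
    next
      case (gen f)
      then show ?case by (rule generated_alg.gen)
    qed
    then show ?thesis using g by simp
  qed
qed

lemma polys_subst:
  "g \<in> polys F \<Longrightarrow> (\<And>f. f \<in> F \<Longrightarrow> (\<lambda>y. f (h y)) \<in> polys G) \<Longrightarrow> (\<lambda>y. g (h y)) \<in> polys G"
  by (induction rule: polys_induct) (auto intro: polys_intros)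

lemma polys_subset: "g \<in> polys F \<Longrightarrow> F \<subseteq> polys G \<Longrightarrow> g \<in> polys G"
  using polys_subst[of g F "\<lambda>x. x" G] by auto

lemma polys_descend:
  "g \<in> polys ((\<lambda>f y. f (h y)) ` F) \<Longrightarrow> \<exists>g'\<in>polys F. g = (\<lambda>y. g' (h y))"
proof (induction rule: polys_induct)
  case (const c)
  show ?case by (intro bexI[of _ "\<lambda>x. c"] polys_const) simp
next
  case (gen f)
  then show ?case by (auto intro: polys_gen)
next
  case (add f g)
  then obtain f' g' where "f' \<in> polys F" "f = (\<lambda>y. f' (h y))" "g' \<in> polys F" "g = (\<lambda>y. g' (h y))" by
      blast
  then show ?case by (intro bexI[of _ "\<lambda>x. f' x + g' x"] polys_add) auto
next
  case (mult f g)
  then obtain f' g' where "f' \<in> polys F" "f = (\<lambda>y. f' (h y))" "g' \<in> polys F" "g = (\<lambda>y. g' (h y))" by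
      blast
  then show ?case by (intro bexI[of _ "\<lambda>x. f' x * g' x"] polys_mult) auto
qed

lemma polys_invariant:
  "g \<in> polys F \<Longrightarrow> (\<And>f. f \<in> F \<Longrightarrow> f x = f y) \<Longrightarrow> g x = g y"
  by (induction rule: polys_induct) auto

lemma polys_poly: "f \<in> polys {\<lambda>t. t} \<Longrightarrow> \<exists>p. f = poly p"
proof (induction rule: polys_induct)
  case (const c)
  then show ?case by (intro exI[of _ "[:c:]"]) auto
next
  case (gen f)
  then show ?case by (intro exI[of _ "[:0, 1:]"]) auto
next
  case (add f g)
  then obtain p q where "f = poly p" "g = poly q" by blast
  then show ?case by (intro exI[of _ "p + q"]) auto
next
  case (mult f g)
  then obtain p q where "f = poly p" "g = poly q" by blast
  then show ?case by (intro exI[of _ "p * q"]) auto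
qed

text \<open>With \<open>u v = 1\<close>, every Laurent polynomial in \<open>u\<close> is \<open>a + b u\<close> with \<open>a\<close> and \<open>b\<close> polynomial
  in \<open>u + v\<close>. If it is symmetric in \<open>u\<close> and \<open>v\<close>, it equals its average \<open>a + b (u + v) / 2\<close> over
  the exchange. In the application the symmetry comes from conjugacy of matrices and is known on
  the set \<open>Y\<close> of irreducible parameters.\<close>

lemma polys_involution:
  assumes g: "g \<in> polys (insert u (insert v F))"
    and \<tau>: "\<And>y. y \<in> Y \<Longrightarrow> \<tau> y \<in> Y"
    and uv: "\<And>y. y \<in> Y \<Longrightarrow> u y * v y = 1"
    and swap: "\<And>y. y \<in> Y \<Longrightarrow> u (\<tau> y) = v y" "\<And>y. y \<in> Y \<Longrightarrow> v (\<tau> y) = u y"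
    and inv: "\<And>f y. f \<in> F \<Longrightarrow> y \<in> Y \<Longrightarrow> f (\<tau> y) = f y" "\<And>y. y \<in> Y \<Longrightarrow> g (\<tau> y) = g y"
  shows "\<exists>h\<in>polys (insert (\<lambda>y. u y + v y) F). \<forall>y\<in>Y. g y = h y"
proof -
  let ?P = "polys (insert (\<lambda>y. u y + v y) F)"
  have s: "(\<lambda>y. u y + v y) \<in> ?P" by (rule polys_gen) simp
  have "\<exists>a\<in>?P. \<exists>b\<in>?P. \<forall>y\<in>Y. g y = a y + b y * u y"
    using g
  proof (induction rule: polys_induct)
    case (const c)
    then show ?case by (intro bexI[of _ "\<lambda>y. c"] bexI[of _ "\<lambda>y. 0"]) (auto intro: polys_intros)
  next
    case (gen f)
    then consider "f = u" | "f = v" | "f \<in> F" by blast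
    then show ?case
    proof cases
      case 1
      then show ?thesis by (intro bexI[of _ "\<lambda>y. 0"] bexI[of _ "\<lambda>y. 1"]) (auto intro: polys_intros)
    next
      case 2
      then show ?thesis by (intro bexI[of _ "\<lambda>y. u y + v y"] bexI[of _ "\<lambda>y. - 1"] s) (auto intro:
          polys_intros)
    next
      case 3
      then show ?thesis by (intro bexI[of _ f] bexI[of _ "\<lambda>y. 0"]) (auto intro: polys_intros)
    qed
  next
    case (add f g)
    then obtain a b a' b' where *: "a \<in> ?P" "b \<in> ?P" "a' \<in> ?P" "b' \<in> ?P"
      "\<forall>y\<in>Y. f y = a y + b y * u y" "\<forall>y\<in>Y. g y = a' y + b' y * u y" by blast
    show ?case
      by (rule bexI[of _ "\<lambda>y. a y + a' y"], rule bexI[of _ "\<lambda>y. b y + b' y"])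
        (use * in \<open>auto simp: algebra_simps intro: polys_add\<close>)
  next
    case (mult f g)
    then obtain a b a' b' where *: "a \<in> ?P" "b \<in> ?P" "a' \<in> ?P" "b' \<in> ?P"
      "\<forall>y\<in>Y. f y = a y + b y * u y" "\<forall>y\<in>Y. g y = a' y + b' y * u y" by blast
    have eq: "f y * g y = (a y * a' y - b y * b' y)
        + (a y * b' y + a' y * b y + b y * b' y * (u y + v y)) * u y" if "y \<in> Y" for y
    proof -
      have "b y * b' y * (u y * v y) = b y * b' y" using uv[OF that] by simp
      then show ?thesis using * that by (simp add: algebra_simps)
    qed
    have m1: "(\<lambda>y. a y * a' y - b y * b' y) \<in> ?P" using * by (intro polys_diff polys_mult)
    have m2: "(\<lambda>y. a y * b' y + a' y * b y + b y * b' y * (u y + v y)) \<in> ?P"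
      using * by (intro polys_add[OF polys_add[OF polys_mult polys_mult] polys_mult[OF polys_mult
          s]])
    show ?case
    proof (intro bexI ballI)
      fix y assume "y \<in> Y"
      then show "f y * g y = (a y * a' y - b y * b' y)
        + (a y * b' y + a' y * b y + b y * b' y * (u y + v y)) * u y" by (rule eq)
    qed (rule m1 m2)+
  qed
  then obtain a b where ab: "a \<in> ?P" "b \<in> ?P" and g_eq: "\<And>y. y \<in> Y \<Longrightarrow> g y = a y + b y * u y" by blast
  have ab_inv: "a (\<tau> y) = a y" "b (\<tau> y) = b y" if "y \<in> Y" for y
    using that by (auto intro!: polys_invariant[OF ab(1)] polys_invariant[OF ab(2)] simp: swap inv)
  have "g y = a y + b y * (u y + v y) / 2" if y: "y \<in> Y" for y
  proof -
    have "2 * g y = g y + g (\<tau> y)" using inv(2)[OF y] by simp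
    also have "\<dots> = 2 * a y + b y * (u y + v y)"
      using y \<tau>[OF y] by (simp add: g_eq swap ab_inv algebra_simps)
    finally show ?thesis by (simp add: field_simps)
  qed
  moreover have "(\<lambda>y. a y + b y * (u y + v y) / 2) \<in> ?P"
    by (rule polys_add[OF ab(1) polys_divide_const[OF polys_mult[OF ab(2) s]]])
  ultimately show ?thesis by (intro bexI[of _ "\<lambda>y. a y + b y * (u y + v y) / 2"]) auto
qed

section \<open>Conjugation invariants of two pairs of matrices\<close>

type_synonym triple = "complex \<times> complex \<times> complex"

definition SL2_pairs :: "(m2 \<times> m2) set" where
  "SL2_pairs = {(A, B). dt A = 1 \<and> dt B = 1}"

definition conj2 :: "m2 \<Rightarrow> m2 \<times> m2 \<Rightarrow> m2 \<times> m2" where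
  "conj2 G = (\<lambda>(A, B). (G * A * adj G, G * B * adj G))"

text \<open>The coordinates of Fricke and Vogt on the character variety of \<open>F\<^sub>2\<close> in \<open>SL\<^sub>2\<close>.\<close>

definition trs :: "m2 \<times> m2 \<Rightarrow> triple" where
  "trs = (\<lambda>(A, B). (tr A, tr B, tr (A * B)))"

text \<open>This is the trace of the commutator minus two; it vanishes exactly at the reducible
  pairs.\<close>

definition disc :: "triple \<Rightarrow> complex" where
  "disc = (\<lambda>(x, y, z). x * x + y * y + z * z - x * y * z - 4)"

lemma dt_commutator:
  assumes "dt A = 1" "dt B = 1"
  shows "dt (A * B - B * A) = - disc (trs (A, B))"
proof -
  have "dt (A * B - B * A) = 4 * dt A * dt B - tr A * tr A * dt B - tr B * tr B * dt A
      - tr (A * B) * tr (A * B) + tr A * tr B * tr (A * B)"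
    by (simp add: m2_simps algebra_simps)
  then show ?thesis using assms by (simp add: disc_def trs_def algebra_simps)
qed

lemma common_eigenvector:
  assumes "dt A = 1" "dt B = 1" and nz: "v \<noteq> 0 \<or> w \<noteq> 0"
    and A: "e11 A * v + e12 A * w = \<alpha> * v" "e21 A * v + e22 A * w = \<alpha> * w"
    and B: "e11 B * v + e12 B * w = \<beta> * v" "e21 B * v + e22 B * w = \<beta> * w"
  shows "disc (trs (A, B)) = 0"
proof -
  define C where "C = A * B - B * A"
  have "e11 C * v + e12 C * w
      = e11 A * (\<beta> * v) + e12 A * (\<beta> * w) - (e11 B * (\<alpha> * v) + e12 B * (\<alpha> * w))"
    unfolding A[symmetric] B[symmetric] by (simp add: C_def m2_simps algebra_simps)
  also have "\<dots> = \<beta> * (e11 A * v + e12 A * w) - \<alpha> * (e11 B * v + e12 B * w)"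
    by (simp add: algebra_simps)
  also have "\<dots> = 0" unfolding A B by simp
  finally have 1: "e11 C * v + e12 C * w = 0" .
  have "e21 C * v + e22 C * w
      = e21 A * (\<beta> * v) + e22 A * (\<beta> * w) - (e21 B * (\<alpha> * v) + e22 B * (\<alpha> * w))"
    unfolding A[symmetric] B[symmetric] by (simp add: C_def m2_simps algebra_simps)
  also have "\<dots> = \<beta> * (e21 A * v + e22 A * w) - \<alpha> * (e21 B * v + e22 B * w)"
    by (simp add: algebra_simps)
  also have "\<dots> = 0" unfolding A B by simp
  finally have 2: "e21 C * v + e22 C * w = 0" .
  have "dt C * v = e22 C * (e11 C * v + e12 C * w) - e12 C * (e21 C * v + e22 C * w)"
    "dt C * w = e11 C * (e21 C * v + e22 C * w) - e21 C * (e11 C * v + e12 C * w)"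
    by (simp_all add: dt_def algebra_simps)
  then have "dt C = 0" using nz unfolding 1 2 by auto
  then show ?thesis using dt_commutator[OF assms(1,2)] by (simp add: C_def)
qed

text \<open>A normal form for irreducible pairs: eigenvectors of the first matrix for \<open>l\<close> and of the
  second for \<open>1 / m\<close> form the basis.\<close>

definition slice :: "triple \<Rightarrow> m2 \<times> m2" where
  "slice = (\<lambda>(l, m, z). (M2 l 1 0 (1 / l), M2 m 0 (z - l * m - 1 / l * (1 / m)) (1 / m)))"

definition slice_trs :: "triple \<Rightarrow> triple" where
  "slice_trs = (\<lambda>(l, m, z). (l + 1 / l, m + 1 / m, z))"

lemma slice_SL2: "l \<noteq> 0 \<Longrightarrow> m \<noteq> 0 \<Longrightarrow> slice (l, m, z) \<in> SL2_pairs"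
  by (simp add: slice_def SL2_pairs_def dt_def)

lemma trs_slice: "l \<noteq> 0 \<Longrightarrow> m \<noteq> 0 \<Longrightarrow> trs (slice (l, m, z)) = slice_trs (l, m, z)"
  by (simp add: slice_def trs_def slice_trs_def m2_simps)

lemma inverse_sum_surj:
  fixes x :: complex
  obtains l where "l \<noteq> 0" "l + 1 / l = x"
proof -
  obtain r where "r\<^sup>2 = x\<^sup>2 - 4" using power2_csqrt by metis
  then have eq: "(x + r) / 2 * ((x - r) / 2) = 1" by (simp add: power2_eq_square algebra_simps)
  then have nz: "(x + r) / 2 \<noteq> 0" by auto
  then have "1 / ((x + r) / 2) = (x - r) / 2"
    using eq by (metis nonzero_mult_div_cancel_left)
  then have "(x + r) / 2 + 1 / ((x + r) / 2) = x" by (simp add: field_simps)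
  then show thesis using nz that by blast
qed

lemma trs_surj: "\<exists>a\<in>SL2_pairs. trs a = t"
proof -
  obtain x y z where t: "t = (x, y, z)" by (metis surj_pair)
  obtain l m where "l \<noteq> 0" "l + 1 / l = x" "m \<noteq> 0" "m + 1 / m = y" using inverse_sum_surj by metis
  then show ?thesis
    by (intro bexI[of _ "slice (l, m, z)"]) (auto simp: t trs_slice slice_trs_def slice_SL2)
qed

text \<open>The eigenvalues \<open>l\<close> and \<open>m\<close> can be chosen freely among the two of each matrix. This
  freedom is the source of the symmetry under \<open>l \<mapsto> 1 / l\<close> and \<open>m \<mapsto> 1 / m\<close> that invariant functions
  have on the slice.\<close>

lemma conj_slice:
  assumes dA: "dt A = 1" and dB: "dt B = 1" and disc: "disc (trs (A, B)) \<noteq> 0"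
    and l: "l \<noteq> 0" "l + 1 / l = tr A" and m: "m \<noteq> 0" "m + 1 / m = tr B"
  obtains G where "dt G = 1" "(A, B) = conj2 G (slice (l, m, tr (A * B)))"
proof -
  obtain a b c d where A: "A = M2 a b c d" by (cases A)
  obtain p q r s where B: "B = M2 p q r s" by (cases B)
  define k n where "k = 1 / l" and "n = 1 / m"
  have lk: "l * k = 1" and mn: "m * n = 1" using l m by (simp_all add: k_def n_def)
  have ad: "a * d = 1 + b * c" "a + d = l + k" and ps: "p * s = 1 + q * r" "p + s = m + n"
    using dA dB l m by (simp_all add: A B k_def n_def m2_simps algebra_simps)
  have "(p - n) * (s - n) = p * s - (p + s) * n + n * n" by (simp add: algebra_simps)
  also have "\<dots> = q * r" unfolding ps using mn by (simp add: algebra_simps)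
  finally obtain w1 w2 where w: "w1 \<noteq> 0 \<or> w2 \<noteq> 0" "(p - n) * w1 + q * w2 = 0" "r * w1 + (s - n) * w2
      = 0"
    by (rule singular_kernel)
  then have Bw: "p * w1 + q * w2 = n * w1" "r * w1 + s * w2 = n * w2" by (simp_all add:
      algebra_simps)
  \<comment> \<open>By Cayley-Hamilton the image of \<open>A - 1 / l\<close> consists of eigenvectors for \<open>l\<close>.\<close>
  define v1 v2 where "v1 = (a - k) * w1 + b * w2" and "v2 = c * w1 + (d - k) * w2"
  have "a * v1 + b * v2 - l * v1 = (a * a + b * c - (l + k) * a + l * k) * w1 + b * ((a + d) - (l +
      k)) * w2"
    by (simp add: v1_def v2_def algebra_simps)
  also have "\<dots> = 0" unfolding ad(2)[symmetric] lk using ad(1) by (simp add: algebra_simps)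
  finally have Av1: "a * v1 + b * v2 = l * v1" by simp
  have "c * v1 + d * v2 - l * v2 = c * ((a + d) - (l + k)) * w1 + (d * d + b * c - (l + k) * d + l *
      k) * w2"
    by (simp add: v1_def v2_def algebra_simps)
  also have "\<dots> = 0" unfolding ad(2)[symmetric] lk using ad(1) by (simp add: algebra_simps)
  finally have Av2: "c * v1 + d * v2 = l * v2" by simp
  define g where "g = M2 v1 w1 v2 w2"
  have "dt g \<noteq> 0"
  proof
    assume "dt g = 0"
    then have par: "v1 * w2 = w1 * v2" by (simp add: g_def m2_simps)
    obtain e where "v1 = e * w1" "v2 = e * w2"
    proof (cases "w1 = 0")
      case True
      then show thesis using that[of "v2 / w2"] w(1) par by simp
    next
      case False
      then show thesis using that[of "v1 / w1"] par by (simp add: field_simps)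
    qed
    then have "a * w1 + b * w2 = (e + k) * w1" "c * w1 + d * w2 = (e + k) * w2"
      by (simp_all add: v1_def v2_def algebra_simps)
    then have "disc (trs (A, B)) = 0"
      by (intro common_eigenvector[OF dA dB w(1), of "e + k" n]) (simp_all add: A B Bw)
    then show False using disc by simp
  qed
  then obtain e where e: "dt (scale_m2 e g) = 1" by (rule normalise_dt)
  define G where "G = scale_m2 e g"
  have G: "dt G = 1" using e by (simp add: G_def)
  have "A * g = g * M2 l 1 0 k"
    using Av1 Av2 by (intro m2_eqI) (simp_all add: A g_def m2_simps mult.commute,
      simp_all add: v1_def v2_def algebra_simps)
  then have AG: "A * G = G * M2 l 1 0 k" by (simp add: G_def scale_m2_mult)
  define N where "N = adj G * B * G"
  have BN: "B = G * N * adj G" using G by (simp add: N_def mult.assoc mult_adj mult_adj_cancel)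
  have "e12 (adj g * B * g) = 0 \<and> e22 (adj g * B * g) = n * dt g"
  proof -
    have "e12 (adj g * B * g) = w2 * (p * w1 + q * w2) - w1 * (r * w1 + s * w2)"
      "e22 (adj g * B * g) = v1 * (r * w1 + s * w2) - v2 * (p * w1 + q * w2)"
      by (simp_all add: g_def B m2_simps algebra_simps)
    then show ?thesis unfolding Bw by (simp add: g_def m2_simps algebra_simps)
  qed
  moreover have "N = scale_m2 (e\<^sup>2) (adj g * B * g)"
    by (intro m2_eqI) (simp_all add: N_def G_def scale_m2_def m2_simps power2_eq_square
        algebra_simps)
  moreover have "e\<^sup>2 * dt g = 1" using e by (simp add: dt_scale_m2)
  ultimately have N2: "e12 N = 0" "e22 N = n" by (auto simp: scale_m2_def)
  have "tr N = tr B" using G by (simp add: BN tr_conj)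
  then have "e11 N + n = m + n" using N2 m by (simp add: tr_def n_def)
  then have N1: "e11 N = m" by simp
  have AN: "A = G * M2 l 1 0 k * adj G"
    using AG G by (metis mult.assoc mult.right_neutral mult_adj)
  have "tr (A * B) = tr (M2 l 1 0 k * N)"
    unfolding AN BN using G by (simp add: conj_mult tr_conj)
  then have "e21 N = tr (A * B) - l * m - k * n" using N1 N2 by (simp add: m2_simps)
  then have "N = M2 m 0 (tr (A * B) - l * m - k * n) n" using N1 N2 by (intro m2_eqI) auto
  then show thesis using G AN BN by (intro that[of G]) (simp_all add: conj2_def slice_def k_def
      n_def)
qed

definition coords_m2 :: "((m2 \<times> m2) \<times> m2 \<times> m2 \<Rightarrow> complex) set" where
  "coords_m2 = {\<lambda>l. e11 (fst (fst l)), \<lambda>l. e12 (fst (fst l)), \<lambda>l. e21 (fst (fst l)), \<lambda>l. e22 (fst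
      (fst l)),
     \<lambda>l. e11 (snd (fst l)), \<lambda>l. e12 (snd (fst l)), \<lambda>l. e21 (snd (fst l)), \<lambda>l. e22 (snd (fst l)),
     \<lambda>l. e11 (fst (snd l)), \<lambda>l. e12 (fst (snd l)), \<lambda>l. e21 (fst (snd l)), \<lambda>l. e22 (fst (snd l)),
     \<lambda>l. e11 (snd (snd l)), \<lambda>l. e12 (snd (snd l)), \<lambda>l. e21 (snd (snd l)), \<lambda>l. e22 (snd (snd l))}"

definition coords6 :: "(triple \<times> triple \<Rightarrow> complex) set" where
  "coords6 = {\<lambda>v. fst (fst v), \<lambda>v. fst (snd (fst v)), \<lambda>v. snd (snd (fst v)),
     \<lambda>v. fst (snd v), \<lambda>v. fst (snd (snd v)), \<lambda>v. snd (snd (snd v))}"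

text \<open>The parameters of the elementary factors are interpolated linearly.\<close>

lemma curve_SL2:
  assumes "dt A = 1" "dt B = 1"
  obtains c where "\<And>t. dt (c t) = 1" "c 0 = A" "c 1 = B"
    "\<And>e. e \<in> {e11, e12, e21, e22} \<Longrightarrow> (\<lambda>t. e (c t)) \<in> polys {\<lambda>t. t}"
proof -
  obtain a1 a2 a3 a4 where A: "A = elem_prod a1 a2 a3 a4" using elem_prod_surj[OF assms(1)] .
  obtain b1 b2 b3 b4 where B: "B = elem_prod b1 b2 b3 b4" using elem_prod_surj[OF assms(2)] .
  define l where "l a b t = a + (b - a) * t" for a b t :: complex
  have l: "(\<lambda>t. l a b t) \<in> polys {\<lambda>t. t}" for a b
    unfolding l_def by (intro polys_add polys_mult polys_const polys_gen) simp
  define c where "c t = elem_prod (l a1 b1 t) (l a2 b2 t) (l a3 b3 t) (l a4 b4 t)" for t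
  have entries: "e11 (elem_prod a b c d) = (1 + a * b) * (1 + c * d) + a * d"
    "e12 (elem_prod a b c d) = (1 + a * b) * c + a"
    "e21 (elem_prod a b c d) = b * (1 + c * d) + d"
    "e22 (elem_prod a b c d) = b * c + 1" for a b c d
    by (simp_all add: elem_prod_def upper_def lower_def m2_simps algebra_simps)
  have "(\<lambda>t. e (c t)) \<in> polys {\<lambda>t. t}" if "e \<in> {e11, e12, e21, e22}" for e
    using that unfolding c_def
    by (elim insertE emptyE; simp only: entries; intro polys_add polys_mult polys_const l)
  then show thesis
    by (intro that[of c]) (auto simp: c_def l_def A B)
qed

text \<open>Irreducibility of the product of copies of \<open>SL\<^sub>2\<close>, by restriction to a polynomial curve
  from \<open>l\<close> to \<open>l0\<close>, where \<open>D\<close> and \<open>\<Delta>\<close> become polynomials in one variable.\<close>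

lemma SL2_density:
  assumes D: "D \<in> polys coords_m2" and \<Delta>: "\<Delta> \<in> polys coords_m2"
    and prod: "\<And>l. l \<in> SL2_pairs \<times> SL2_pairs \<Longrightarrow> D l * \<Delta> l = 0"
    and l0: "l0 \<in> SL2_pairs \<times> SL2_pairs" "\<Delta> l0 \<noteq> 0" and l: "l \<in> SL2_pairs \<times> SL2_pairs"
  shows "D l = 0"
proof -
  obtain A1 A2 A3 A4 where A: "l = ((A1, A2), (A3, A4))" by (metis surj_pair)
  obtain B1 B2 B3 B4 where B: "l0 = ((B1, B2), (B3, B4))" by (metis surj_pair)
  have d: "dt A1 = 1" "dt B1 = 1" "dt A2 = 1" "dt B2 = 1" "dt A3 = 1" "dt B3 = 1" "dt A4 = 1" "dt B4
      = 1"
    using l l0 by (auto simp: A B SL2_pairs_def)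
  obtain c1 where c1: "\<And>t. dt (c1 t) = 1" "c1 0 = A1" "c1 1 = B1"
    "\<And>e. e \<in> {e11, e12, e21, e22} \<Longrightarrow> (\<lambda>t. e (c1 t)) \<in> polys {\<lambda>t. t}"
    using curve_SL2[OF d(1,2)] by metis
  obtain c2 where c2: "\<And>t. dt (c2 t) = 1" "c2 0 = A2" "c2 1 = B2"
    "\<And>e. e \<in> {e11, e12, e21, e22} \<Longrightarrow> (\<lambda>t. e (c2 t)) \<in> polys {\<lambda>t. t}"
    using curve_SL2[OF d(3,4)] by metis
  obtain c3 where c3: "\<And>t. dt (c3 t) = 1" "c3 0 = A3" "c3 1 = B3"
    "\<And>e. e \<in> {e11, e12, e21, e22} \<Longrightarrow> (\<lambda>t. e (c3 t)) \<in> polys {\<lambda>t. t}"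
    using curve_SL2[OF d(5,6)] by metis
  obtain c4 where c4: "\<And>t. dt (c4 t) = 1" "c4 0 = A4" "c4 1 = B4"
    "\<And>e. e \<in> {e11, e12, e21, e22} \<Longrightarrow> (\<lambda>t. e (c4 t)) \<in> polys {\<lambda>t. t}"
    using curve_SL2[OF d(7,8)] by metis
  define c where "c t = ((c1 t, c2 t), (c3 t, c4 t))" for t
  have gens: "(\<lambda>t. f (c t)) \<in> polys {\<lambda>t. t}" if "f \<in> coords_m2" for f
    using that c1(4) c2(4) c3(4) c4(4) unfolding coords_m2_def c_def
    by (elim insertE emptyE; simp)
  obtain p where p: "(\<lambda>t. D (c t)) = poly p" using polys_poly[OF polys_subst[where h = c, OF D
      gens]] by blast
  obtain q where q: "(\<lambda>t. \<Delta> (c t)) = poly q" using polys_poly[OF polys_subst[where h = c, OF \<Delta>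
      gens]] by blast
  have "poly (p * q) t = 0" for t
    using prod[of "c t"] fun_cong[OF p, of t] fun_cong[OF q, of t] c1(1) c2(1) c3(1) c4(1)
    by (simp add: c_def SL2_pairs_def)
  then have "p * q = 0" using poly_all_0_iff_0 by blast
  moreover have "q \<noteq> 0"
    using fun_cong[OF q, of 1] l0(2) c1(3) c2(3) c3(3) c4(3) by (auto simp: c_def B)
  ultimately have "p = 0" by simp
  then show ?thesis using fun_cong[OF p, of 0] c1(2) c2(2) c3(2) c4(2) by (simp add: c_def A)
qed

lemma coords_m2_gens:
  "(\<lambda>l. e11 (fst (fst l))) \<in> polys coords_m2" "(\<lambda>l. e12 (fst (fst l))) \<in> polys coords_m2"
  "(\<lambda>l. e21 (fst (fst l))) \<in> polys coords_m2" "(\<lambda>l. e22 (fst (fst l))) \<in> polys coords_m2"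
  "(\<lambda>l. e11 (snd (fst l))) \<in> polys coords_m2" "(\<lambda>l. e12 (snd (fst l))) \<in> polys coords_m2"
  "(\<lambda>l. e21 (snd (fst l))) \<in> polys coords_m2" "(\<lambda>l. e22 (snd (fst l))) \<in> polys coords_m2"
  "(\<lambda>l. e11 (fst (snd l))) \<in> polys coords_m2" "(\<lambda>l. e12 (fst (snd l))) \<in> polys coords_m2"
  "(\<lambda>l. e21 (fst (snd l))) \<in> polys coords_m2" "(\<lambda>l. e22 (fst (snd l))) \<in> polys coords_m2"
  "(\<lambda>l. e11 (snd (snd l))) \<in> polys coords_m2" "(\<lambda>l. e12 (snd (snd l))) \<in> polys coords_m2"
  "(\<lambda>l. e21 (snd (snd l))) \<in> polys coords_m2" "(\<lambda>l. e22 (snd (snd l))) \<in> polys coords_m2"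
  by (rule polys_gen, simp add: coords_m2_def)+

lemma coords6_gens:
  "(\<lambda>v. fst (fst v)) \<in> polys coords6" "(\<lambda>v. fst (snd (fst v))) \<in> polys coords6"
  "(\<lambda>v. snd (snd (fst v))) \<in> polys coords6" "(\<lambda>v. fst (snd v)) \<in> polys coords6"
  "(\<lambda>v. fst (snd (snd v))) \<in> polys coords6" "(\<lambda>v. snd (snd (snd v))) \<in> polys coords6"
  by (rule polys_gen, simp add: coords6_def)+

lemma trs_polys:
  assumes "H \<in> polys coords6"
  shows "(\<lambda>l. H (trs (fst l), trs (snd l))) \<in> polys coords_m2"
proof (rule polys_subst[OF assms])
  fix f assume "f \<in> coords6"
  then show "(\<lambda>l. f (trs (fst l), trs (snd l))) \<in> polys coords_m2"
    unfolding coords6_def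
    by (auto simp: trs_def case_prod_beta m2_simps intro!: polys_add polys_mult coords_m2_gens)
qed

text \<open>The theorem of Fricke and Vogt, for two independent pairs at once. On the slice an
  invariant function is a Laurent polynomial in the eigenvalues that is symmetric under their
  inversion, hence a polynomial in the traces. Conjugates of the slice are dense, so the equality
  extends to all pairs.\<close>

theorem SL2_invariants:
  assumes F: "F \<in> polys coords_m2"
    and inv: "\<And>G H a b. dt G = 1 \<Longrightarrow> dt H = 1 \<Longrightarrow> a \<in> SL2_pairs \<Longrightarrow> b \<in> SL2_pairs
       \<Longrightarrow> F (conj2 G a, conj2 H b) = F (a, b)"
  shows "\<exists>H\<in>polys coords6. \<forall>a\<in>SL2_pairs. \<forall>b\<in>SL2_pairs. F (a, b) = H (trs a, trs b)"
proof -
  define Y0 where "Y0 = {(l, m, z). l \<noteq> 0 \<and> m \<noteq> 0 \<and> disc (slice_trs (l, m, z)) \<noteq> 0}"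
  define Y where "Y = Y0 \<times> Y0"
  have conj: "\<exists>G. dt G = 1 \<and> a = conj2 G (slice y)"
    if "a \<in> SL2_pairs" "y \<in> Y0" "trs a = slice_trs y" for a y
  proof -
    obtain A B where a: "a = (A, B)" by (metis surj_pair)
    obtain l m z where y: "y = (l, m, z)" by (metis surj_pair)
    have *: "dt A = 1" "dt B = 1" "disc (trs (A, B)) \<noteq> 0" "l \<noteq> 0" "l + 1 / l = tr A" "m \<noteq> 0"
      "m + 1 / m = tr B" and z: "z = tr (A * B)"
      using that by (simp_all add: a y Y0_def SL2_pairs_def trs_def slice_trs_def)
    obtain G where "dt G = 1" "(A, B) = conj2 G (slice (l, m, tr (A * B)))" by (rule conj_slice[OF
        *])
    then show ?thesis by (auto simp: a y z)
  qed
  have slice: "slice y \<in> SL2_pairs" "trs (slice y) = slice_trs y" if "y \<in> Y0" for y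
    using that by (auto simp: Y0_def slice_SL2 trs_slice)
  have F_slice: "F (a, b) = F (slice y, slice y')"
    if "a \<in> SL2_pairs" "b \<in> SL2_pairs" "y \<in> Y0" "y' \<in> Y0" "trs a = slice_trs y" "trs b = slice_trs
        y'" for a b y y'
  proof -
    have "slice y \<in> SL2_pairs" "slice y' \<in> SL2_pairs" using slice(1) that(3,4) by blast+
    moreover from conj[OF that(1,3,5)] conj[OF that(2,4,6)]
    obtain G H where "dt G = 1" "a = conj2 G (slice y)" "dt H = 1" "b = conj2 H (slice y')"
      by blast
    ultimately show ?thesis using inv by simp
  qed
  let ?l = "\<lambda>y::triple \<times> triple. fst (fst y)" and ?m = "\<lambda>y::triple \<times> triple. fst (snd (fst y))"
    and ?z = "\<lambda>y::triple \<times> triple. snd (snd (fst y))"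
  let ?l' = "\<lambda>y::triple \<times> triple. fst (snd y)" and ?m' = "\<lambda>y::triple \<times> triple. fst (snd (snd y))"
    and ?z' = "\<lambda>y::triple \<times> triple. snd (snd (snd y))"
  let ?C0 = "{?l, \<lambda>y. 1 / ?l y, ?m, \<lambda>y. 1 / ?m y, ?z, ?l', \<lambda>y. 1 / ?l' y, ?m', \<lambda>y. 1 / ?m' y, ?z'}"
  define g where "g y = F (slice (fst y), slice (snd y))" for y
  have gens: "?l \<in> polys ?C0" "(\<lambda>y. 1 / ?l y) \<in> polys ?C0" "?m \<in> polys ?C0" "(\<lambda>y. 1 / ?m y) \<in> polys
      ?C0"
    "?z \<in> polys ?C0" "?l' \<in> polys ?C0" "(\<lambda>y. 1 / ?l' y) \<in> polys ?C0" "?m' \<in> polys ?C0"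
    "(\<lambda>y. 1 / ?m' y) \<in> polys ?C0" "?z' \<in> polys ?C0"
    by (rule polys_gen, simp)+
  have g: "g \<in> polys ?C0"
    unfolding g_def
  proof (rule polys_subst[OF F])
    fix f assume "f \<in> coords_m2"
    then show "(\<lambda>y. f (slice (fst y), slice (snd y))) \<in> polys ?C0"
      unfolding coords_m2_def
      by (elim insertE emptyE; simp only: slice_def case_prod_beta fst_conv snd_conv m2.sel;
          intro polys_diff polys_mult polys_const gens)
  qed
  have g_eq: "g y = g y'" if "y \<in> Y" "y' \<in> Y" "slice_trs (fst y) = slice_trs (fst y')" "slice_trs
      (snd y) = slice_trs (snd y')" for y y'
    unfolding g_def using that by (intro F_slice) (auto simp: Y_def slice)
  define t1 t2 :: "triple \<Rightarrow> triple" where "t1 = (\<lambda>(l, m, z). (1 / l, m, z))" and "t2 = (\<lambda>(l, m, z).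
      (l, 1 / m, z))"
  have t: "slice_trs (1 / l, m, z) = slice_trs (l, m, z)" "slice_trs (l, 1 / m, z) = slice_trs (l,
      m, z)" for l m z
    by (simp_all add: slice_trs_def)
  have t_Y: "(l, m, z) \<in> Y0 \<Longrightarrow> (1 / l, m, z) \<in> Y0" "(l, m, z) \<in> Y0 \<Longrightarrow> (l, 1 / m, z) \<in> Y0" for l m z
    by (simp_all add: Y0_def t)
  have nz: "?l y \<noteq> 0" "?m y \<noteq> 0" "?l' y \<noteq> 0" "?m' y \<noteq> 0" if "y \<in> Y" for y
    using that by (auto simp: Y_def Y0_def)
  let ?s = "\<lambda>y. ?l y + 1 / ?l y" and ?t = "\<lambda>y. ?m y + 1 / ?m y"
  let ?s' = "\<lambda>y. ?l' y + 1 / ?l' y" and ?t' = "\<lambda>y. ?m' y + 1 / ?m' y"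
  have "\<exists>h\<in>polys (insert ?s {?m, \<lambda>y. 1 / ?m y, ?z, ?l', \<lambda>y. 1 / ?l' y, ?m', \<lambda>y. 1 / ?m' y, ?z'}).
      \<forall>y\<in>Y. g y = h y"
    by (rule polys_involution[OF g, where \<tau> = "map_prod t1 id"])
      (auto simp: nz t_Y t Y_def t1_def case_prod_beta intro!: g_eq)
  then obtain g1 where g1: "g1 \<in> polys (insert ?m (insert (\<lambda>y. 1 / ?m y) {?s, ?z, ?l', \<lambda>y. 1 / ?l'
      y, ?m', \<lambda>y. 1 / ?m' y, ?z'}))"
    and g1g: "\<And>y. y \<in> Y \<Longrightarrow> g1 y = g y" by (auto simp: insert_commute)
  have "\<exists>h\<in>polys (insert ?t {?s, ?z, ?l', \<lambda>y. 1 / ?l' y, ?m', \<lambda>y. 1 / ?m' y, ?z'}). \<forall>y\<in>Y. g1 y = h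
      y"
    by (rule polys_involution[OF g1, where \<tau> = "map_prod t2 id"])
      (auto simp: nz t_Y t Y_def g1g t2_def case_prod_beta intro!: g_eq)
  then obtain g2 where g2: "g2 \<in> polys (insert ?l' (insert (\<lambda>y. 1 / ?l' y) {?t, ?s, ?z, ?m', \<lambda>y. 1 /
      ?m' y, ?z'}))"
    and g2g: "\<And>y. y \<in> Y \<Longrightarrow> g2 y = g y" by (auto simp: insert_commute g1g)
  have "\<exists>h\<in>polys (insert ?s' {?t, ?s, ?z, ?m', \<lambda>y. 1 / ?m' y, ?z'}). \<forall>y\<in>Y. g2 y = h y"
    by (rule polys_involution[OF g2, where \<tau> = "map_prod id t1"])
      (auto simp: nz t_Y t Y_def g2g t1_def case_prod_beta intro!: g_eq)
  then obtain g3 where g3: "g3 \<in> polys (insert ?m' (insert (\<lambda>y. 1 / ?m' y) {?s', ?t, ?s, ?z, ?z'}))"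
    and g3g: "\<And>y. y \<in> Y \<Longrightarrow> g3 y = g y" by (auto simp: insert_commute g2g)
  have "\<exists>h\<in>polys (insert ?t' {?s', ?t, ?s, ?z, ?z'}). \<forall>y\<in>Y. g3 y = h y"
    by (rule polys_involution[OF g3, where \<tau> = "map_prod id t2"])
      (auto simp: nz t_Y t Y_def g3g t2_def case_prod_beta intro!: g_eq)
  then obtain g4 where g4: "g4 \<in> polys {?s, ?t, ?z, ?s', ?t', ?z'}"
    and g4g: "\<And>y. y \<in> Y \<Longrightarrow> g4 y = g y" by (auto simp: insert_commute g3g)
  have eqset: "{?s, ?t, ?z, ?s', ?t', ?z'} = (\<lambda>f y. f (slice_trs (fst y), slice_trs (snd y))) `
      coords6"
    by (simp add: coords6_def slice_trs_def case_prod_beta)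
  from polys_descend[OF g4[unfolded eqset]] obtain H where H: "H \<in> polys coords6" and g4H: "g4 =
      (\<lambda>y. H (slice_trs (fst y), slice_trs (snd y)))"
    by (rule bexE)
  define D where "D l = F l - H (trs (fst l), trs (snd l))" for l
  define \<Delta> where "\<Delta> l = disc (trs (fst l)) * disc (trs (snd l))" for l
  have D: "D \<in> polys coords_m2" unfolding D_def using F trs_polys[OF H] by (rule polys_diff)
  have "(\<lambda>v. disc (fst v) * disc (snd v)) \<in> polys coords6"
    unfolding disc_def case_prod_beta by (intro polys_mult polys_add polys_diff polys_const
        coords6_gens)
  from trs_polys[OF this] have \<Delta>: "\<Delta> \<in> polys coords_m2" by (simp add: \<Delta>_def[abs_def])
  have surj: "\<exists>y. y \<in> Y0 \<and> trs a = slice_trs y" if "a \<in> SL2_pairs" "disc (trs a) \<noteq> 0" for a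
  proof -
    obtain x y z where xyz: "trs a = (x, y, z)" by (metis surj_pair)
    obtain l m where "l \<noteq> 0" "l + 1 / l = x" "m \<noteq> 0" "m + 1 / m = y" using inverse_sum_surj by metis
    then show ?thesis using that xyz by (intro exI[of _ "(l, m, z)"]) (auto simp: Y0_def
        slice_trs_def)
  qed
  have zero: "D (a, b) * \<Delta> (a, b) = 0" if "a \<in> SL2_pairs" "b \<in> SL2_pairs" for a b
  proof (cases "\<Delta> (a, b) = 0")
    case False
    then have "disc (trs a) \<noteq> 0" "disc (trs b) \<noteq> 0" by (auto simp: \<Delta>_def)
    from surj[OF that(1) this(1)] surj[OF that(2) this(2)] obtain y y' where y: "y \<in> Y0" "y' \<in> Y0"
        "trs a = slice_trs y" "trs b = slice_trs y'"
      by blast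
    then have "F (a, b) = g (y, y')" unfolding g_def using F_slice that by auto
    also have "\<dots> = H (trs a, trs b)"
      using g4g[of "(y, y')"] y by (simp add: Y_def g4H)
    finally show ?thesis by (simp add: D_def)
  qed simp
  \<comment> \<open>The generators of the quaternion group of order eight form an irreducible pair.\<close>
  let ?a = "(M2 \<i> 0 0 (- \<i>), M2 0 1 (- 1) 0)"
  have "?a \<in> SL2_pairs" "disc (trs ?a) \<noteq> 0" by (simp_all add: SL2_pairs_def disc_def trs_def
      m2_simps)
  then have l0: "(?a, ?a) \<in> SL2_pairs \<times> SL2_pairs" "\<Delta> (?a, ?a) \<noteq> 0" by (simp_all add: \<Delta>_def)
  have "D l * \<Delta> l = 0" if "l \<in> SL2_pairs \<times> SL2_pairs" for l
    using zero[of "fst l" "snd l"] that by auto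
  from SL2_density[OF D \<Delta> this l0] have "D (a, b) = 0" if "a \<in> SL2_pairs" "b \<in> SL2_pairs" for a b
    using that by auto
  then show ?thesis using H by (intro bexI[of _ H]) (auto simp: D_def)
qed

section \<open>Representations of the free group and their lifts\<close>

lemma SO_simps [simp]: "A \<otimes>\<^bsub>SO n\<^esub> B = A * B" "\<one>\<^bsub>SO n\<^esub> = 1\<^sub>m n"
  by (simp_all add: SO_def)

lemma F2_simps [simp]: "u \<otimes>\<^bsub>F2\<^esub> v = foldr push u v" "\<one>\<^bsub>F2\<^esub> = []"
  by (simp_all add: F2_def free_group_def)

lemma carrier_F2: "w \<in> carrier F2 \<longleftrightarrow> reduced w \<and> fst ` set w \<subseteq> {1, 2}"
  by (simp add: F2_def free_group_def)

lemma group_F2: "group F2"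
  unfolding F2_def by (rule group_free_group)

definition letter_mat :: "m2 \<times> m2 \<Rightarrow> nat letter \<Rightarrow> m2" where
  "letter_mat a l = (let C = if fst l = 1 then fst a else snd a in if snd l then C else adj C)"

text \<open>The value of a word at a pair of matrices. It is defined on all lists of letters, so that
  it can be computed letter by letter; on \<open>SL\<^sub>2\<close> it is compatible with reduction of words.\<close>

definition word_mat :: "m2 \<times> m2 \<Rightarrow> nat letter list \<Rightarrow> m2" where
  "word_mat a w = foldr (\<lambda>l M. letter_mat a l * M) w 1"

lemma word_mat_simps [simp]: "word_mat a [] = 1" "word_mat a (l # w) = letter_mat a l * word_mat a
    w"
  by (simp_all add: word_mat_def)

lemma dt_letter_mat: "a \<in> SL2_pairs \<Longrightarrow> dt (letter_mat a l) = 1"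
  by (auto simp: letter_mat_def SL2_pairs_def Let_def)

lemma dt_word_mat: "a \<in> SL2_pairs \<Longrightarrow> dt (word_mat a w) = 1"
  by (induction w) (simp_all add: dt_mult dt_letter_mat)

lemma letter_mat_inv: "a \<in> SL2_pairs \<Longrightarrow> letter_mat a l * letter_mat a (inv_letter l) = 1"
  by (auto simp: letter_mat_def SL2_pairs_def Let_def inv_letter_def mult_adj adj_mult_self)

lemma word_mat_push: "a \<in> SL2_pairs \<Longrightarrow> word_mat a (push l w) = letter_mat a l * word_mat a w"
  by (cases w) (auto simp: mult.assoc[symmetric] letter_mat_inv)

lemma word_mat_mult:
  "a \<in> SL2_pairs \<Longrightarrow> word_mat a (foldr push u v) = word_mat a u * word_mat a v"
  by (induction u) (simp_all add: word_mat_push mult.assoc)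

lemma word_mat_conj:
  assumes "dt G = 1"
  shows "word_mat (conj2 G a) w = G * word_mat a w * adj G"
proof (induction w)
  case (Cons l w)
  have "letter_mat (conj2 G a) l = G * letter_mat a l * adj G"
    by (auto simp: letter_mat_def conj2_def Let_def adj_mult mult.assoc split: prod.split)
  then show ?case using Cons assms by (simp add: conj_mult)
qed (simp add: mult_adj assms)

text \<open>The representation in \<open>SO(4)\<close> with a given lift. As \<open>F\<^sub>2\<close> is free, there is one for any two
  pairs; as the double cover is surjective, every representation arises in this way.\<close>

definition rep :: "m2 \<times> m2 \<Rightarrow> m2 \<times> m2 \<Rightarrow> nat letter list \<Rightarrow> complex mat" where
  "rep a b = (\<lambda>w\<in>carrier F2. pi_mat (word_mat a w) (word_mat b w))"

lemma rep_apply: "w \<in> carrier F2 \<Longrightarrow> rep a b w = pi_mat (word_mat a w) (word_mat b w)"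
  by (simp add: rep_def)

lemma rep_Hom:
  assumes "a \<in> SL2_pairs" "b \<in> SL2_pairs"
  shows "rep a b \<in> Hom F2 (SO 4)"
proof -
  have "rep a b \<in> hom F2 (SO 4)"
  proof (rule homI)
    fix u v assume uv: "u \<in> carrier F2" "v \<in> carrier F2"
    then have "u \<otimes>\<^bsub>F2\<^esub> v \<in> carrier F2" using group_F2 by (simp only: group.is_monoid monoid.m_closed)
    then show "rep a b (u \<otimes>\<^bsub>F2\<^esub> v) = rep a b u \<otimes>\<^bsub>SO 4\<^esub> rep a b v"
      using uv assms by (simp add: rep_apply word_mat_mult pi_mat_mult)
  qed (simp add: rep_apply pi_mat_SO dt_word_mat assms)
  then show ?thesis by (simp add: Hom_def rep_def)
qed

lemma carrier_F2_Cons: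
  assumes "l # w \<in> carrier F2"
  shows "[l] \<in> carrier F2" "w \<in> carrier F2" "l # w = [l] \<otimes>\<^bsub>F2\<^esub> w"
  using assms by (cases w; auto simp: carrier_F2 reduced_Cons)+

lemma Hom_one: "\<rho> \<in> Hom F2 (SO 4) \<Longrightarrow> \<rho> [] = 1\<^sub>m 4"
  using hom_one[of \<rho> F2 "SO 4"] group_F2 group_SO by (simp add: Hom_def)

lemma Hom_Cons: "\<rho> \<in> Hom F2 (SO 4) \<Longrightarrow> l # w \<in> carrier F2 \<Longrightarrow> \<rho> (l # w) = \<rho> [l] * \<rho> w"
  using carrier_F2_Cons[of l w] hom_mult[of \<rho> F2 "SO 4" "[l]" w] by (simp add: Hom_def)

lemma Hom_SO: "\<rho> \<in> Hom F2 (SO 4) \<Longrightarrow> w \<in> carrier F2 \<Longrightarrow> \<rho> w \<in> carrier (SO 4)"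
  by (auto simp: Hom_def dest: hom_in_carrier)

lemma gen_carrier: "i \<in> {1, 2} \<Longrightarrow> [(i, b)] \<in> carrier F2"
  by (simp add: carrier_F2)

lemma Hom_inv_letter:
  assumes \<rho>: "\<rho> \<in> Hom F2 (SO 4)" and i: "i \<in> {1, 2}"
  shows "\<rho> [(i, False)] = transpose_mat (\<rho> [(i, True)])"
proof -
  let ?R = "\<rho> [(i, True)]" and ?S = "\<rho> [(i, False)]"
  have R: "?R \<in> carrier_mat 4 4" "?R * transpose_mat ?R = 1\<^sub>m 4" and S: "?S \<in> carrier_mat 4 4"
    using Hom_SO[OF \<rho> gen_carrier[OF i]] by (auto simp: SO_def)
  have "\<rho> ([(i, False)] \<otimes>\<^bsub>F2\<^esub> [(i, True)]) = ?S * ?R"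
    using \<rho> gen_carrier[OF i] hom_mult[of \<rho> F2 "SO 4"] by (simp only: Hom_def Int_iff SO_simps)
  then have SR: "?S * ?R = 1\<^sub>m 4" using Hom_one[OF \<rho>] by (simp add: inv_letter_def)
  have "?S = ?S * (?R * transpose_mat ?R)" using R S by simp
  also have "\<dots> = ?S * ?R * transpose_mat ?R" using R S by (simp add: assoc_mult_mat[of _ 4 4 _ 4 _
      4])
  also have "\<dots> = transpose_mat ?R" using R SR by simp
  finally show ?thesis .
qed

lemma rep_surj:
  assumes \<rho>: "\<rho> \<in> Hom F2 (SO 4)"
  obtains a b where "a \<in> SL2_pairs" "b \<in> SL2_pairs" "\<rho> = rep a b"
proof -
  obtain A1 B1 where 1: "dt A1 = 1" "dt B1 = 1" "\<rho> [(1, True)] = pi_mat A1 B1"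
    using pi_mat_surj[OF Hom_SO[OF \<rho> gen_carrier]] by (metis insertI1)
  obtain A2 B2 where 2: "dt A2 = 1" "dt B2 = 1" "\<rho> [(2, True)] = pi_mat A2 B2"
    using pi_mat_surj[OF Hom_SO[OF \<rho> gen_carrier]] by (metis insertI1 insertI2)
  let ?a = "(A1, A2)" and ?b = "(B1, B2)"
  have ab: "?a \<in> SL2_pairs" "?b \<in> SL2_pairs" using 1 2 by (simp_all add: SL2_pairs_def)
  have letter: "\<rho> [l] = pi_mat (letter_mat ?a l) (letter_mat ?b l)" if "[l] \<in> carrier F2" for l
  proof -
    obtain i b where l: "l = (i, b)" by (metis surj_pair)
    have i: "i \<in> {1, 2}" using that by (simp add: carrier_F2 l)
    show ?thesis
      using i 1 2 Hom_inv_letter[OF \<rho> i] by (cases b) (auto simp: l letter_mat_def pi_mat_transpose)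
  qed
  have "\<rho> w = rep ?a ?b w" if "w \<in> carrier F2" for w
    using that
  proof (induction w)
    case Nil
    then show ?case by (simp add: rep_apply Hom_one[OF \<rho>] pi_mat_one)
  next
    case (Cons l w)
    then show ?case
      using carrier_F2_Cons(1,2)[OF Cons.prems] Hom_Cons[OF \<rho> Cons.prems]
      by (simp add: rep_apply letter pi_mat_mult)
  qed
  moreover have "\<rho> w = rep ?a ?b w" if "w \<notin> carrier F2" for w
    using that \<rho> by (auto simp: Hom_def rep_def extensional_def)
  ultimately show thesis using that ab by blast
qed

lemma SO_inv:
  assumes "dt G = 1" "dt H = 1"
  shows "inv\<^bsub>SO 4\<^esub> (pi_mat G H) = pi_mat (adj G) (adj H)"
  by (rule group.inv_equality[OF group_SO])
    (use assms in \<open>simp_all add: pi_mat_mult adj_mult_self pi_mat_one pi_mat_SO\<close>)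

lemma conj_rep_rep:
  assumes "dt G = 1" "dt H = 1"
  shows "conj_rep (SO 4) F2 (pi_mat G H) (rep a b) = rep (conj2 G a) (conj2 H b)"
  unfolding conj_rep_def
  by (rule ext) (simp add: rep_def SO_inv assms pi_mat_mult word_mat_conj restrict_def)

section \<open>Functions on the character variety as functions of six traces\<close>

text \<open>\<open>H\<close> expresses \<open>f\<close> in the six traces of a lift. By the surjectivity of \<open>rep\<close> a function on
  \<open>Hom F2 (SO 4)\<close> is determined by \<open>H\<close>.\<close>

definition lifts :: "((nat letter list \<Rightarrow> complex mat) \<Rightarrow> complex) \<Rightarrow> (triple \<times> triple \<Rightarrow> complex) \<Rightarrow>
    bool" where
  "lifts f H \<longleftrightarrow> (\<forall>a\<in>SL2_pairs. \<forall>b\<in>SL2_pairs. f (rep a b) = H (trs a, trs b))"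

lemma lifts_unique_left:
  assumes "lifts f H" "lifts g H" "f \<in> extensional (Hom F2 (SO 4))" "g \<in> extensional (Hom F2 (SO
      4))"
  shows "f = g"
proof (rule extensionalityI[OF assms(3,4)])
  fix \<rho> assume "\<rho> \<in> Hom F2 (SO 4)"
  then show "f \<rho> = g \<rho>" using assms(1,2) by (metis rep_surj lifts_def)
qed

definition flip :: "bool \<Rightarrow> 'a::uminus \<Rightarrow> 'a" where
  "flip s x = (if s then - x else x)"

text \<open>Two lifts of the same representation differ by signs of the generators, applied to both
  pairs simultaneously. An expression in the six traces of a lift is therefore invariant under the
  corresponding sign changes.\<close>

definition sign_pair :: "bool \<Rightarrow> bool \<Rightarrow> m2 \<times> m2 \<Rightarrow> m2 \<times> m2" where
  "sign_pair s t a = (flip s (fst a), flip t (snd a))"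

definition sign_trs :: "bool \<Rightarrow> bool \<Rightarrow> triple \<Rightarrow> triple" where
  "sign_trs s t = (\<lambda>(x, y, z). (flip s x, flip t y, flip s (flip t z)))"

lemma m2_uminus: "dt (- A) = dt A" "tr (- A) = - tr A" "adj (- A) = - adj A"
  by (simp_all add: m2_simps)

lemma sign_pair_SL2: "a \<in> SL2_pairs \<Longrightarrow> sign_pair s t a \<in> SL2_pairs"
  by (auto simp: SL2_pairs_def sign_pair_def flip_def m2_uminus)

lemma trs_sign_pair: "trs (sign_pair s t a) = sign_trs s t (trs a)"
  by (auto simp: trs_def sign_pair_def sign_trs_def flip_def m2_uminus split: prod.split)

lemma word_mat_sign: "\<exists>r. \<forall>a. word_mat (sign_pair s t a) w = flip r (word_mat a w)"
proof (induction w)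
  case Nil
  then show ?case by (intro exI[of _ False]) (simp add: flip_def)
next
  case (Cons l w)
  then obtain r where r: "\<And>a. word_mat (sign_pair s t a) w = flip r (word_mat a w)" by blast
  have "letter_mat (sign_pair s t a) l = flip (if fst l = 1 then s else t) (letter_mat a l)" for a
    by (auto simp: letter_mat_def sign_pair_def flip_def m2_uminus Let_def)
  then show ?case
    by (intro exI[of _ "(if fst l = 1 then s else t) \<noteq> r"]) (auto simp: r flip_def)
qed

lemma pi_mat_uminus: "pi_mat (- A) (- B) = pi_mat A B"
  by (simp add: pi_mat_def m2_uminus)

lemma rep_sign: "rep (sign_pair s t a) (sign_pair s t b) = rep a b"
proof -
  have "pi_mat (word_mat (sign_pair s t a) w) (word_mat (sign_pair s t b) w)
      = pi_mat (word_mat a w) (word_mat b w)" for w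
  proof -
    obtain r where "\<And>a. word_mat (sign_pair s t a) w = flip r (word_mat a w)"
      using word_mat_sign by blast
    then show ?thesis by (simp add: flip_def pi_mat_uminus)
  qed
  then show ?thesis by (simp add: rep_def)
qed

lemma lifts_sign_invariant:
  assumes "lifts f H"
  shows "H (map_prod (sign_trs s t) (sign_trs s t) v) = H v"
proof -
  obtain a b where ab: "a \<in> SL2_pairs" "b \<in> SL2_pairs" "v = (trs a, trs b)"
    using trs_surj by (metis prod.collapse)
  have "f (rep (sign_pair s t a) (sign_pair s t b)) = f (rep a b)" by (simp add: rep_sign)
  then show ?thesis
    using assms ab unfolding lifts_def by (simp add: sign_pair_SL2 trs_sign_pair)
qed

lemma pi_mat_entry_polys:
  assumes "i < 4" "j < 4"
    and "\<And>e. e \<in> {e11, e12, e21, e22} \<Longrightarrow> (\<lambda>l. e (c l)) \<in> polys F"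
    and "\<And>e. e \<in> {e11, e12, e21, e22} \<Longrightarrow> (\<lambda>l. e (d l)) \<in> polys F"
  shows "(\<lambda>l. pi_mat (c l) (d l) $$ (i, j)) \<in> polys F"
proof -
  have c: "(\<lambda>l. e11 (c l)) \<in> polys F" "(\<lambda>l. e12 (c l)) \<in> polys F" "(\<lambda>l. e21 (c l)) \<in> polys F" "(\<lambda>l.
      e22 (c l)) \<in> polys F"
    and d: "(\<lambda>l. e11 (d l)) \<in> polys F" "(\<lambda>l. e12 (d l)) \<in> polys F" "(\<lambda>l. e21 (d l)) \<in> polys F" "(\<lambda>l.
        e22 (d l)) \<in> polys F"
    using assms(3,4) by simp_all
  show ?thesis
    unfolding pi_mat_index[OF assms(1,2)] coord_def tr_def times_m2_def adj_def m2.sel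
    by (intro polys_add polys_mult polys_uminus polys_divide_const polys_const c d)
qed

lemma coord_ring_lift:
  assumes "f \<in> coord_ring_Hom 4 (SO 4) F2 {\<gamma> 1, \<gamma> 2}"
  shows "\<exists>F\<in>polys coords_m2. \<forall>a\<in>SL2_pairs. \<forall>b\<in>SL2_pairs. f (rep a b) = F (a, b)"
proof -
  from assms[unfolded coord_ring_Hom_def generated_alg_iff[of _ "Hom F2 (SO 4)"]]
  obtain g where "g \<in> polys {(\<lambda>\<rho>. p (\<rho> s)) | p s. p \<in> GL_coords 4 \<and> s \<in> {\<gamma> 1, \<gamma> 2}}"
    and f: "f = restrict g (Hom F2 (SO 4))" by (rule bexE)
  from this(1) have "\<exists>F\<in>polys coords_m2. \<forall>a\<in>SL2_pairs. \<forall>b\<in>SL2_pairs. g (rep a b) = F (a, b)"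
  proof (induction rule: polys_induct)
    case (const c)
    show ?case by (intro bexI[of _ "\<lambda>x. c"] polys_const) simp
  next
    case (gen f)
    then obtain p s where f: "f = (\<lambda>\<rho>. p (\<rho> s))" and p: "p \<in> GL_coords 4" and s: "s \<in> {\<gamma> 1, \<gamma> 2}" by
        blast
    have s_c: "s \<in> carrier F2" using s by (auto simp: \<gamma>_def free_gen_def carrier_F2)
    consider i j where "p = (\<lambda>A. A $$ (i, j))" "i < 4" "j < 4" | "p = (\<lambda>A. inverse (det A))"
      using p by (auto simp: GL_coords_def)
    then show ?case
    proof cases
      case 1
      let ?F = "\<lambda>l. pi_mat (word_mat (fst l) s) (word_mat (snd l) s) $$ (i, j)"
      have "?F \<in> polys coords_m2"
        by (rule pi_mat_entry_polys[OF 1(2,3)])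
          (use s in \<open>auto simp: \<gamma>_def free_gen_def letter_mat_def intro: coords_m2_gens\<close>)
      then show ?thesis by (rule bexI[rotated]) (simp add: f 1 rep_apply s_c)
    next
      case 2
      show ?thesis
        by (rule bexI[of _ "\<lambda>l. 1"]) (simp_all add: f 2 rep_apply s_c det_pi_mat dt_word_mat
            polys_const)
    qed
  next
    case (add f g)
    then obtain F G where "F \<in> polys coords_m2" "G \<in> polys coords_m2"
      "\<forall>a\<in>SL2_pairs. \<forall>b\<in>SL2_pairs. f (rep a b) = F (a, b)"
      "\<forall>a\<in>SL2_pairs. \<forall>b\<in>SL2_pairs. g (rep a b) = G (a, b)" by blast
    then show ?case by (intro bexI[of _ "\<lambda>l. F l + G l"] polys_add) auto
  next
    case (mult f g)
    then obtain F G where "F \<in> polys coords_m2" "G \<in> polys coords_m2"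
      "\<forall>a\<in>SL2_pairs. \<forall>b\<in>SL2_pairs. f (rep a b) = F (a, b)"
      "\<forall>a\<in>SL2_pairs. \<forall>b\<in>SL2_pairs. g (rep a b) = G (a, b)" by blast
    then show ?case by (intro bexI[of _ "\<lambda>l. F l * G l"] polys_mult) auto
  qed
  then show ?thesis by (simp add: f rep_Hom)
qed

text \<open>A conjugation in \<open>SO(4)\<close> lifts to independent conjugations of the two pairs of matrices.\<close>

theorem coord_ring_X_lift:
  assumes "f \<in> coord_ring_X 4 (SO 4) F2 {\<gamma> 1, \<gamma> 2}"
  obtains H where "H \<in> polys coords6" "lifts f H"
proof -
  have f: "f \<in> coord_ring_Hom 4 (SO 4) F2 {\<gamma> 1, \<gamma> 2}"
    and inv: "\<And>A \<rho>. A \<in> carrier (SO 4) \<Longrightarrow> \<rho> \<in> Hom F2 (SO 4) \<Longrightarrow> f (conj_rep (SO 4) F2 A \<rho>) = f \<rho>"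
    using assms by (auto simp: coord_ring_X_def)
  from coord_ring_lift[OF f] obtain F where F: "F \<in> polys coords_m2"
    and fF: "\<And>a b. a \<in> SL2_pairs \<Longrightarrow> b \<in> SL2_pairs \<Longrightarrow> f (rep a b) = F (a, b)" by blast
  have conj: "conj2 G a \<in> SL2_pairs" if "dt G = 1" "a \<in> SL2_pairs" for G a
    using that by (auto simp: SL2_pairs_def conj2_def dt_mult)
  have F_inv: "F (conj2 G a, conj2 H b) = F (a, b)"
    if *: "dt G = 1" "dt H = 1" "a \<in> SL2_pairs" "b \<in> SL2_pairs" for G H a b
  proof -
    have "F (conj2 G a, conj2 H b) = f (conj_rep (SO 4) F2 (pi_mat G H) (rep a b))"
      using * by (simp add: conj_rep_rep fF conj)
    also have "\<dots> = F (a, b)" using * by (simp add: inv pi_mat_SO rep_Hom fF)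
    finally show ?thesis .
  qed
  have "\<exists>H\<in>polys coords6. \<forall>a\<in>SL2_pairs. \<forall>b\<in>SL2_pairs. F (a, b) = H (trs a, trs b)"
    by (rule SL2_invariants[OF F]) (rule F_inv)
  then obtain H where "H \<in> polys coords6" "\<forall>a\<in>SL2_pairs. \<forall>b\<in>SL2_pairs. F (a, b) = H (trs a, trs b)"
    by (rule bexE)
  then show thesis using fF by (intro that) (auto simp: lifts_def)
qed

section \<open>Membership in the coordinate ring\<close>

lemma generated_alg_extensional: "f \<in> generated_alg X F \<Longrightarrow> f \<in> extensional X"
  by (induction rule: generated_alg.induct) (rule restrict_extensional)+

lemma generated_alg_sum:
  assumes "finite I" "\<And>i. i \<in> I \<Longrightarrow> (\<lambda>x\<in>X. f i x) \<in> generated_alg X F"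
  shows "(\<lambda>x\<in>X. \<Sum>i\<in>I. f i x) \<in> generated_alg X F"
  using assms
proof (induction I rule: finite_induct)
  case empty
  show ?case unfolding sum.empty by (rule generated_alg.const)
next
  case (insert i I)
  have "(\<lambda>x\<in>X. (\<lambda>x\<in>X. f i x) x + (\<lambda>x\<in>X. \<Sum>i\<in>I. f i x) x) \<in> generated_alg X F"
    using insert by (intro generated_alg.add) auto
  also have "(\<lambda>x\<in>X. (\<lambda>x\<in>X. f i x) x + (\<lambda>x\<in>X. \<Sum>i\<in>I. f i x) x) = (\<lambda>x\<in>X. \<Sum>i\<in>insert i I. f i x)"
    using insert by (auto simp: restrict_def fun_eq_iff)
  finally show ?case .
qed

lemma generated_alg_restrict_mult:
  assumes "(\<lambda>x\<in>X. f x) \<in> generated_alg X F" "(\<lambda>x\<in>X. g x) \<in> generated_alg X F"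
  shows "(\<lambda>x\<in>X. f x * g x) \<in> generated_alg X F"
proof -
  have "(\<lambda>x\<in>X. f x * g x) = (\<lambda>x\<in>X. (\<lambda>x\<in>X. f x) x * (\<lambda>x\<in>X. g x) x)"
    by (auto simp: restrict_def fun_eq_iff)
  then show ?thesis using generated_alg.mult[OF assms] by simp
qed

text \<open>Matrices of regular functions are closed under products and transposition. Since inverses
  in \<open>SO(4)\<close> are transposes, the values of all words are of this kind.\<close>

definition poly_mat :: "'x set \<Rightarrow> ('x \<Rightarrow> complex) set \<Rightarrow> ('x \<Rightarrow> complex mat) \<Rightarrow> bool" where
  "poly_mat X F M \<longleftrightarrow> (\<forall>x\<in>X. M x \<in> carrier_mat 4 4) \<and>
     (\<forall>i<4. \<forall>j<4. (\<lambda>x\<in>X. M x $$ (i, j)) \<in> generated_alg X F)"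

lemma poly_mat_entry:
  assumes "poly_mat X F M" "i < 4" "j < 4"
  shows "(\<lambda>x\<in>X. M x $$ (i, j)) \<in> generated_alg X F"
  using assms(1)[unfolded poly_mat_def, THEN conjunct2, rule_format, OF assms(2,3)] .

lemma poly_mat_const: "A \<in> carrier_mat 4 4 \<Longrightarrow> poly_mat X F (\<lambda>x. A)"
  by (simp add: poly_mat_def generated_alg.const)

lemma poly_mat_transpose: "poly_mat X F M \<Longrightarrow> poly_mat X F (\<lambda>x. transpose_mat (M x))"
proof -
  assume M: "poly_mat X F M"
  then have "(\<lambda>x\<in>X. transpose_mat (M x) $$ (i, j)) = (\<lambda>x\<in>X. M x $$ (j, i))" if "i < 4" "j < 4" for i
      j
    using that by (intro restrict_ext index_transpose_mat) (auto simp: poly_mat_def)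
  then show ?thesis using M by (simp add: poly_mat_def)
qed

lemma poly_mat_mult:
  assumes M: "poly_mat X F M" and N: "poly_mat X F N"
  shows "poly_mat X F (\<lambda>x. M x * N x)"
proof -
  have "(\<lambda>x\<in>X. (M x * N x) $$ (i, j)) \<in> generated_alg X F" if ij: "i < 4" "j < 4" for i j
  proof -
    have "(\<lambda>x\<in>X. (M x * N x) $$ (i, j)) = (\<lambda>x\<in>X. \<Sum>k<4. M x $$ (i, k) * N x $$ (k, j))"
    proof (rule restrict_ext)
      fix x assume "x \<in> X"
      then have "M x \<in> carrier_mat 4 4" "N x \<in> carrier_mat 4 4" using M N by (auto simp:
          poly_mat_def)
      then show "(M x * N x) $$ (i, j) = (\<Sum>k<4. M x $$ (i, k) * N x $$ (k, j))"
        using ij by (auto simp: scalar_prod_def lessThan_atLeast0)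
    qed
    also have "\<dots> \<in> generated_alg X F"
      using M N ij by (intro generated_alg_sum generated_alg_restrict_mult) (auto simp:
          poly_mat_def)
    finally show ?thesis .
  qed
  then show ?thesis using M N by (auto simp: poly_mat_def)
qed

lemma poly_mat_cong: "poly_mat X F M \<Longrightarrow> (\<And>x. x \<in> X \<Longrightarrow> M x = N x) \<Longrightarrow> poly_mat X F N"
  unfolding poly_mat_def by (metis (mono_tags, lifting) restrict_ext)

lemma poly_mat_trace:
  assumes "poly_mat X F M"
  shows "(\<lambda>x\<in>X. mat_trace (M x)) \<in> generated_alg X F"
proof -
  have "(\<lambda>x\<in>X. mat_trace (M x)) = (\<lambda>x\<in>X. \<Sum>i<4. M x $$ (i, i))"
    using assms by (intro restrict_ext) (auto simp: poly_mat_def mat_trace_def)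
  also have "\<dots> \<in> generated_alg X F"
    using assms by (intro generated_alg_sum) (auto simp: poly_mat_def)
  finally show ?thesis .
qed

lemma poly_mat_word:
  assumes "w \<in> carrier F2"
  shows "poly_mat (Hom F2 (SO 4)) {(\<lambda>\<rho>. p (\<rho> s)) | p s. p \<in> GL_coords 4 \<and> s \<in> {\<gamma> 1, \<gamma> 2}} (\<lambda>\<rho>. \<rho> w)"
    (is "poly_mat ?X ?F _")
  using assms
proof (induction w)
  case Nil
  show ?case
    by (rule poly_mat_cong[OF poly_mat_const[of "1\<^sub>m 4"]]) (simp_all add: Hom_one)
next
  case (Cons l w)
  have letter: "poly_mat ?X ?F (\<lambda>\<rho>. \<rho> [l])"
  proof -
    obtain i b where l: "l = (i, b)" by (metis surj_pair)
    have i: "i \<in> {1, 2}" using Cons.prems by (simp add: carrier_F2 l)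
    have pos: "poly_mat ?X ?F (\<lambda>\<rho>. \<rho> [(i, True)])"
      unfolding poly_mat_def
    proof (intro conjI allI impI ballI)
      show "\<rho> [(i, True)] \<in> carrier_mat 4 4" if "\<rho> \<in> ?X" for \<rho>
        using Hom_SO[OF that gen_carrier[OF i]] by (simp add: SO_def)
      fix j k :: nat assume "j < 4" "k < 4"
      then have "(\<lambda>A. A $$ (j, k)) \<in> GL_coords 4" unfolding GL_coords_def by blast
      moreover have "[(i, True)] \<in> {\<gamma> 1, \<gamma> 2}" using i by (auto simp: \<gamma>_def free_gen_def)
      ultimately have "(\<lambda>\<rho>. \<rho> [(i, True)] $$ (j, k)) \<in> ?F"
        by (intro CollectI exI[of _ "\<lambda>A. A $$ (j, k)"] exI[of _ "[(i, True)]"]) simp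
      then show "(\<lambda>\<rho>\<in>?X. \<rho> [(i, True)] $$ (j, k)) \<in> generated_alg ?X ?F"
        by (rule generated_alg.gen)
    qed
    show ?thesis
      using pos poly_mat_cong[OF poly_mat_transpose[OF pos]] Hom_inv_letter[OF _ i]
      by (cases b) (auto simp: l)
  qed
  have w: "poly_mat ?X ?F (\<lambda>\<rho>. \<rho> w)" using Cons carrier_F2_Cons by blast
  show ?case
    by (rule poly_mat_cong[OF poly_mat_mult[OF letter w]]) (simp add: Hom_Cons[OF _ Cons.prems])
qed

lemma regular_on_word:
  assumes p: "p \<in> generated_alg (carrier (SO 4)) (GL_coords 4)" and w: "w \<in> carrier F2"
  shows "(\<lambda>\<rho>\<in>Hom F2 (SO 4). p (\<rho> w)) \<in> coord_ring_Hom 4 (SO 4) F2 {\<gamma> 1, \<gamma> 2}"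
  using p
proof (induction rule: generated_alg.induct)
  case (const c)
  have "(\<lambda>\<rho>\<in>Hom F2 (SO 4). (\<lambda>A\<in>carrier (SO 4). c) (\<rho> w)) = (\<lambda>\<rho>\<in>Hom F2 (SO 4). c)"
    by (intro restrict_ext) (simp add: Hom_SO w)
  then show ?case unfolding coord_ring_Hom_def by (simp only: generated_alg.const)
next
  case (gen f)
  have eq: "(\<lambda>\<rho>\<in>Hom F2 (SO 4). restrict f (carrier (SO 4)) (\<rho> w)) = (\<lambda>\<rho>\<in>Hom F2 (SO 4). f (\<rho> w))"
    by (intro restrict_ext) (simp add: Hom_SO w)
  consider i j where "f = (\<lambda>A. A $$ (i, j))" "i < 4" "j < 4" | "f = (\<lambda>A. inverse (det A))"
    using gen by (auto simp: GL_coords_def)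
  then show ?case
  proof cases
    case 1
    show ?thesis unfolding eq unfolding coord_ring_Hom_def 1(1) by (intro poly_mat_entry
        poly_mat_word w 1(2,3))
  next
    case 2
    have "(\<lambda>\<rho>\<in>Hom F2 (SO 4). f (\<rho> w)) = (\<lambda>\<rho>\<in>Hom F2 (SO 4). 1)"
      using Hom_SO w by (intro restrict_ext) (auto simp: 2 SO_def)
    then show ?thesis unfolding eq coord_ring_Hom_def by (simp only: generated_alg.const)
  qed
next
  case (add f g)
  have "(\<lambda>\<rho>\<in>Hom F2 (SO 4). (\<lambda>x\<in>carrier (SO 4). f x + g x) (\<rho> w))
      = (\<lambda>\<rho>\<in>Hom F2 (SO 4). (\<lambda>\<rho>\<in>Hom F2 (SO 4). f (\<rho> w)) \<rho> + (\<lambda>\<rho>\<in>Hom F2 (SO 4). g (\<rho> w)) \<rho>)"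
    by (intro restrict_ext) (simp add: Hom_SO w)
  then show ?case using add(3,4) unfolding coord_ring_Hom_def by (simp only: generated_alg.add)
next
  case (mult f g)
  have "(\<lambda>\<rho>\<in>Hom F2 (SO 4). (\<lambda>x\<in>carrier (SO 4). f x * g x) (\<rho> w))
      = (\<lambda>\<rho>\<in>Hom F2 (SO 4). (\<lambda>\<rho>\<in>Hom F2 (SO 4). f (\<rho> w)) \<rho> * (\<lambda>\<rho>\<in>Hom F2 (SO 4). g (\<rho> w)) \<rho>)"
    by (intro restrict_ext) (simp add: Hom_SO w)
  then show ?case using mult(3,4) unfolding coord_ring_Hom_def by (simp only: generated_alg.mult)
qed

abbreviation char_ring :: "((nat letter list \<Rightarrow> complex mat) \<Rightarrow> complex) set" where
  "char_ring \<equiv> coord_ring_X 4 (SO 4) F2 {\<gamma> 1, \<gamma> 2}"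

lemma conj_rep_Hom:
  assumes "A \<in> carrier (SO 4)" "\<rho> \<in> Hom F2 (SO 4)"
  shows "conj_rep (SO 4) F2 A \<rho> \<in> Hom F2 (SO 4)"
proof -
  obtain G H where "dt G = 1" "dt H = 1" "A = pi_mat G H" using pi_mat_surj[OF assms(1)] .
  moreover obtain a b where "a \<in> SL2_pairs" "b \<in> SL2_pairs" "\<rho> = rep a b" using rep_surj[OF
      assms(2)] .
  ultimately show ?thesis
    by (auto simp: conj_rep_rep intro!: rep_Hom) (auto simp: SL2_pairs_def conj2_def dt_mult)
qed

lemma char_ring_iff:
  "f \<in> char_ring \<longleftrightarrow> f \<in> coord_ring_Hom 4 (SO 4) F2 {\<gamma> 1, \<gamma> 2} \<and>
     (\<forall>A\<in>carrier (SO 4). \<forall>\<rho>\<in>Hom F2 (SO 4). f (conj_rep (SO 4) F2 A \<rho>) = f \<rho>)"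
  by (simp only: coord_ring_X_def mem_Collect_eq)

lemma char_ring_const: "(\<lambda>\<rho>\<in>Hom F2 (SO 4). c) \<in> char_ring"
  unfolding char_ring_iff by (intro conjI ballI, simp only: coord_ring_Hom_def generated_alg.const)
    (simp add: conj_rep_Hom)

lemma char_ring_add: "f \<in> char_ring \<Longrightarrow> g \<in> char_ring \<Longrightarrow> (\<lambda>\<rho>\<in>Hom F2 (SO 4). f \<rho> + g \<rho>) \<in> char_ring"
  unfolding char_ring_iff by (intro conjI ballI, simp only: coord_ring_Hom_def generated_alg.add)
    (simp add: conj_rep_Hom)

lemma char_ring_mult: "f \<in> char_ring \<Longrightarrow> g \<in> char_ring \<Longrightarrow> (\<lambda>\<rho>\<in>Hom F2 (SO 4). f \<rho> * g \<rho>) \<in> char_ring"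
  unfolding char_ring_iff by (intro conjI ballI, simp only: coord_ring_Hom_def generated_alg.mult)
    (simp add: conj_rep_Hom)

lemma char_ring_extensional: "f \<in> char_ring \<Longrightarrow> f \<in> extensional (Hom F2 (SO 4))"
  by (auto simp: coord_ring_X_def coord_ring_Hom_def dest: generated_alg_extensional)

lemma generated_alg_subset_char_ring:
  assumes "\<And>f. f \<in> F \<Longrightarrow> restrict f (Hom F2 (SO 4)) \<in> char_ring"
  shows "generated_alg (Hom F2 (SO 4)) F \<subseteq> char_ring"
proof
  fix f assume "f \<in> generated_alg (Hom F2 (SO 4)) F"
  then show "f \<in> char_ring"
    by (induction rule: generated_alg.induct) (assumption | rule assms char_ring_const char_ring_add
        char_ring_mult)+
qed

text \<open>Characters of algebraic representations are the main instance.\<close>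

lemma class_function_char_ring:
  assumes p: "p \<in> generated_alg (carrier (SO 4)) (GL_coords 4)" and w: "w \<in> carrier F2"
    and cl: "\<And>A B. A \<in> carrier (SO 4) \<Longrightarrow> B \<in> carrier (SO 4)
       \<Longrightarrow> p (A \<otimes>\<^bsub>SO 4\<^esub> B \<otimes>\<^bsub>SO 4\<^esub> inv\<^bsub>SO 4\<^esub> A) = p B"
  shows "(\<lambda>\<rho>\<in>Hom F2 (SO 4). p (\<rho> w)) \<in> char_ring"
  unfolding coord_ring_X_def
proof (intro CollectI conjI ballI)
  show "(\<lambda>\<rho>\<in>Hom F2 (SO 4). p (\<rho> w)) \<in> coord_ring_Hom 4 (SO 4) F2 {\<gamma> 1, \<gamma> 2}"
    using p w by (rule regular_on_word)
  fix A \<rho> assume A: "A \<in> carrier (SO 4)" and \<rho>: "\<rho> \<in> Hom F2 (SO 4)"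
  have "p (conj_rep (SO 4) F2 A \<rho> w) = p (\<rho> w)"
    using cl[OF A Hom_SO[OF \<rho> w]] w by (simp add: conj_rep_def)
  then show "(\<lambda>\<rho>\<in>Hom F2 (SO 4). p (\<rho> w)) (conj_rep (SO 4) F2 A \<rho>) = (\<lambda>\<rho>\<in>Hom F2 (SO 4). p (\<rho> w)) \<rho>"
    using A \<rho> by (simp add: conj_rep_Hom)
qed

lemma Q4_rep:
  assumes "g \<in> carrier F2" "h \<in> carrier F2" "a \<in> SL2_pairs" "b \<in> SL2_pairs"
  shows "Q4_fun g h (rep a b) = 4 * (tr (word_mat a g) * tr (word_mat a h) * tr (word_mat b (g \<otimes>\<^bsub>F2\<^esub>
      h))
    - tr (word_mat b g) * tr (word_mat b h) * tr (word_mat a (g \<otimes>\<^bsub>F2\<^esub> h)))"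
  using assms by (simp add: Q4_fun_def rep_Hom rep_apply Q4_pi_mat word_mat_mult)

lemma Q4_char_ring:
  assumes g: "g \<in> carrier F2" and h: "h \<in> carrier F2"
  shows "Q4_fun g h \<in> char_ring"
  unfolding coord_ring_X_def
proof (intro CollectI conjI ballI)
  let ?F = "{(\<lambda>\<rho>. p (\<rho> s)) | p s. p \<in> GL_coords 4 \<and> s \<in> {\<gamma> 1, \<gamma> 2}}"
  have entry: "\<exists>f\<in>polys ?F. \<forall>\<rho>\<in>Hom F2 (SO 4). \<rho> w $$ (i, j) = f \<rho>" if "w \<in> carrier F2" "i < 4" "j <
      4" for w i j
  proof -
    have "(\<lambda>\<rho>\<in>Hom F2 (SO 4). \<rho> w $$ (i, j)) \<in> generated_alg (Hom F2 (SO 4)) ?F"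
      by (intro poly_mat_entry poly_mat_word that)
    from this[unfolded generated_alg_iff[of _ "Hom F2 (SO 4)"]]
    obtain f where f: "f \<in> polys ?F" "(\<lambda>\<rho>\<in>Hom F2 (SO 4). \<rho> w $$ (i, j)) = restrict f (Hom F2 (SO
        4))"
      by (rule bexE)
    have "\<rho> w $$ (i, j) = f \<rho>" if "\<rho> \<in> Hom F2 (SO 4)" for \<rho>
      using fun_cong[OF f(2), of \<rho>] that by simp
    then show ?thesis by (intro bexI[OF _ f(1)] ballI)
  qed
  define e where "e w i j = (SOME f. f \<in> polys ?F \<and> (\<forall>\<rho>\<in>Hom F2 (SO 4). \<rho> w $$ (i, j) = f \<rho>))" for w
      i j
  have e: "e w i j \<in> polys ?F \<and> (\<forall>\<rho>\<in>Hom F2 (SO 4). \<rho> w $$ (i, j) = e w i j \<rho>)"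
    if "w \<in> carrier F2" "i < 4" "j < 4" for w i j
    using entry[OF that] unfolding e_def Bex_def by (rule someI_ex)
  let ?q = "\<lambda>\<rho>. 4 * ((e g 0 1 \<rho> - e g 1 0 \<rho>) * (e h 2 3 \<rho> - e h 3 2 \<rho>)
     - (e g 0 2 \<rho> - e g 2 0 \<rho>) * (e h 1 3 \<rho> - e h 3 1 \<rho>)
     + (e g 0 3 \<rho> - e g 3 0 \<rho>) * (e h 1 2 \<rho> - e h 2 1 \<rho>)
     + (e g 1 2 \<rho> - e g 2 1 \<rho>) * (e h 0 3 \<rho> - e h 3 0 \<rho>)
     - (e g 1 3 \<rho> - e g 3 1 \<rho>) * (e h 0 2 \<rho> - e h 2 0 \<rho>)
     + (e g 2 3 \<rho> - e g 3 2 \<rho>) * (e h 0 1 \<rho> - e h 1 0 \<rho>))"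
  have "?q \<in> polys ?F"
    by (intro polys_add polys_mult polys_diff polys_const e[THEN conjunct1] g h) simp_all
  moreover have "Q4_fun g h = restrict ?q (Hom F2 (SO 4))"
    unfolding Q4_fun_def by (intro restrict_ext) (simp only: Q4_expand, simp add: e[THEN conjunct2,
        rule_format] g h)
  ultimately show "Q4_fun g h \<in> coord_ring_Hom 4 (SO 4) F2 {\<gamma> 1, \<gamma> 2}"
    unfolding coord_ring_Hom_def generated_alg_iff[of _ "Hom F2 (SO 4)"] by (intro bexI)
  fix A \<rho> assume A: "A \<in> carrier (SO 4)" and \<rho>: "\<rho> \<in> Hom F2 (SO 4)"
  obtain G H where GH: "dt G = 1" "dt H = 1" "A = pi_mat G H" using pi_mat_surj[OF A] .
  obtain a b where ab: "a \<in> SL2_pairs" "b \<in> SL2_pairs" "\<rho> = rep a b" using rep_surj[OF \<rho>] .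
  have "conj2 G a \<in> SL2_pairs" "conj2 H b \<in> SL2_pairs"
    using ab GH by (auto simp: SL2_pairs_def conj2_def dt_mult)
  then show "Q4_fun g h (conj_rep (SO 4) F2 A \<rho>) = Q4_fun g h \<rho>"
    using ab GH by (simp add: conj_rep_rep Q4_rep g h word_mat_conj tr_conj)
qed

section \<open>Parity of polynomials\<close>

text \<open>Linear combinations of monomials, in a form suitable for averaging over sign changes.\<close>

inductive_set lin_span :: "('x \<Rightarrow> complex) set \<Rightarrow> ('x \<Rightarrow> complex) set" for M where
  zero: "(\<lambda>x. 0) \<in> lin_span M"
| step: "f \<in> lin_span M \<Longrightarrow> m \<in> M \<Longrightarrow> (\<lambda>x. c * m x + f x) \<in> lin_span M"

lemma lin_span_add: "f \<in> lin_span M \<Longrightarrow> g \<in> lin_span M \<Longrightarrow> (\<lambda>x. f x + g x) \<in> lin_span M"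
proof (induction rule: lin_span.induct)
  case (step f m c)
  then show ?case using lin_span.step[of "\<lambda>x. f x + g x" M m c] by (simp add: add.assoc)
qed simp

lemma lin_span_cmult: "f \<in> lin_span M \<Longrightarrow> (\<lambda>x. c * f x) \<in> lin_span M"
proof (induction rule: lin_span.induct)
  case (step f m d)
  then show ?case using lin_span.step[of "\<lambda>x. c * f x" M m "c * d"] by (simp add: algebra_simps)
qed (simp add: lin_span.zero)

lemma lin_span_gen: "m \<in> M \<Longrightarrow> m \<in> lin_span M"
  using lin_span.step[OF lin_span.zero, of m M 1] by simp

lemma lin_span_subset:
  assumes "f \<in> lin_span M" "(\<lambda>x. 0) \<in> V" "\<And>f m c. f \<in> V \<Longrightarrow> m \<in> M \<Longrightarrow> (\<lambda>x. c * m x + f x) \<in> V"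
  shows "f \<in> V"
  using assms(1) by (induction rule: lin_span.induct) (auto intro: assms(2,3))

text \<open>\<open>M\<close> stands for the set of monomials in the functions of \<open>F\<close>.\<close>

lemma polys_lin_span:
  assumes g: "g \<in> polys F" and one: "(\<lambda>x. 1) \<in> M"
    and mult: "\<And>f m. f \<in> F \<Longrightarrow> m \<in> M \<Longrightarrow> (\<lambda>x. f x * m x) \<in> M"
  shows "g \<in> lin_span M"
proof -
  have "(\<lambda>x. g x * h x) \<in> lin_span M" if "h \<in> lin_span M" for h
    using g that
  proof (induction arbitrary: h rule: polys_induct)
    case (const c)
    then show ?case by (rule lin_span_cmult)
  next
    case (gen f)
    show ?case
      using gen(2)
    proof (induction rule: lin_span.induct)
      case (step h m c)
      then show ?case
        using lin_span.step[OF step(3) mult[OF gen(1) step(2)], of c] by (simp add: algebra_simps)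
    qed (simp add: lin_span.zero)
  next
    case (add f g)
    then show ?case using lin_span_add[OF add(3)[OF add(5)] add(4)[OF add(5)]] by (simp add:
        distrib_right)
  next
    case (mult f g)
    then show ?case by (simp add: mult.assoc)
  qed
  from this[OF lin_span_gen[OF one]] show ?thesis by simp
qed

text \<open>Averaging over \<open>\<tau>\<close> keeps the invariant monomials and kills those that change their sign.\<close>

lemma lin_span_invariant:
  assumes f: "f \<in> lin_span M" and inv: "\<And>x. f (\<tau> x) = f x"
    and M: "\<And>m. m \<in> M \<Longrightarrow> (\<forall>x. m (\<tau> x) = m x) \<or> (\<forall>x. m (\<tau> x) = - m x)"
  shows "f \<in> lin_span {m \<in> M. \<forall>x. m (\<tau> x) = m x}"
proof -
  have "(\<lambda>x. (f x + f (\<tau> x)) / 2) \<in> lin_span {m \<in> M. \<forall>x. m (\<tau> x) = m x}"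
    using f
  proof (induction rule: lin_span.induct)
    case zero
    show ?case using lin_span.zero by simp
  next
    case (step f m c)
    show ?case
    proof (cases "\<forall>x. m (\<tau> x) = m x")
      case True
      then have "(\<lambda>x. c * m x + (f x + f (\<tau> x)) / 2) \<in> lin_span {m \<in> M. \<forall>x. m (\<tau> x) = m x}"
        using step by (intro lin_span.step) auto
      then show ?thesis using True by (simp add: field_simps)
    next
      case False
      then have "\<forall>x. m (\<tau> x) = - m x" using M[OF step(2)] by blast
      then show ?thesis using step(3) by simp
    qed
  qed
  then show ?thesis using inv by simp
qed

text \<open>These generate the even polynomials in two variables.\<close>

definition square_coords :: "(complex \<times> complex \<Rightarrow> complex) set" where
  "square_coords = {\<lambda>v. fst v * fst v, \<lambda>v. fst v * snd v, \<lambda>v. snd v * snd v}"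

lemma even_monomial:
  assumes "even (i + j)"
  shows "(\<lambda>v. fst v ^ i * snd v ^ j) \<in> polys square_coords"
proof -
  have gens: "(\<lambda>v. fst v * fst v) \<in> polys square_coords" "(\<lambda>v. fst v * snd v) \<in> polys square_coords"
    "(\<lambda>v. snd v * snd v) \<in> polys square_coords"
    by (rule polys_gen, simp add: square_coords_def)+
  define e where "e = i mod 2"
  have i: "i = 2 * (i div 2) + e" by (simp add: e_def)
  have j: "j = 2 * (j div 2) + e" using assms by (auto simp: e_def elim!: evenE oddE)
  have "(\<lambda>v. (fst v * fst v) ^ (i div 2) * (snd v * snd v) ^ (j div 2) * (fst v * snd v) ^ e) \<in>
      polys square_coords"
    by (intro polys_mult[OF polys_mult[OF polys_power polys_power] polys_power] gens)
  moreover have "(\<lambda>v::complex \<times> complex. (fst v * fst v) ^ (i div 2) * (snd v * snd v) ^ (j div 2) *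
      (fst v * snd v) ^ e)
      = (\<lambda>v::complex \<times> complex. fst v ^ i * snd v ^ j)"
  proof (rule ext)
    fix v :: "complex \<times> complex"
    have "fst v ^ i = (fst v * fst v) ^ (i div 2) * fst v ^ e" "snd v ^ j = (snd v * snd v) ^ (j div
        2) * snd v ^ e"
      using i j by (metis power_add power_mult power2_eq_square)+
    then show "(fst v * fst v) ^ (i div 2) * (snd v * snd v) ^ (j div 2) * (fst v * snd v) ^ e = fst
        v ^ i * snd v ^ j"
      by (simp add: power_mult_distrib)
  qed
  ultimately show ?thesis by simp
qed

lemma tr_surj_pair: "\<exists>A. dt A = 1 \<and> tr A = s"
  by (intro exI[of _ "M2 s (- 1) 1 0"]) (simp add: m2_simps)

text \<open>Regular class functions of \<open>SO(4)\<close>. A class function gives an invariant of the value of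
  the first generator; its expression in six traces is restricted to the pairs whose second matrix
  is \<open>1\<close>. The result is even since \<open>(A, B)\<close> and \<open>(- A, - B)\<close> have the same image.\<close>

theorem class_function_lift:
  assumes p: "p \<in> generated_alg (carrier (SO 4)) (GL_coords 4)"
    and cl: "\<And>A B. A \<in> carrier (SO 4) \<Longrightarrow> B \<in> carrier (SO 4)
       \<Longrightarrow> p (A \<otimes>\<^bsub>SO 4\<^esub> B \<otimes>\<^bsub>SO 4\<^esub> inv\<^bsub>SO 4\<^esub> A) = p B"
  obtains P where "P \<in> polys square_coords"
    "\<And>A B. dt A = 1 \<Longrightarrow> dt B = 1 \<Longrightarrow> p (pi_mat A B) = P (tr A, tr B)"
proof -
  have w: "[(1, True)] \<in> carrier F2" by (simp add: carrier_F2)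
  obtain H where H: "H \<in> polys coords6" "lifts (\<lambda>\<rho>\<in>Hom F2 (SO 4). p (\<rho> [(1, True)])) H"
    using coord_ring_X_lift[OF class_function_char_ring[OF p w cl]] by metis
  define P where "P v = H ((fst v, 2, fst v), (snd v, 2, snd v))" for v :: "complex \<times> complex"
  have P: "p (pi_mat A B) = P (tr A, tr B)" if "dt A = 1" "dt B = 1" for A B
  proof -
    have ab: "(A, 1) \<in> SL2_pairs" "(B, 1) \<in> SL2_pairs" using that by (simp_all add: SL2_pairs_def)
    then have "(\<lambda>\<rho>\<in>Hom F2 (SO 4). p (\<rho> [(1, True)])) (rep (A, 1) (B, 1)) = H (trs (A, 1), trs (B,
        1))"
      using H(2) unfolding lifts_def by blast
    then show ?thesis
      using ab w by (simp add: rep_Hom rep_apply letter_mat_def P_def trs_def)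
  qed
  have "P \<in> polys {fst, snd}"
    unfolding P_def
  proof (rule polys_subst[OF H(1)])
    fix f assume "f \<in> coords6"
    then show "(\<lambda>v. f ((fst v, 2, fst v), snd v, 2, snd v)) \<in> polys {fst, snd}"
      unfolding coords6_def
      by (elim insertE emptyE; simp only: fst_conv snd_conv)
        (rule polys_const | rule polys_gen, simp)+
  qed
  define M where "M = {\<lambda>v::complex \<times> complex. fst v ^ i * snd v ^ j | i j. True}"
  have "P \<in> lin_span M"
  proof (rule polys_lin_span[OF \<open>P \<in> polys {fst, snd}\<close>])
    show "(\<lambda>x. 1) \<in> M" unfolding M_def by (intro CollectI exI[of _ 0]) simp
    fix f m assume f: "f \<in> {fst, snd :: complex \<times> complex \<Rightarrow> complex}" and "m \<in> M"
    then obtain i j where m: "m = (\<lambda>v. fst v ^ i * snd v ^ j)" by (auto simp: M_def)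
    have "(\<lambda>x. fst x * m x) = (\<lambda>v. fst v ^ Suc i * snd v ^ j)" "(\<lambda>x. snd x * m x) = (\<lambda>v. fst v ^ i *
        snd v ^ Suc j)"
      by (simp_all add: m mult_ac)
    then have "(\<lambda>x. fst x * m x) \<in> M" "(\<lambda>x. snd x * m x) \<in> M" unfolding M_def by blast+
    then show "(\<lambda>x. f x * m x) \<in> M" using f by blast
  qed
  moreover define \<tau> where "\<tau> v = (- fst v, - snd v)" for v :: "complex \<times> complex"
  moreover have "P (\<tau> v) = P v" for v
  proof -
    obtain A B where "dt A = 1" "tr A = fst v" "dt B = 1" "tr B = snd v" using tr_surj_pair by metis
    then show ?thesis using P[of A B] P[of "- A" "- B"] by (simp add: m2_uminus pi_mat_uminus \<tau>_def)
  qed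
  moreover have sign: "(\<lambda>v. fst v ^ i * snd v ^ j) (\<tau> v) = (-1) ^ (i + j) * (fst v ^ i * snd v ^ j)"
      for i j v
    by (simp add: \<tau>_def power_minus[of "fst v"] power_minus[of "snd v"] power_add)
  have "(\<forall>x. m (\<tau> x) = m x) \<or> (\<forall>x. m (\<tau> x) = - m x)" if "m \<in> M" for m
  proof -
    from that obtain i j where m: "m = (\<lambda>v. fst v ^ i * snd v ^ j)" by (auto simp: M_def)
    show ?thesis using sign[where i = i and j = j] by (cases "even (i + j)") (auto simp: m)
  qed
  ultimately have "P \<in> lin_span {m \<in> M. \<forall>x. m (\<tau> x) = m x}" by (intro lin_span_invariant)
  then have "P \<in> polys square_coords"
  proof (rule lin_span_subset)
    fix f m c assume f: "f \<in> polys square_coords" and m: "m \<in> {m \<in> M. \<forall>x. m (\<tau> x) = m x}"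
    then obtain i j where m_eq: "m = (\<lambda>v. fst v ^ i * snd v ^ j)" by (auto simp: M_def)
    have "m \<in> polys square_coords"
    proof (cases "even (i + j)")
      case True
      then show ?thesis unfolding m_eq by (rule even_monomial)
    next
      case False
      have "m x = 0" for x
      proof -
        have "m (\<tau> x) = - m x" using sign[where i = i and j = j and v = x] False by (simp add: m_eq)
        moreover have "m (\<tau> x) = m x" using m by blast
        ultimately show ?thesis by (simp add: eq_neg_iff_add_eq_0)
      qed
      then have "m = (\<lambda>x. 0)" by (rule ext)
      then show ?thesis by (simp only: polys_const)
    qed
    then show "(\<lambda>x. c * m x + f x) \<in> polys square_coords"
      by (intro polys_add polys_mult polys_const f)
  qed (rule polys_const)
  then show thesis using P by (rule that)
qed

section \<open>The trace algebra\<close>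

text \<open>The algebras and modules of functions are computed in terms of the six traces from here
  on.\<close>

definition lifted :: "((nat letter list \<Rightarrow> complex mat) \<Rightarrow> complex) set \<Rightarrow> (triple \<times> triple \<Rightarrow> complex)
    set" where
  "lifted R = {H. \<exists>f\<in>R. lifts f H}"

abbreviation Hom_alg :: "((nat letter list \<Rightarrow> complex mat) \<Rightarrow> complex) set \<Rightarrow> ((nat letter list \<Rightarrow>
    complex mat) \<Rightarrow> complex) set" where
  "Hom_alg F \<equiv> generated_alg (Hom F2 (SO 4)) F"

lemma lifted_const: "(\<lambda>v. c) \<in> lifted (Hom_alg F)"
  unfolding lifted_def lifts_def
  by (intro CollectI bexI[OF _ generated_alg.const[of c]]) (simp add: rep_Hom)

lemma lifted_add:
  assumes "H \<in> lifted (Hom_alg F)" "K \<in> lifted (Hom_alg F)"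
  shows "(\<lambda>v. H v + K v) \<in> lifted (Hom_alg F)"
proof -
  obtain f g where "f \<in> Hom_alg F" "g \<in> Hom_alg F" "lifts f H" "lifts g K"
    using assms unfolding lifted_def by blast
  then show ?thesis
    unfolding lifted_def lifts_def
    by (intro CollectI bexI[OF _ generated_alg.add[of f _ _ g]]) (simp_all add: rep_Hom)
qed

lemma lifted_mult:
  assumes "H \<in> lifted (Hom_alg F)" "K \<in> lifted (Hom_alg F)"
  shows "(\<lambda>v. H v * K v) \<in> lifted (Hom_alg F)"
proof -
  obtain f g where "f \<in> Hom_alg F" "g \<in> Hom_alg F" "lifts f H" "lifts g K"
    using assms unfolding lifted_def by blast
  then show ?thesis
    unfolding lifted_def lifts_def
    by (intro CollectI bexI[OF _ generated_alg.mult[of f _ _ g]]) (simp_all add: rep_Hom)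
qed

lemma lifted_diff:
  assumes "H \<in> lifted (Hom_alg F)" "K \<in> lifted (Hom_alg F)"
  shows "(\<lambda>v. H v - K v) \<in> lifted (Hom_alg F)"
  using lifted_add[OF assms(1) lifted_mult[OF lifted_const[of "- 1"] assms(2)]] by simp

lemma lifted_cdivide: "H \<in> lifted (Hom_alg F) \<Longrightarrow> (\<lambda>v. H v / c) \<in> lifted (Hom_alg F)"
  using lifted_mult[OF _ lifted_const[of "inverse c" F], of H] by (simp add: divide_inverse)

lemma lifted_power: "H \<in> lifted (Hom_alg F) \<Longrightarrow> (\<lambda>v. H v ^ n) \<in> lifted (Hom_alg F)"
  by (induction n) (simp_all add: lifted_const lifted_mult)

lemmas lifted_intros = lifted_const lifted_add lifted_mult lifted_diff lifted_cdivide

lemma lifted_gen: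
  assumes "f \<in> F" "lifts f H"
  shows "H \<in> lifted (Hom_alg F)"
  unfolding lifted_def lifts_def
  by (intro CollectI bexI[OF _ generated_alg.gen[OF assms(1)]]) (use assms(2) in \<open>simp add: rep_Hom
      lifts_def\<close>)

abbreviation word_traces :: "((nat letter list \<Rightarrow> complex mat) \<Rightarrow> complex) set" where
  "word_traces \<equiv> {(\<lambda>\<rho>. mat_trace (\<rho> w)) | w. w \<in> carrier F2}"

text \<open>\<open>q\<close> is the Fricke polynomial of the word \<open>w\<close>. Since \<open>pi_mat A B\<close> has trace \<open>tr A tr B\<close>,
  the trace of \<open>w\<close> on \<open>SO(4)\<close> is the product of the two values of \<open>q\<close>.\<close>

definition word_trace :: "nat letter list \<Rightarrow> (triple \<Rightarrow> complex) \<Rightarrow> bool" where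
  "word_trace w q \<longleftrightarrow> (\<forall>a\<in>SL2_pairs. tr (word_mat a w) = q (trs a))"

lemma lifted_word:
  assumes "w \<in> carrier F2" "word_trace w q"
  shows "(\<lambda>v. q (fst v) * q (snd v)) \<in> lifted (Hom_alg word_traces)"
proof (rule lifted_gen)
  show "(\<lambda>\<rho>. mat_trace (\<rho> w)) \<in> word_traces" using assms(1) by blast
  show "lifts (\<lambda>\<rho>. mat_trace (\<rho> w)) (\<lambda>v. q (fst v) * q (snd v))"
    using assms by (auto simp: lifts_def rep_apply mat_trace_pi_mat word_trace_def)
qed

lemma tr_square: "dt A = 1 \<Longrightarrow> tr (A * A) = tr A * tr A - 2"
proof -
  have "tr (A * A) = tr A * tr A - 2 * dt A" by (simp add: m2_simps algebra_simps)
  then show "dt A = 1 \<Longrightarrow> ?thesis" by simp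
qed

lemma word_mat_append: "word_mat a (u @ v) = word_mat a u * word_mat a v"
  by (induction u) (simp_all add: mult.assoc)

lemma word_trace_square:
  "word_trace w q \<Longrightarrow> word_trace (w @ w) (\<lambda>t. q t * q t - 2)"
  by (simp add: word_trace_def word_mat_append tr_square dt_word_mat)

text \<open>The traces of \<open>w\<close> and of its square are \<open>q q'\<close> and \<open>(q\<^sup>2 - 2) (q'\<^sup>2 - 2)\<close>, where \<open>q\<close> and
  \<open>q'\<close> are the two values of the Fricke polynomial.\<close>

lemma lifted_square_sum:
  assumes "w \<in> carrier F2" "w @ w \<in> carrier F2" "word_trace w q"
  shows "(\<lambda>v. q (fst v) * q (fst v) + q (snd v) * q (snd v)) \<in> lifted (Hom_alg word_traces)"
proof -
  define q1 q2 where "q1 = (\<lambda>v. q (fst v) * q (snd v))"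
    and "q2 = (\<lambda>v. (q (fst v) * q (fst v) - 2) * (q (snd v) * q (snd v) - 2))"
  have 1: "q1 \<in> lifted (Hom_alg word_traces)"
    unfolding q1_def by (rule lifted_word[OF assms(1,3)])
  have 2: "q2 \<in> lifted (Hom_alg word_traces)"
    unfolding q2_def by (rule lifted_word[OF assms(2) word_trace_square[OF assms(3)]])
  have "(\<lambda>v. (q1 v * q1 v + 4 - q2 v) / 2) \<in> lifted (Hom_alg word_traces)"
    by (intro lifted_intros 1 2)
  also have "(\<lambda>v. (q1 v * q1 v + 4 - q2 v) / 2) = (\<lambda>v. q (fst v) * q (fst v) + q (snd v) * q (snd
      v))"
    by (simp add: q1_def q2_def fun_eq_iff field_simps)
  finally show ?thesis .
qed

abbreviation (input) X1 :: "triple \<times> triple \<Rightarrow> complex" where "X1 v \<equiv> fst (fst v)"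
abbreviation (input) Y1 :: "triple \<times> triple \<Rightarrow> complex" where "Y1 v \<equiv> fst (snd (fst v))"
abbreviation (input) Z1 :: "triple \<times> triple \<Rightarrow> complex" where "Z1 v \<equiv> snd (snd (fst v))"
abbreviation (input) X2 :: "triple \<times> triple \<Rightarrow> complex" where "X2 v \<equiv> fst (snd v)"
abbreviation (input) Y2 :: "triple \<times> triple \<Rightarrow> complex" where "Y2 v \<equiv> fst (snd (snd v))"
abbreviation (input) Z2 :: "triple \<times> triple \<Rightarrow> complex" where "Z2 v \<equiv> snd (snd (snd v))"

abbreviation tx :: "triple \<Rightarrow> complex" where "tx t \<equiv> fst t"
abbreviation ty :: "triple \<Rightarrow> complex" where "ty t \<equiv> fst (snd t)"
abbreviation tz :: "triple \<Rightarrow> complex" where "tz t \<equiv> snd (snd t)"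

lemma tr_identities:
  assumes "dt A = 1" "dt B = 1"
  shows "tr (A * adj B) = tr A * tr B - tr (A * B)"
    "tr (A * (A * B)) = tr A * tr (A * B) - tr B"
    "tr (A * (B * B)) = tr B * tr (A * B) - tr A"
    "tr (A * (B * (adj A * adj B))) = tr A * tr A + tr B * tr B + tr (A * B) * tr (A * B)
       - tr A * tr B * tr (A * B) - 2"
proof -
  show "tr (A * adj B) = tr A * tr B - tr (A * B)" by (simp add: m2_simps algebra_simps)
  have "tr (A * (A * B)) = tr A * tr (A * B) - dt A * tr B" "tr (A * (B * B)) = tr B * tr (A * B) -
      dt B * tr A"
    "tr (A * (B * (adj A * adj B))) = tr A * tr A * dt B + tr B * tr B * dt A + tr (A * B) * tr (A *
        B)
       - tr A * tr B * tr (A * B) - 2 * dt A * dt B"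
    by (simp_all add: m2_simps algebra_simps)
  then show "tr (A * (A * B)) = tr A * tr (A * B) - tr B" "tr (A * (B * B)) = tr B * tr (A * B) - tr
      A"
    "tr (A * (B * (adj A * adj B))) = tr A * tr A + tr B * tr B + tr (A * B) * tr (A * B)
       - tr A * tr B * tr (A * B) - 2"
    using assms by simp_all
qed

abbreviation (input) la :: "nat letter" where "la \<equiv> (1, True)"
abbreviation (input) lb :: "nat letter" where "lb \<equiv> (2, True)"
abbreviation (input) la' :: "nat letter" where "la' \<equiv> (1, False)"
abbreviation (input) lb' :: "nat letter" where "lb' \<equiv> (2, False)"

lemma traces_of_words:
  "word_trace [la] tx" "word_trace [lb] ty" "word_trace [la, lb] tz"
  "word_trace [la, lb'] (\<lambda>t. tx t * ty t - tz t)"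
  "word_trace [la, la, lb] (\<lambda>t. tx t * tz t - ty t)"
  "word_trace [la, lb, lb] (\<lambda>t. ty t * tz t - tx t)"
  "word_trace [la, lb, la', lb'] (\<lambda>t. tx t * tx t + ty t * ty t + tz t * tz t - tx t * ty t * tz t -
      2)"
  by (auto simp: word_trace_def letter_mat_def SL2_pairs_def trs_def tr_identities)

lemma word_carriers:
  "[la] \<in> carrier F2" "[lb] \<in> carrier F2" "[la, lb] \<in> carrier F2" "[la, lb'] \<in> carrier F2"
  "[la, la, lb] \<in> carrier F2" "[la, lb, lb] \<in> carrier F2" "[la, lb, la', lb'] \<in> carrier F2"
  "[la] @ [la] \<in> carrier F2" "[lb] @ [lb] \<in> carrier F2" "[la, lb] @ [la, lb] \<in> carrier F2"
  "[la, lb'] @ [la, lb'] \<in> carrier F2" "[la, la, lb] @ [la, la, lb] \<in> carrier F2"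
  "[la, lb, lb] @ [la, lb, lb] \<in> carrier F2" "[lb, la'] \<in> carrier F2"
  by (simp_all add: carrier_F2 inv_letter_def)

text \<open>In these coordinates the exchange of the two triples of traces changes the sign of the
  differences only, so that symmetric and antisymmetric functions are told apart on monomials.\<close>

definition sx :: "triple \<times> triple \<Rightarrow> complex" where "sx v = X1 v + X2 v"
definition sy :: "triple \<times> triple \<Rightarrow> complex" where "sy v = Y1 v + Y2 v"
definition sz :: "triple \<times> triple \<Rightarrow> complex" where "sz v = Z1 v + Z2 v"
definition dx :: "triple \<times> triple \<Rightarrow> complex" where "dx v = X1 v - X2 v"
definition dy :: "triple \<times> triple \<Rightarrow> complex" where "dy v = Y1 v - Y2 v"
definition dz :: "triple \<times> triple \<Rightarrow> complex" where "dz v = Z1 v - Z2 v"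

lemmas sd_defs = sx_def sy_def sz_def dx_def dy_def dz_def

text \<open>These functions generate all even polynomials that are symmetric under the exchange of the
  two triples. With \<open>B(x, y) = x\<^sup>2 y\<^sup>2 + x'\<^sup>2 y'\<^sup>2\<close> and \<open>e = x y z + x' y' z'\<close>, the words
  \<open>w = \<gamma>\<^sub>1 \<gamma>\<^sub>2\<^sup>-\<^sup>1\<close>, \<open>\<gamma>\<^sub>1\<^sup>2 \<gamma>\<^sub>2\<close> and \<open>\<gamma>\<^sub>1 \<gamma>\<^sub>2\<^sup>2\<close> and their squares give the mixed terms such as
  \<open>x y z' + x' y' z\<close> and the differences \<open>B(x, y) - 2 e\<close>, \<open>B(x, z) - 2 e\<close>, \<open>B(y, z) - 2 e\<close>. The
  commutator gives one more linear relation between these four unknowns, and all of them can be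
  solved for.\<close>

lemma trace_alg_symmetric:
  defines "TL \<equiv> lifted (Hom_alg word_traces)"
  shows "(\<lambda>v. sx v * sx v) \<in> TL" "(\<lambda>v. dx v * dx v) \<in> TL" "(\<lambda>v. sy v * sy v) \<in> TL"
    "(\<lambda>v. dy v * dy v) \<in> TL" "(\<lambda>v. sz v * sz v) \<in> TL" "(\<lambda>v. dz v * dz v) \<in> TL"
    "(\<lambda>v. sx v * dx v * (sy v * dy v)) \<in> TL" "(\<lambda>v. sx v * dx v * (sz v * dz v)) \<in> TL"
    "(\<lambda>v. sy v * dy v * (sz v * dz v)) \<in> TL"
    "(\<lambda>v. sx v * sy v * sz v) \<in> TL" "(\<lambda>v. sx v * dy v * dz v) \<in> TL"
    "(\<lambda>v. dx v * sy v * dz v) \<in> TL" "(\<lambda>v. dx v * dy v * sz v) \<in> TL"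
proof -
  define px py pz where "px = (\<lambda>v. X1 v * X2 v)" and "py = (\<lambda>v. Y1 v * Y2 v)" and "pz = (\<lambda>v. Z1 v *
      Z2 v)"
  define qx qy qz where "qx = (\<lambda>v. X1 v * X1 v + X2 v * X2 v)" and "qy = (\<lambda>v. Y1 v * Y1 v + Y2 v *
      Y2 v)"
    and "qz = (\<lambda>v. Z1 v * Z1 v + Z2 v * Z2 v)"
  define pw pu pv where "pw = (\<lambda>v. (X1 v * Y1 v - Z1 v) * (X2 v * Y2 v - Z2 v))"
    and "pu = (\<lambda>v. (X1 v * Z1 v - Y1 v) * (X2 v * Z2 v - Y2 v))"
    and "pv = (\<lambda>v. (Y1 v * Z1 v - X1 v) * (Y2 v * Z2 v - X2 v))"
  define qw qu qv where
    "qw = (\<lambda>v. (X1 v * Y1 v - Z1 v) * (X1 v * Y1 v - Z1 v) + (X2 v * Y2 v - Z2 v) * (X2 v * Y2 v -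
        Z2 v))"
    and "qu = (\<lambda>v. (X1 v * Z1 v - Y1 v) * (X1 v * Z1 v - Y1 v) + (X2 v * Z2 v - Y2 v) * (X2 v * Z2 v
        - Y2 v))"
    and "qv = (\<lambda>v. (Y1 v * Z1 v - X1 v) * (Y1 v * Z1 v - X1 v) + (Y2 v * Z2 v - X2 v) * (Y2 v * Z2 v
        - X2 v))"
  define k where "k = (\<lambda>v. (X1 v * X1 v + Y1 v * Y1 v + Z1 v * Z1 v - X1 v * Y1 v * Z1 v - 2)
    * (X2 v * X2 v + Y2 v * Y2 v + Z2 v * Z2 v - X2 v * Y2 v * Z2 v - 2))"
  have p: "px \<in> TL" "py \<in> TL" "pz \<in> TL" "pw \<in> TL" "pu \<in> TL" "pv \<in> TL" "k \<in> TL"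
    unfolding px_def py_def pz_def pw_def pu_def pv_def k_def TL_def
    by (rule lifted_word[OF word_carriers(1) traces_of_words(1)] lifted_word[OF word_carriers(2)
        traces_of_words(2)]
      lifted_word[OF word_carriers(3) traces_of_words(3)] lifted_word[OF word_carriers(4)
          traces_of_words(4)]
      lifted_word[OF word_carriers(5) traces_of_words(5)] lifted_word[OF word_carriers(6)
          traces_of_words(6)]
      lifted_word[OF word_carriers(7) traces_of_words(7)])+
  have q: "qx \<in> TL" "qy \<in> TL" "qz \<in> TL" "qw \<in> TL" "qu \<in> TL" "qv \<in> TL"
    unfolding qx_def qy_def qz_def qw_def qu_def qv_def TL_def
    by (rule lifted_square_sum[OF word_carriers(1,8) traces_of_words(1)] lifted_square_sum[OF
        word_carriers(2,9) traces_of_words(2)]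
      lifted_square_sum[OF word_carriers(3,10) traces_of_words(3)] lifted_square_sum[OF
          word_carriers(4,11) traces_of_words(4)]
      lifted_square_sum[OF word_carriers(5,12) traces_of_words(5)] lifted_square_sum[OF
          word_carriers(6,13) traces_of_words(6)])+
  note ints = lifted_intros[of _ word_traces, folded TL_def]
  define ux uy uz where "ux = (\<lambda>v. py v * pz v + px v - pv v)" and "uy = (\<lambda>v. px v * pz v + py v -
      pu v)"
    and "uz = (\<lambda>v. px v * py v + pz v - pw v)"
  have u: "ux \<in> TL" "uy \<in> TL" "uz \<in> TL"
    unfolding ux_def uy_def uz_def by (intro ints p q)+
  have u_eq: "ux v = Y1 v * Z1 v * X2 v + Y2 v * Z2 v * X1 v" "uy v = X1 v * Z1 v * Y2 v + X2 v * Z2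
      v * Y1 v"
    "uz v = X1 v * Y1 v * Z2 v + X2 v * Y2 v * Z1 v" for v
    by (simp_all add: ux_def uy_def uz_def px_def py_def pz_def pw_def pu_def pv_def algebra_simps)
  \<comment> \<open>\<open>axy = B(x, y) - 2 e\<close>, and similarly for the other two pairs of variables\<close>
  define axy axz ayz where "axy = (\<lambda>v. qw v - qz v)" and "axz = (\<lambda>v. qu v - qy v)" and "ayz = (\<lambda>v.
      qv v - qx v)"
  have a: "axy \<in> TL" "axz \<in> TL" "ayz \<in> TL"
    unfolding axy_def axz_def ayz_def by (intro ints p q)+
  \<comment> \<open>The product \<open>k\<close> of the two commutator traces contains \<open>- B(x, y) - B(x, z) - B(y, z) + 2 e\<close>,
      that is,
    \<open>- axy - axz - ayz - 4 e\<close>, and otherwise only known terms.\<close>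
  define e where "e = (\<lambda>v. (px v * px v + py v * py v + pz v * pz v + qx v * qy v + qx v * qz v + qy
      v * qz v
    - axy v - axz v - ayz v - 2 * (qx v + qy v + qz v) + 4 - px v * ux v - py v * uy v - pz v * uz v
    + px v * py v * pz v - k v) / 4)"
  have e: "e \<in> TL"
    unfolding e_def by (intro ints p q u a)
  have e_eq: "e v = X1 v * Y1 v * Z1 v + X2 v * Y2 v * Z2 v" for v
    unfolding e_def u_eq
    by (simp add: px_def py_def pz_def qx_def qy_def qz_def axy_def axz_def ayz_def qw_def qu_def
        qv_def k_def)
      (simp add: algebra_simps)
  have *: "(\<lambda>v. qx v + 2 * px v) \<in> TL" "(\<lambda>v. qx v - 2 * px v) \<in> TL" "(\<lambda>v. qy v + 2 * py v) \<in> TL"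
    "(\<lambda>v. qy v - 2 * py v) \<in> TL" "(\<lambda>v. qz v + 2 * pz v) \<in> TL" "(\<lambda>v. qz v - 2 * pz v) \<in> TL"
    "(\<lambda>v. 2 * (axy v + 2 * e v) - qx v * qy v) \<in> TL" "(\<lambda>v. 2 * (axz v + 2 * e v) - qx v * qz v) \<in>
        TL"
    "(\<lambda>v. 2 * (ayz v + 2 * e v) - qy v * qz v) \<in> TL"
    "(\<lambda>v. e v + ux v + uy v + uz v) \<in> TL" "(\<lambda>v. e v + ux v - uy v - uz v) \<in> TL"
    "(\<lambda>v. e v - ux v + uy v - uz v) \<in> TL" "(\<lambda>v. e v - ux v - uy v + uz v) \<in> TL"
    by (intro ints p q u a e)+
  have eqs: "(\<lambda>v. sx v * sx v) = (\<lambda>v. qx v + 2 * px v)" "(\<lambda>v. dx v * dx v) = (\<lambda>v. qx v - 2 * px v)"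
    "(\<lambda>v. sy v * sy v) = (\<lambda>v. qy v + 2 * py v)" "(\<lambda>v. dy v * dy v) = (\<lambda>v. qy v - 2 * py v)"
    "(\<lambda>v. sz v * sz v) = (\<lambda>v. qz v + 2 * pz v)" "(\<lambda>v. dz v * dz v) = (\<lambda>v. qz v - 2 * pz v)"
    "(\<lambda>v. sx v * dx v * (sy v * dy v)) = (\<lambda>v. 2 * (axy v + 2 * e v) - qx v * qy v)"
    "(\<lambda>v. sx v * dx v * (sz v * dz v)) = (\<lambda>v. 2 * (axz v + 2 * e v) - qx v * qz v)"
    "(\<lambda>v. sy v * dy v * (sz v * dz v)) = (\<lambda>v. 2 * (ayz v + 2 * e v) - qy v * qz v)"
    "(\<lambda>v. sx v * sy v * sz v) = (\<lambda>v. e v + ux v + uy v + uz v)"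
    "(\<lambda>v. sx v * dy v * dz v) = (\<lambda>v. e v + ux v - uy v - uz v)"
    "(\<lambda>v. dx v * sy v * dz v) = (\<lambda>v. e v - ux v + uy v - uz v)"
    "(\<lambda>v. dx v * dy v * sz v) = (\<lambda>v. e v - ux v - uy v + uz v)"
    unfolding e_eq u_eq
    by (simp_all add: fun_eq_iff sd_defs px_def py_def pz_def qx_def qy_def qz_def axy_def axz_def
        ayz_def
        qw_def qu_def qv_def algebra_simps)
  show "(\<lambda>v. sx v * sx v) \<in> TL" "(\<lambda>v. dx v * dx v) \<in> TL" "(\<lambda>v. sy v * sy v) \<in> TL"
    "(\<lambda>v. dy v * dy v) \<in> TL" "(\<lambda>v. sz v * sz v) \<in> TL" "(\<lambda>v. dz v * dz v) \<in> TL"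
    "(\<lambda>v. sx v * dx v * (sy v * dy v)) \<in> TL" "(\<lambda>v. sx v * dx v * (sz v * dz v)) \<in> TL"
    "(\<lambda>v. sy v * dy v * (sz v * dz v)) \<in> TL"
    "(\<lambda>v. sx v * sy v * sz v) \<in> TL" "(\<lambda>v. sx v * dy v * dz v) \<in> TL"
    "(\<lambda>v. dx v * sy v * dz v) \<in> TL" "(\<lambda>v. dx v * dy v * sz v) \<in> TL"
    unfolding eqs by (fact *)+
qed

section \<open>Module spans\<close>

lemma module_span_zero: "(\<lambda>x\<in>X. 0) \<in> module_span X R M"
  unfolding module_span_def by (intro CollectI exI[of _ "{}"]) simp

lemma module_span_add_term:
  assumes f: "f \<in> module_span X (generated_alg X F) M" and a: "a \<in> generated_alg X F" and m: "m \<in> M"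
  shows "(\<lambda>x\<in>X. a x * m x + f x) \<in> module_span X (generated_alg X F) M"
proof -
  obtain N b where N: "finite N" "N \<subseteq> M" and b: "\<And>n. n \<in> N \<Longrightarrow> b n \<in> generated_alg X F"
    and f_eq: "f = (\<lambda>x\<in>X. \<Sum>n\<in>N. b n x * n x)"
    using f unfolding module_span_def by blast
  define c where "c n = (if n = m then (if m \<in> N then (\<lambda>x\<in>X. a x + b m x) else a) else b n)" for n
  have "c n \<in> generated_alg X F" if "n \<in> insert m N" for n
    using that a b generated_alg.add[OF a b, of m] unfolding c_def by (cases "n = m"; cases "m \<in> N")
        (simp_all only: if_True if_False, auto)
  moreover have "(\<lambda>x\<in>X. a x * m x + f x) = (\<lambda>x\<in>X. \<Sum>n\<in>insert m N. c n x * n x)"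
  proof (rule restrict_ext)
    fix x assume x: "x \<in> X"
    have "(\<Sum>n\<in>N - {m}. c n x * n x) = (\<Sum>n\<in>N - {m}. b n x * n x)"
      by (rule sum.cong) (auto simp: c_def)
    then have "(\<Sum>n\<in>insert m N. c n x * n x) = c m x * m x + (\<Sum>n\<in>N - {m}. b n x * n x)"
      using N(1) by (simp add: sum.insert_remove)
    also have "\<dots> = a x * m x + (\<Sum>n\<in>N. b n x * n x)"
      using N(1) x by (cases "m \<in> N") (simp_all add: c_def sum.remove algebra_simps)
    finally show "a x * m x + f x = (\<Sum>n\<in>insert m N. c n x * n x)" using x by (simp add: f_eq)
  qed
  ultimately show ?thesis
    unfolding module_span_def using N m
    by (intro CollectI exI[of _ "insert m N"] exI[of _ c]) auto
qed

text \<open>Induction on the number of summands replaces the choice of coefficient families.\<close>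

lemma module_span_induct [consumes 1, case_names zero add_term]:
  assumes f: "f \<in> module_span X R M" and zero: "P (\<lambda>x\<in>X. 0)"
    and step: "\<And>f a m. P f \<Longrightarrow> a \<in> R \<Longrightarrow> m \<in> M \<Longrightarrow> P (\<lambda>x\<in>X. a x * m x + f x)"
  shows "P f"
proof -
  obtain N b where N: "finite N" "N \<subseteq> M" and b: "\<And>n. n \<in> N \<Longrightarrow> b n \<in> R"
    and f_eq: "f = (\<lambda>x\<in>X. \<Sum>n\<in>N. b n x * n x)"
    using f unfolding module_span_def by blast
  have "P (\<lambda>x\<in>X. \<Sum>n\<in>N. b n x * n x)"
    using N b
  proof (induction N rule: finite_induct)
    case empty
    show ?case unfolding sum.empty by (rule zero)
  next
    case (insert n N)
    have "P (\<lambda>x\<in>X. b n x * n x + (\<lambda>x\<in>X. \<Sum>n\<in>N. b n x * n x) x)"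
      using insert by (intro step) auto
    also have "(\<lambda>x\<in>X. b n x * n x + (\<lambda>x\<in>X. \<Sum>n\<in>N. b n x * n x) x) = (\<lambda>x\<in>X. \<Sum>n\<in>insert n N. b n x * n
        x)"
      using insert(1,2) by (intro restrict_ext) simp
    finally show ?case .
  qed
  then show ?thesis by (simp only: f_eq)
qed

lemma module_span_extensional: "f \<in> module_span X R M \<Longrightarrow> f \<in> extensional X"
  by (induction rule: module_span_induct) (rule restrict_extensional)+

lemma module_span_add:
  assumes f: "f \<in> module_span X (generated_alg X F) M" and g: "g \<in> module_span X (generated_alg X F)
      M"
  shows "(\<lambda>x\<in>X. f x + g x) \<in> module_span X (generated_alg X F) M"
  using f
proof (induction rule: module_span_induct)
  case zero
  have "(\<lambda>x\<in>X. (\<lambda>x\<in>X. 0) x + g x) = g"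
    using module_span_extensional[OF g] by (auto simp: restrict_def extensional_def fun_eq_iff)
  then show ?case using g by (simp only:)
next
  case (add_term f a m)
  have "(\<lambda>x\<in>X. (\<lambda>x\<in>X. a x * m x + f x) x + g x) = (\<lambda>x\<in>X. a x * m x + (\<lambda>x\<in>X. f x + g x) x)"
    by (intro restrict_ext) (simp add: add.assoc)
  then show ?case using module_span_add_term[OF add_term] by (simp only:)
qed

lemma module_span_mult:
  assumes r: "r \<in> generated_alg X F" and f: "f \<in> module_span X (generated_alg X F) M"
  shows "(\<lambda>x\<in>X. r x * f x) \<in> module_span X (generated_alg X F) M"
  using f
proof (induction rule: module_span_induct)
  case zero
  have "(\<lambda>x\<in>X. r x * (\<lambda>x\<in>X. 0) x) = (\<lambda>x\<in>X. 0)" by (intro restrict_ext) simp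
  then show ?case by (simp only: module_span_zero)
next
  case (add_term f a m)
  have "(\<lambda>x\<in>X. r x * (\<lambda>x\<in>X. a x * m x + f x) x)
      = (\<lambda>x\<in>X. (\<lambda>x\<in>X. r x * a x) x * m x + (\<lambda>x\<in>X. r x * f x) x)"
    by (intro restrict_ext) (simp add: algebra_simps)
  then show ?case
    using module_span_add_term[OF add_term(1) generated_alg.mult[OF r add_term(2)] add_term(3)] by
        (simp only:)
qed

lemma module_span_gen:
  assumes "m \<in> M" "m \<in> extensional X"
  shows "m \<in> module_span X (generated_alg X F) M"
proof -
  have "(\<lambda>x\<in>X. (\<lambda>x\<in>X. 1) x * m x + (\<lambda>x\<in>X. 0) x) = m"
    using assms(2) by (auto simp: restrict_def extensional_def fun_eq_iff)
  then show ?thesis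
    using module_span_add_term[OF module_span_zero generated_alg.const[of 1 X F] assms(1)] by (simp
        only:)
qed

lemma module_span_subset:
  assumes R: "R \<subseteq> generated_alg X F" and M: "M \<subseteq> module_span X (generated_alg X F) M'"
  shows "module_span X R M \<subseteq> module_span X (generated_alg X F) M'"
proof
  fix f assume "f \<in> module_span X R M"
  then show "f \<in> module_span X (generated_alg X F) M'"
  proof (induction rule: module_span_induct)
    case (add_term f a m)
    have "(\<lambda>x\<in>X. a x * m x + f x) = (\<lambda>x\<in>X. (\<lambda>x\<in>X. a x * m x) x + f x)"
      by (intro restrict_ext) simp
    moreover have "(\<lambda>x\<in>X. a x * m x) \<in> module_span X (generated_alg X F) M'"
      using add_term(2,3) R M by (intro module_span_mult) auto
    ultimately show ?case using module_span_add[OF _ add_term(1)] by (simp only:)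
  qed (rule module_span_zero)
qed

lemma module_span_subset_char_ring:
  assumes "R \<subseteq> char_ring" "M \<subseteq> char_ring"
  shows "module_span (Hom F2 (SO 4)) R M \<subseteq> char_ring"
proof
  fix f assume "f \<in> module_span (Hom F2 (SO 4)) R M"
  then show "f \<in> char_ring"
  proof (induction rule: module_span_induct)
    case (add_term f a m)
    have "(\<lambda>x\<in>Hom F2 (SO 4). a x * m x + f x) = (\<lambda>x\<in>Hom F2 (SO 4). (\<lambda>x\<in>Hom F2 (SO 4). a x * m x) x +
        f x)"
      by (intro restrict_ext) simp
    moreover have "(\<lambda>x\<in>Hom F2 (SO 4). a x * m x) \<in> char_ring"
      using add_term(2,3) assms by (intro char_ring_mult) auto
    ultimately show ?case using char_ring_add[OF _ add_term(1)] by (simp only:)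
  qed (rule char_ring_const)
qed

abbreviation Hom_span :: "((nat letter list \<Rightarrow> complex mat) \<Rightarrow> complex) set \<Rightarrow>
    ((nat letter list \<Rightarrow> complex mat) \<Rightarrow> complex) set \<Rightarrow> ((nat letter list \<Rightarrow> complex mat) \<Rightarrow> complex)
        set" where
  "Hom_span \<equiv> module_span (Hom F2 (SO 4))"

lemma lifted_span_add:
  assumes "H \<in> lifted (Hom_span (Hom_alg F) M)" "K \<in> lifted (Hom_span (Hom_alg F) M)"
  shows "(\<lambda>v. H v + K v) \<in> lifted (Hom_span (Hom_alg F) M)"
proof -
  obtain f g where *: "f \<in> Hom_span (Hom_alg F) M" "g \<in> Hom_span (Hom_alg F) M" "lifts f H" "lifts g
      K"
    using assms unfolding lifted_def by blast
  show ?thesis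
    unfolding lifted_def lifts_def
    by (intro CollectI bexI[OF _ module_span_add[OF *(1,2)]]) (use *(3,4) in \<open>simp add: rep_Hom
        lifts_def\<close>)
qed

lemma lifted_span_mult:
  assumes "H \<in> lifted (Hom_alg F)" "K \<in> lifted (Hom_span (Hom_alg F) M)"
  shows "(\<lambda>v. H v * K v) \<in> lifted (Hom_span (Hom_alg F) M)"
proof -
  obtain f g where *: "f \<in> Hom_alg F" "g \<in> Hom_span (Hom_alg F) M" "lifts f H" "lifts g K"
    using assms unfolding lifted_def by blast
  show ?thesis
    unfolding lifted_def lifts_def
    by (intro CollectI bexI[OF _ module_span_mult[OF *(1,2)]]) (use *(3,4) in \<open>simp add: rep_Hom
        lifts_def\<close>)
qed

lemma lifted_span_cmult:
  "K \<in> lifted (Hom_span (Hom_alg F) M) \<Longrightarrow> (\<lambda>v. c * K v) \<in> lifted (Hom_span (Hom_alg F) M)"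
  by (rule lifted_span_mult[OF lifted_const])

lemma lifted_span_diff:
  assumes "H \<in> lifted (Hom_span (Hom_alg F) M)" "K \<in> lifted (Hom_span (Hom_alg F) M)"
  shows "(\<lambda>v. H v - K v) \<in> lifted (Hom_span (Hom_alg F) M)"
  using lifted_span_add[OF assms(1) lifted_span_cmult[OF assms(2), of "- 1"]] by simp

lemma lifted_span_gen:
  assumes "m \<in> M" "m \<in> extensional (Hom F2 (SO 4))" "lifts m H"
  shows "H \<in> lifted (Hom_span (Hom_alg F) M)"
  unfolding lifted_def using module_span_gen[OF assms(1,2)] assms(3) by blast

lemma lifted_span_alg:
  assumes "one_fun \<in> M" "H \<in> lifted (Hom_alg F)"
  shows "H \<in> lifted (Hom_span (Hom_alg F) M)"
proof -
  have "(\<lambda>v. 1) \<in> lifted (Hom_span (Hom_alg F) M)"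
    by (rule lifted_span_gen[OF assms(1)]) (auto simp: one_fun_def lifts_def rep_Hom)
  from lifted_span_mult[OF assms(2) this] show ?thesis by simp
qed

section \<open>Generators over the trace algebra\<close>

text \<open>The last assumption computes the trace of the product \<open>g h\<close> without reducing the word.\<close>

lemma lifts_Q4:
  assumes "g \<in> carrier F2" "h \<in> carrier F2" "word_trace g q" "word_trace h r"
    and "\<And>a. a \<in> SL2_pairs \<Longrightarrow> tr (word_mat a g * word_mat a h) = s (trs a)"
  shows "lifts (Q4_fun g h) (\<lambda>v. 4 * (q (fst v) * r (fst v) * s (snd v) - q (snd v) * r (snd v) * s
      (fst v)))"
  using assms by (simp add: lifts_def Q4_rep word_mat_mult word_trace_def)

lemma lifts_Q4_self:
  assumes "g \<in> carrier F2" "word_trace g q"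
  shows "lifts (Q4_fun g g) (\<lambda>v. 8 * (q (snd v) * q (snd v) - q (fst v) * q (fst v)))"
proof -
  have "lifts (Q4_fun g g) (\<lambda>v. 4 * (q (fst v) * q (fst v) * (q (snd v) * q (snd v) - 2)
      - q (snd v) * q (snd v) * (q (fst v) * q (fst v) - 2)))"
    using assms by (intro lifts_Q4) (simp_all add: tr_square dt_word_mat word_trace_def)
  then show ?thesis by (simp add: algebra_simps)
qed

text \<open>The eight module generators, with the group elements written as reduced words.\<close>

definition Q_gens :: "((nat letter list \<Rightarrow> complex mat) \<Rightarrow> complex) set" where
  "Q_gens = {one_fun, Q4_fun [la] [la], Q4_fun [la] [lb], Q4_fun [lb] [lb], Q4_fun [la, lb] [la,
      lb],
     Q4_fun [la, lb'] [la, lb'], Q4_fun [la, lb'] [lb], Q4_fun [lb, la'] [la]}"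

lemma Q4_extensional: "Q4_fun g h \<in> extensional (Hom F2 (SO 4))"
  unfolding Q4_fun_def by (rule restrict_extensional)

lemma lifts_Q_mixed:
  "lifts (Q4_fun [la] [lb]) (\<lambda>v. 4 * (X1 v * Y1 v * Z2 v - X2 v * Y2 v * Z1 v))"
  "lifts (Q4_fun [la, lb'] [lb]) (\<lambda>v. 4 * ((X1 v * Y1 v - Z1 v) * Y1 v * X2 v - (X2 v * Y2 v - Z2 v)
      * Y2 v * X1 v))"
  "lifts (Q4_fun [lb, la'] [la]) (\<lambda>v. 4 * ((X1 v * Y1 v - Z1 v) * X1 v * Y2 v - (X2 v * Y2 v - Z2 v)
      * X2 v * Y1 v))"
proof -
  show "lifts (Q4_fun [la] [lb]) (\<lambda>v. 4 * (X1 v * Y1 v * Z2 v - X2 v * Y2 v * Z1 v))"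
    by (rule lifts_Q4[OF word_carriers(1,2) traces_of_words(1,2)])
      (auto simp: letter_mat_def trs_def SL2_pairs_def)
  show "lifts (Q4_fun [la, lb'] [lb]) (\<lambda>v. 4 * ((X1 v * Y1 v - Z1 v) * Y1 v * X2 v - (X2 v * Y2 v -
      Z2 v) * Y2 v * X1 v))"
    by (rule lifts_Q4[OF word_carriers(4,2) traces_of_words(4,2)])
      (auto simp: letter_mat_def trs_def SL2_pairs_def mult.assoc adj_mult_self)
  have "word_trace [lb, la'] (\<lambda>t. tx t * ty t - tz t)"
    unfolding word_trace_def
  proof
    fix a assume "a \<in> SL2_pairs"
    obtain A B where a: "a = (A, B)" by (metis surj_pair)
    have "tr (B * adj A) = tr A * tr B - tr (A * B)" by (simp add: m2_simps algebra_simps)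
    then show "tr (word_mat a [lb, la']) = tx (trs a) * ty (trs a) - tz (trs a)"
      by (simp add: a letter_mat_def trs_def)
  qed
  then show "lifts (Q4_fun [lb, la'] [la]) (\<lambda>v. 4 * ((X1 v * Y1 v - Z1 v) * X1 v * Y2 v - (X2 v * Y2
      v - Z2 v) * X2 v * Y1 v))"
    by (rule lifts_Q4[OF word_carriers(14,1) _ traces_of_words(1)])
      (auto simp: letter_mat_def trs_def SL2_pairs_def mult.assoc adj_mult_self)
qed

text \<open>Together with the symmetric functions these account for all even monomials. The functions
  \<open>Q\<^sub>4(g, g)\<close> give the differences of squares \<open>x\<^sup>2 - x'\<^sup>2\<close> and \<open>x y z - x' y' z'\<close>, and the mixed ones
  give differences such as \<open>x' y' z - x y z'\<close>, up to multiples of the former with symmetric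
  coefficients.\<close>

lemma antisymmetric_in_span:
  defines "S \<equiv> lifted (Hom_span (Hom_alg word_traces) Q_gens)"
  shows "(\<lambda>v. sx v * dx v) \<in> S" "(\<lambda>v. sy v * dy v) \<in> S" "(\<lambda>v. sz v * dz v) \<in> S"
    "(\<lambda>v. sx v * sy v * dz v) \<in> S" "(\<lambda>v. sx v * dy v * sz v) \<in> S" "(\<lambda>v. dx v * sy v * sz v) \<in> S"
    "(\<lambda>v. dx v * dy v * dz v) \<in> S"
proof -
  let ?T = "lifted (Hom_alg word_traces)"
  note add = lifted_span_add[of _ word_traces Q_gens, folded S_def]
  note diff = lifted_span_diff[of _ word_traces Q_gens, folded S_def]
  note cmult = lifted_span_cmult[of _ word_traces Q_gens, folded S_def]
  note mult = lifted_span_mult[of _ word_traces _ Q_gens, folded S_def]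
  note gen = lifted_span_gen[OF _ Q4_extensional, of _ _ Q_gens _ word_traces, folded S_def]
  define kx ky kz kw where "kx = (\<lambda>v. 8 * (X2 v * X2 v - X1 v * X1 v))" and "ky = (\<lambda>v. 8 * (Y2 v *
      Y2 v - Y1 v * Y1 v))"
    and "kz = (\<lambda>v. 8 * (Z2 v * Z2 v - Z1 v * Z1 v))"
    and "kw = (\<lambda>v. 8 * ((X2 v * Y2 v - Z2 v) * (X2 v * Y2 v - Z2 v) - (X1 v * Y1 v - Z1 v) * (X1 v *
        Y1 v - Z1 v)))"
  define ka kb kc where "ka = (\<lambda>v. 4 * ((X1 v * Y1 v - Z1 v) * Y1 v * X2 v - (X2 v * Y2 v - Z2 v) *
      Y2 v * X1 v))"
    and "kb = (\<lambda>v. 4 * ((X1 v * Y1 v - Z1 v) * X1 v * Y2 v - (X2 v * Y2 v - Z2 v) * X2 v * Y1 v))"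
    and "kc = (\<lambda>v. 4 * (X1 v * Y1 v * Z2 v - X2 v * Y2 v * Z1 v))"
  have "kx \<in> S" unfolding kx_def by (rule gen[OF _ lifts_Q4_self[OF word_carriers(1)
      traces_of_words(1)]]) (simp add: Q_gens_def)
  have "ky \<in> S" unfolding ky_def by (rule gen[OF _ lifts_Q4_self[OF word_carriers(2)
      traces_of_words(2)]]) (simp add: Q_gens_def)
  have "kz \<in> S" unfolding kz_def by (rule gen[OF _ lifts_Q4_self[OF word_carriers(3)
      traces_of_words(3)]]) (simp add: Q_gens_def)
  have "kw \<in> S" unfolding kw_def by (rule gen[OF _ lifts_Q4_self[OF word_carriers(4)
      traces_of_words(4)]]) (simp add: Q_gens_def)
  have "kc \<in> S" unfolding kc_def by (rule gen[OF _ lifts_Q_mixed(1)]) (simp add: Q_gens_def)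
  have "ka \<in> S" unfolding ka_def by (rule gen[OF _ lifts_Q_mixed(2)]) (simp add: Q_gens_def)
  have "kb \<in> S" unfolding kb_def by (rule gen[OF _ lifts_Q_mixed(3)]) (simp add: Q_gens_def)
  note k = \<open>kx \<in> S\<close> \<open>ky \<in> S\<close> \<open>kz \<in> S\<close> \<open>kw \<in> S\<close> \<open>ka \<in> S\<close> \<open>kb \<in> S\<close> \<open>kc \<in> S\<close>
  define px py qx qy where "px = (\<lambda>v. (sx v * sx v - dx v * dx v) / 4)" and "py = (\<lambda>v. (sy v * sy v
      - dy v * dy v) / 4)"
    and "qx = (\<lambda>v. (sx v * sx v + dx v * dx v) / 2)" and "qy = (\<lambda>v. (sy v * sy v + dy v * dy v) /
        2)"
  have pq: "px \<in> ?T" "py \<in> ?T" "qx \<in> ?T" "qy \<in> ?T"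
    unfolding px_def py_def qx_def qy_def
    by (rule lifted_cdivide, rule lifted_diff lifted_add; rule trace_alg_symmetric)+
  define fx fy fz fo where "fx = (\<lambda>v. 1 / 4 * ka v + 1 / 8 * (px v * ky v))" and "fy = (\<lambda>v. 1 / 4 *
      kb v + 1 / 8 * (py v * kx v))"
    and "fz = (\<lambda>v. - 1 / 4 * kc v)"
    and "fo = (\<lambda>v. 1 / 16 * kw v - 1 / 16 * kz v - 1 / 32 * (qy v * kx v) - 1 / 32 * (qx v * ky v))"
  have f: "fx \<in> S" "fy \<in> S" "fz \<in> S" "fo \<in> S"
    unfolding fx_def fy_def fz_def fo_def
    by (intro add diff cmult mult[OF pq(1) k(2)] mult[OF pq(2) k(1)] mult[OF pq(3) k(2)] mult[OF
        pq(4) k(1)] k)+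
  have f_eq: "fx v = X1 v * Y2 v * Z2 v - X2 v * Y1 v * Z1 v" "fy v = X2 v * Y1 v * Z2 v - X1 v * Y2
      v * Z1 v"
    "fz v = X2 v * Y2 v * Z1 v - X1 v * Y1 v * Z2 v" "fo v = X1 v * Y1 v * Z1 v - X2 v * Y2 v * Z2
        v" for v
    by (simp_all add: fx_def fy_def fz_def fo_def px_def py_def qx_def qy_def kx_def ky_def kz_def
        kw_def
        ka_def kb_def kc_def sd_defs field_simps)
  have "(\<lambda>v. - 1 / 8 * kx v) \<in> S" "(\<lambda>v. - 1 / 8 * ky v) \<in> S" "(\<lambda>v. - 1 / 8 * kz v) \<in> S"
    "(\<lambda>v. fo v + fz v - fy v - fx v) \<in> S" "(\<lambda>v. fo v + fy v - fx v - fz v) \<in> S"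
    "(\<lambda>v. fo v + fx v - fy v - fz v) \<in> S" "(\<lambda>v. fo v + fx v + fy v + fz v) \<in> S"
    by (intro add diff cmult k f)+
  note * = this
  have eqs: "(\<lambda>v. sx v * dx v) = (\<lambda>v. - 1 / 8 * kx v)" "(\<lambda>v. sy v * dy v) = (\<lambda>v. - 1 / 8 * ky v)"
    "(\<lambda>v. sz v * dz v) = (\<lambda>v. - 1 / 8 * kz v)"
    "(\<lambda>v. sx v * sy v * dz v) = (\<lambda>v. fo v + fz v - fy v - fx v)"
    "(\<lambda>v. sx v * dy v * sz v) = (\<lambda>v. fo v + fy v - fx v - fz v)"
    "(\<lambda>v. dx v * sy v * sz v) = (\<lambda>v. fo v + fx v - fy v - fz v)"
    "(\<lambda>v. dx v * dy v * dz v) = (\<lambda>v. fo v + fx v + fy v + fz v)"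
    unfolding f_eq by (simp_all add: kx_def ky_def kz_def sd_defs algebra_simps fun_eq_iff)
  show "(\<lambda>v. sx v * dx v) \<in> S" "(\<lambda>v. sy v * dy v) \<in> S" "(\<lambda>v. sz v * dz v) \<in> S"
    "(\<lambda>v. sx v * sy v * dz v) \<in> S" "(\<lambda>v. sx v * dy v * sz v) \<in> S" "(\<lambda>v. dx v * sy v * sz v) \<in> S"
    "(\<lambda>v. dx v * dy v * dz v) \<in> S"
    unfolding eqs by (fact *)+
qed

definition sd_monomial :: "nat \<Rightarrow> nat \<Rightarrow> nat \<Rightarrow> nat \<Rightarrow> nat \<Rightarrow> nat \<Rightarrow> triple \<times> triple \<Rightarrow> complex" where
  "sd_monomial i i' j j' k k' v = sx v ^ i * dx v ^ i' * (sy v ^ j * dy v ^ j') * (sz v ^ k * dz v ^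
      k')"

text \<open>Squares of the six coordinates are trace functions, so only exponents zero and one matter.
  The evenness conditions leave sixteen products, half of them symmetric.\<close>

lemma even_sd_monomial:
  assumes "even (i + i' + k + k')" "even (j + j' + k + k')"
  shows "sd_monomial i i' j j' k k' \<in> lifted (Hom_span (Hom_alg word_traces) Q_gens)" (is "_ \<in> ?S")
proof -
  let ?T = "lifted (Hom_alg word_traces)"
  have one: "one_fun \<in> Q_gens" by (simp add: Q_gens_def)
  note sym = trace_alg_symmetric
  note sym' = lifted_span_alg[OF one sym(7)] lifted_span_alg[OF one sym(8)] lifted_span_alg[OF one
      sym(9)]
    lifted_span_alg[OF one sym(10)] lifted_span_alg[OF one sym(11)] lifted_span_alg[OF one sym(12)]
    lifted_span_alg[OF one sym(13)]
  note anti = antisymmetric_in_span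
  have one': "(\<lambda>v. 1) \<in> ?S" by (rule lifted_span_alg[OF one lifted_const])
  have xyz: "(\<lambda>v. sx v * dx v * (sy v * dy v) * (sz v * dz v)) \<in> ?S"
    by (rule lifted_span_mult[OF sym(7) anti(3)])
  note facts = xyz sym' anti
  have basic: "(\<lambda>v. sx v ^ e * dx v ^ e' * (sy v ^ f * dy v ^ f') * (sz v ^ g * dz v ^ g')) \<in> ?S"
    if "e < 2" "e' < 2" "f < 2" "f' < 2" "g < 2" "g' < 2" "even (e + e' + g + g')" "even (f + f' + g
        + g')"
    for e e' f f' g g' :: nat
  proof -
    have cs: "e' = e \<and> f' = f \<and> g' = g \<or> e' = 1 - e \<and> f' = 1 - f \<and> g' = 1 - g"
      using that unfolding less_2_cases_iff One_nat_def[symmetric] by (elim disjE) simp_all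
    have "e = 0 \<or> e = 1" "f = 0 \<or> f = 1" "g = 0 \<or> g = 1" using that by auto
    with cs show ?thesis
      by (elim disjE conjE) (simp_all add: one' facts[unfolded mult.assoc] mult.assoc)
  qed
  define r where "r = (\<lambda>v. (sx v * sx v) ^ (i div 2) * (dx v * dx v) ^ (i' div 2)
    * ((sy v * sy v) ^ (j div 2) * (dy v * dy v) ^ (j' div 2)) * ((sz v * sz v) ^ (k div 2) * (dz v
        * dz v) ^ (k' div 2)))"
  have r: "r \<in> ?T"
    unfolding r_def
    by (rule lifted_mult[OF lifted_mult[OF lifted_mult[OF lifted_power[OF sym(1)] lifted_power[OF
        sym(2)]]
      lifted_mult[OF lifted_power[OF sym(3)] lifted_power[OF sym(4)]]]
      lifted_mult[OF lifted_power[OF sym(5)] lifted_power[OF sym(6)]]])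
  have "(\<lambda>v. r v * (sx v ^ (i mod 2) * dx v ^ (i' mod 2) * (sy v ^ (j mod 2) * dy v ^ (j' mod 2))
    * (sz v ^ (k mod 2) * dz v ^ (k' mod 2)))) \<in> ?S"
  proof (rule lifted_span_mult[OF r basic])
    show "even (i mod 2 + i' mod 2 + k mod 2 + k' mod 2)" "even (j mod 2 + j' mod 2 + k mod 2 + k'
        mod 2)"
      using assms by presburger+
  qed simp_all
  moreover have pw: "x ^ n = (x * x) ^ (n div 2) * x ^ (n mod 2)" for x :: complex and n
    by (metis mult_div_mod_eq power_add power_mult power2_eq_square)
  have "sd_monomial i i' j j' k k' v = r v * (sx v ^ (i mod 2) * dx v ^ (i' mod 2) * (sy v ^ (j mod
      2) * dy v ^ (j' mod 2))
    * (sz v ^ (k mod 2) * dz v ^ (k' mod 2)))" for v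
    unfolding sd_monomial_def r_def pw[of "sx v" i] pw[of "dx v" i'] pw[of "sy v" j] pw[of "dy v"
        j']
      pw[of "sz v" k] pw[of "dz v" k'] by (simp only: mult_ac)
  then have "sd_monomial i i' j j' k k' = (\<lambda>v. r v * (sx v ^ (i mod 2) * dx v ^ (i' mod 2)
    * (sy v ^ (j mod 2) * dy v ^ (j' mod 2)) * (sz v ^ (k mod 2) * dz v ^ (k' mod 2))))" by (rule
        ext)
  ultimately show ?thesis by (simp only:)
qed

lemma flip_simps [simp]: "flip True x = - x" "flip False x = x"
  by (simp_all add: flip_def)

lemma polys_sd:
  assumes "H \<in> polys coords6"
  shows "H \<in> polys {sx, dx, sy, dy, sz, dz}"
proof (rule polys_subset[OF assms], rule subsetI)
  let ?F = "{sx, dx, sy, dy, sz, dz}"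
  have gens: "sx \<in> polys ?F" "dx \<in> polys ?F" "sy \<in> polys ?F" "dy \<in> polys ?F" "sz \<in> polys ?F" "dz \<in>
      polys ?F"
    by (rule polys_gen, simp)+
  have "(\<lambda>v. (sx v + dx v) / 2) \<in> polys ?F" "(\<lambda>v. (sy v + dy v) / 2) \<in> polys ?F" "(\<lambda>v. (sz v + dz v)
      / 2) \<in> polys ?F"
    "(\<lambda>v. (sx v - dx v) / 2) \<in> polys ?F" "(\<lambda>v. (sy v - dy v) / 2) \<in> polys ?F" "(\<lambda>v. (sz v - dz v) /
        2) \<in> polys ?F"
    by (intro polys_divide_const polys_add polys_diff gens)+
  moreover have "(\<lambda>v. (sx v + dx v) / 2) = (\<lambda>v. X1 v)" "(\<lambda>v. (sy v + dy v) / 2) = (\<lambda>v. Y1 v)"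
    "(\<lambda>v. (sz v + dz v) / 2) = (\<lambda>v. Z1 v)" "(\<lambda>v. (sx v - dx v) / 2) = (\<lambda>v. X2 v)"
    "(\<lambda>v. (sy v - dy v) / 2) = (\<lambda>v. Y2 v)" "(\<lambda>v. (sz v - dz v) / 2) = (\<lambda>v. Z2 v)"
    by (simp_all add: sd_defs)
  ultimately have coords: "(\<lambda>v. X1 v) \<in> polys ?F" "(\<lambda>v. Y1 v) \<in> polys ?F" "(\<lambda>v. Z1 v) \<in> polys ?F"
    "(\<lambda>v. X2 v) \<in> polys ?F" "(\<lambda>v. Y2 v) \<in> polys ?F" "(\<lambda>v. Z2 v) \<in> polys ?F" by (simp_all only:)
  fix f assume "f \<in> coords6"
  then show "f \<in> polys ?F" unfolding coords6_def by (elim insertE emptyE) (simp_all only: coords)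
qed

lemma sd_sign:
  "sx (map_prod (sign_trs s t) (sign_trs s t) v) = flip s (sx v)"
  "dx (map_prod (sign_trs s t) (sign_trs s t) v) = flip s (dx v)"
  "sy (map_prod (sign_trs s t) (sign_trs s t) v) = flip t (sy v)"
  "dy (map_prod (sign_trs s t) (sign_trs s t) v) = flip t (dy v)"
  "sz (map_prod (sign_trs s t) (sign_trs s t) v) = flip s (flip t (sz v))"
  "dz (map_prod (sign_trs s t) (sign_trs s t) v) = flip s (flip t (dz v))"
  by (cases v; cases s; cases t; auto simp: sd_defs sign_trs_def)+

lemma sd_monomial_sign:
  "sd_monomial i i' j j' k k' (map_prod (sign_trs True False) (sign_trs True False) v)
    = (- 1) ^ (i + i' + k + k') * sd_monomial i i' j j' k k' v"
  "sd_monomial i i' j j' k k' (map_prod (sign_trs False True) (sign_trs False True) v)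
    = (- 1) ^ (j + j' + k + k') * sd_monomial i i' j j' k k' v"
proof -
  have m: "(- x) ^ n = (- 1) ^ n * x ^ n" for x :: complex and n by (rule power_minus)
  show "sd_monomial i i' j j' k k' (map_prod (sign_trs True False) (sign_trs True False) v)
    = (- 1) ^ (i + i' + k + k') * sd_monomial i i' j j' k k' v"
    unfolding sd_monomial_def sd_sign flip_simps m[of "sx v"] m[of "dx v"] m[of "sz v"] m[of "dz v"]
        power_add
    by (simp only: mult_ac)
  show "sd_monomial i i' j j' k k' (map_prod (sign_trs False True) (sign_trs False True) v)
    = (- 1) ^ (j + j' + k + k') * sd_monomial i i' j j' k k' v"
    unfolding sd_monomial_def sd_sign flip_simps m[of "sy v"] m[of "dy v"] m[of "sz v"] m[of "dz v"]
        power_add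
    by (simp only: mult_ac)
qed

lemma char_ring_in_trace_span:
  assumes f: "f \<in> char_ring"
  shows "f \<in> Hom_span (Hom_alg word_traces) Q_gens"
proof -
  let ?S = "lifted (Hom_span (Hom_alg word_traces) Q_gens)"
  obtain H where H: "H \<in> polys coords6" "lifts f H" using coord_ring_X_lift[OF f] .
  define M where "M = {sd_monomial i i' j j' k k' | i i' j j' k k'. True}"
  have mem: "sd_monomial i i' j j' k k' \<in> M" for i i' j j' k k' unfolding M_def by blast
  have "H \<in> lin_span M"
  proof (rule polys_lin_span[OF polys_sd[OF H(1)]])
    have "(\<lambda>x. 1) = sd_monomial 0 0 0 0 0 0" by (simp add: sd_monomial_def fun_eq_iff)
    then show "(\<lambda>x. 1) \<in> M" by (simp only: mem)
    fix f m assume f: "f \<in> {sx, dx, sy, dy, sz, dz}" and "m \<in> M"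
    then obtain i i' j j' k k' where m: "m = sd_monomial i i' j j' k k'" unfolding M_def by blast
    have "(\<lambda>x. sx x * m x) = sd_monomial (Suc i) i' j j' k k'" "(\<lambda>x. dx x * m x) = sd_monomial i
        (Suc i') j j' k k'"
      "(\<lambda>x. sy x * m x) = sd_monomial i i' (Suc j) j' k k'" "(\<lambda>x. dy x * m x) = sd_monomial i i' j
          (Suc j') k k'"
      "(\<lambda>x. sz x * m x) = sd_monomial i i' j j' (Suc k) k'" "(\<lambda>x. dz x * m x) = sd_monomial i i' j
          j' k (Suc k')"
      by (simp_all add: m sd_monomial_def fun_eq_iff mult_ac)
    then show "(\<lambda>x. f x * m x) \<in> M" using f by (elim insertE emptyE) (simp_all only: mem)
  qed
  define \<sigma> \<tau> where "\<sigma> = map_prod (sign_trs True False) (sign_trs True False)"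
    and "\<tau> = map_prod (sign_trs False True) (sign_trs False True)"
  have sign: "(\<forall>x. m (\<sigma> x) = m x) \<or> (\<forall>x. m (\<sigma> x) = - m x)" "(\<forall>x. m (\<tau> x) = m x) \<or> (\<forall>x. m (\<tau> x) = - m
      x)"
    if "m \<in> M" for m
  proof -
    from that obtain i i' j j' k k' where m: "m = sd_monomial i i' j j' k k'" unfolding M_def by
        blast
    show "(\<forall>x. m (\<sigma> x) = m x) \<or> (\<forall>x. m (\<sigma> x) = - m x)"
      unfolding m \<sigma>_def sd_monomial_sign by (cases "even (i + i' + k + k')") simp_all
    show "(\<forall>x. m (\<tau> x) = m x) \<or> (\<forall>x. m (\<tau> x) = - m x)"
      unfolding m \<tau>_def sd_monomial_sign by (cases "even (j + j' + k + k')") simp_all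
  qed
  let ?M1 = "{m \<in> M. \<forall>x. m (\<sigma> x) = m x}"
  have "H \<in> lin_span ?M1"
    using sign(1) by (intro lin_span_invariant[OF \<open>H \<in> lin_span M\<close>]) (simp_all only: \<sigma>_def
        lifts_sign_invariant[OF H(2)])
  then have "H \<in> lin_span {m \<in> ?M1. \<forall>x. m (\<tau> x) = m x}"
    using sign(2) by (intro lin_span_invariant[where \<tau> = \<tau>]) (simp_all add: \<tau>_def
        lifts_sign_invariant[OF H(2)])
  then have "H \<in> ?S"
  proof (rule lin_span_subset)
    have one: "one_fun \<in> Q_gens" by (simp add: Q_gens_def)
    show zero: "(\<lambda>x. 0) \<in> ?S" by (rule lifted_span_alg[OF one lifted_const])
    fix f m c assume f: "f \<in> ?S" and m: "m \<in> {m \<in> ?M1. \<forall>x. m (\<tau> x) = m x}"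
    then obtain i i' j j' k k' where m_eq: "m = sd_monomial i i' j j' k k'" unfolding M_def by blast
    have inv: "m (\<sigma> x) = m x" "m (\<tau> x) = m x" for x using m by blast+
    have "m \<in> ?S"
    proof (cases "even (i + i' + k + k') \<and> even (j + j' + k + k')")
      case True
      then show ?thesis unfolding m_eq by (intro even_sd_monomial) auto
    next
      case False
      have "m x = - m x" for x
      proof -
        have "(- 1 :: complex) ^ (i + i' + k + k') = - 1 \<or> (- 1 :: complex) ^ (j + j' + k + k') = -
            1"
          using False unfolding minus_one_power_iff by presburger
        then show ?thesis
          using inv[of x] unfolding m_eq \<sigma>_def \<tau>_def sd_monomial_sign by (elim disjE) simp_all
      qed
      then have "m = (\<lambda>x. 0)" by (simp add: fun_eq_iff eq_neg_iff_add_eq_0)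
      then show ?thesis using zero by (simp only:)
    qed
    then show "(\<lambda>x. c * m x + f x) \<in> ?S" by (intro lifted_span_add lifted_span_cmult f)
  qed
  then obtain g where g: "g \<in> Hom_span (Hom_alg word_traces) Q_gens" "lifts g H"
    unfolding lifted_def by blast
  have "f = g"
    by (rule lifts_unique_left[OF H(2) g(2) char_ring_extensional[OF f] module_span_extensional[OF
        g(1)]])
  then show ?thesis using g(1) by simp
qed

section \<open>The full trace algebra\<close>

lemma carrier_GL: "A \<in> carrier (GL n) \<longleftrightarrow> A \<in> carrier_mat n n \<and> (\<exists>B\<in>carrier_mat n n. B * A = 1\<^sub>m n \<and> A
    * B = 1\<^sub>m n)"
  by (auto simp: GL_def units_of_carrier Units_def ring_mat_simps)

lemma GL_simps [simp]: "A \<otimes>\<^bsub>GL n\<^esub> B = A * B" "\<one>\<^bsub>GL n\<^esub> = 1\<^sub>m n"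
  by (simp_all add: GL_def units_of_mult units_of_one ring_mat_simps)

lemma group_GL: "group (GL n)"
  unfolding GL_def by (intro monoid.units_group ring.is_monoid ring_mat)

lemma mat_trace_commute:
  assumes "A \<in> carrier_mat n n" "B \<in> carrier_mat n n"
  shows "mat_trace (A * B) = mat_trace (B * A)"
proof -
  have "mat_trace (A * B) = (\<Sum>i<n. \<Sum>k<n. A $$ (i, k) * B $$ (k, i))"
    using assms by (simp add: mat_trace_def scalar_prod_def lessThan_atLeast0)
  also have "\<dots> = (\<Sum>k<n. \<Sum>i<n. A $$ (i, k) * B $$ (k, i))" by (rule sum.swap)
  also have "\<dots> = mat_trace (B * A)"
    using assms by (simp add: mat_trace_def scalar_prod_def lessThan_atLeast0 mult.commute)
  finally show ?thesis .
qed

text \<open>Regularity and invariance under conjugation bring the character into the range of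
  \<open>class_function_lift\<close>.\<close>

lemma character_class_function:
  assumes "algebraic_rep 4 (SO 4) n \<phi>"
  defines "p \<equiv> (\<lambda>A\<in>carrier (SO 4). mat_trace (\<phi> A))"
  shows "p \<in> generated_alg (carrier (SO 4)) (GL_coords 4)"
    and "A \<in> carrier (SO 4) \<Longrightarrow> B \<in> carrier (SO 4) \<Longrightarrow> p (A \<otimes>\<^bsub>SO 4\<^esub> B \<otimes>\<^bsub>SO 4\<^esub> inv\<^bsub>SO 4\<^esub> A) = p B"
proof -
  have hom: "\<phi> \<in> hom (SO 4) (GL n)"
    and entries: "\<And>i j. i < n \<Longrightarrow> j < n \<Longrightarrow> (\<lambda>A\<in>carrier (SO 4). \<phi> A $$ (i, j)) \<in> generated_alg (carrier
        (SO 4)) (GL_coords 4)"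
    using assms(1) unfolding algebraic_rep_def by blast+
  have c: "\<phi> A \<in> carrier_mat n n" if "A \<in> carrier (SO 4)" for A
    using hom_in_carrier[OF hom that] by (simp add: carrier_GL)
  have "p = (\<lambda>A\<in>carrier (SO 4). \<Sum>i<n. \<phi> A $$ (i, i))"
    unfolding p_def using c by (intro restrict_ext) (auto simp: mat_trace_def)
  then show "p \<in> generated_alg (carrier (SO 4)) (GL_coords 4)"
    using entries by (simp only:) (rule generated_alg_sum; simp only: finite_lessThan lessThan_iff)
  assume A: "A \<in> carrier (SO 4)" and B: "B \<in> carrier (SO 4)"
  interpret G: group "SO 4" by (rule group_SO)
  define C where "C = inv\<^bsub>SO 4\<^esub> A"
  have C: "C \<in> carrier (SO 4)" "C \<otimes>\<^bsub>SO 4\<^esub> A = \<one>\<^bsub>SO 4\<^esub>" using A by (simp_all only: C_def G.inv_closed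
      G.l_inv)
  have CA: "\<phi> C * \<phi> A = 1\<^sub>m n"
    using hom_mult[OF hom C(1) A] hom_one[OF hom group_SO group_GL] C(2) by simp
  have "\<phi> (A \<otimes>\<^bsub>SO 4\<^esub> B \<otimes>\<^bsub>SO 4\<^esub> C) = \<phi> A * \<phi> B * \<phi> C"
    using hom_mult[OF hom G.m_closed[OF A B] C(1)] hom_mult[OF hom A B] by simp
  also have "mat_trace \<dots> = mat_trace (\<phi> C * (\<phi> A * \<phi> B))"
    using c[OF A] c[OF B] c[OF C(1)] by (intro mat_trace_commute[of _ n]) auto
  also have "\<phi> C * (\<phi> A * \<phi> B) = \<phi> C * \<phi> A * \<phi> B"
    using c[OF A] c[OF B] c[OF C(1)] by (simp add: assoc_mult_mat[of _ n n _ n _ n])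
  also have "\<dots> = \<phi> B" using c[OF B] CA by simp
  finally show "p (A \<otimes>\<^bsub>SO 4\<^esub> B \<otimes>\<^bsub>SO 4\<^esub> inv\<^bsub>SO 4\<^esub> A) = p B"
    using B G.m_closed[OF G.m_closed[OF A B] C(1)] unfolding p_def C_def[symmetric] by (simp only:
        restrict_apply')
qed

abbreviation rep_traces :: "((nat letter list \<Rightarrow> complex mat) \<Rightarrow> complex) set" where
  "rep_traces \<equiv> {(\<lambda>\<rho>. mat_trace (\<phi> (\<rho> w))) | \<phi> n w. algebraic_rep 4 (SO 4) n \<phi> \<and> w \<in> carrier F2}"

lemma rep_traces_char_ring: "Hom_alg rep_traces \<subseteq> char_ring"
proof (rule generated_alg_subset_char_ring)
  fix f assume "f \<in> rep_traces"
  then obtain \<phi> n w where f: "f = (\<lambda>\<rho>. mat_trace (\<phi> (\<rho> w)))" and \<phi>: "algebraic_rep 4 (SO 4) n \<phi>"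
    and w: "w \<in> carrier F2" by blast
  have "(\<lambda>\<rho>\<in>Hom F2 (SO 4). (\<lambda>A\<in>carrier (SO 4). mat_trace (\<phi> A)) (\<rho> w)) \<in> char_ring"
    by (rule class_function_char_ring[OF character_class_function(1)[OF \<phi>] w
        character_class_function(2)[OF \<phi>]])
  also have "(\<lambda>\<rho>\<in>Hom F2 (SO 4). (\<lambda>A\<in>carrier (SO 4). mat_trace (\<phi> A)) (\<rho> w)) = restrict f (Hom F2 (SO
      4))"
    unfolding f by (intro restrict_ext) (simp add: Hom_SO w)
  finally show "restrict f (Hom F2 (SO 4)) \<in> char_ring" .
qed

lemma SO_GL: "A \<in> carrier (SO 4) \<Longrightarrow> A \<in> carrier (GL 4)"
proof -
  assume "A \<in> carrier (SO 4)"
  then have A: "A \<in> carrier_mat 4 4" "A * transpose_mat A = 1\<^sub>m 4" by (simp_all add: SO_def)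
  moreover have "transpose_mat A * A = 1\<^sub>m 4" using mat_mult_left_right_inverse[OF A(1) _ A(2)] A(1)
      by simp
  ultimately show ?thesis by (auto simp: carrier_GL intro!: bexI[of _ "transpose_mat A"])
qed

lemma poly_mat_id: "poly_mat (carrier (SO 4)) (GL_coords 4) (\<lambda>A. A)"
  unfolding poly_mat_def
proof (intro conjI ballI allI impI)
  show "A \<in> carrier_mat 4 4" if "A \<in> carrier (SO 4)" for A using that by (simp add: SO_def)
  fix i j :: nat assume "i < 4" "j < 4"
  then have "(\<lambda>A. A $$ (i, j)) \<in> GL_coords 4" unfolding GL_coords_def by blast
  then show "(\<lambda>A\<in>carrier (SO 4). A $$ (i, j)) \<in> generated_alg (carrier (SO 4)) (GL_coords 4)"
    by (rule generated_alg.gen)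
qed

lemma identity_rep: "algebraic_rep 4 (SO 4) 4 (\<lambda>A. A)"
  unfolding algebraic_rep_def
  by (intro conjI allI impI homI poly_mat_entry[OF poly_mat_id]) (simp_all add: SO_GL)

lemma word_traces_rep_traces: "Hom_alg word_traces \<subseteq> Hom_alg rep_traces"
proof
  fix f assume "f \<in> Hom_alg word_traces"
  then show "f \<in> Hom_alg rep_traces"
  proof (induction rule: generated_alg.induct)
    case (gen f)
    then obtain w where "w \<in> carrier F2" "f = (\<lambda>\<rho>. mat_trace (\<rho> w))" by blast
    then have "f \<in> rep_traces"
      by (intro CollectI exI[of _ "\<lambda>A. A"] exI[of _ 4] exI[of _ w]) (simp add: identity_rep)
    then show ?case by (rule generated_alg.gen)
  qed (rule generated_alg.intros; assumption)+
qed

text \<open>The conjugation action of the first factor of the double cover on \<open>M(2, \<complex>)\<close>: the sum of a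
  trivial representation and of one of the two halves of the exterior square. The formula has to
  be polynomial in the entries of \<open>R\<close> without reference to a lift. With \<open>J\<^sub>i\<close> the left
  multiplication by the \<open>i\<close>-th unit, conjugation by \<open>R\<close> preserves the span of the \<open>J\<^sub>i\<close>, and its
  matrix entries there are traces.\<close>

definition adjoint_rep :: "complex mat \<Rightarrow> complex mat" where
  "adjoint_rep R = mat 4 4 (\<lambda>(i, j).
     mat_trace (transpose_mat (pi_mat (quat i) 1) * R * pi_mat (quat j) 1 * transpose_mat R) / 4)"

lemma adjoint_rep_pi_mat:
  assumes "dt A = 1" "dt B = 1"
  shows "adjoint_rep (pi_mat A B) = pi_mat A A"
proof (rule eq_matI)
  fix i j assume "i < dim_row (pi_mat A A)" "j < dim_col (pi_mat A A)"
  then have ij: "i < 4" "j < 4" by auto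
  have "tr (adj (quat i) * A * quat j * adj A) = tr (A * quat j * adj A * adj (quat i))"
    by (simp only: mult.assoc tr_commute[of "adj (quat i)"])
  then show "adjoint_rep (pi_mat A B) $$ (i, j) = pi_mat A A $$ (i, j)"
    using assms ij by (simp add: adjoint_rep_def pi_mat_transpose pi_mat_mult mat_trace_pi_mat
        mult_adj pi_mat_index coord_def)
qed (auto simp: adjoint_rep_def)

lemma adjoint_rep_algebraic: "algebraic_rep 4 (SO 4) 4 adjoint_rep"
  unfolding algebraic_rep_def
proof (intro conjI allI impI)
  show "adjoint_rep \<in> hom (SO 4) (GL 4)"
  proof (rule homI)
    fix R assume "R \<in> carrier (SO 4)"
    then obtain A B where "dt A = 1" "dt B = 1" "R = pi_mat A B" by (rule pi_mat_surj)
    then show "adjoint_rep R \<in> carrier (GL 4)" by (simp add: adjoint_rep_pi_mat SO_GL pi_mat_SO)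
  next
    fix R S assume "R \<in> carrier (SO 4)" "S \<in> carrier (SO 4)"
    then obtain A B C D where "dt A = 1" "dt B = 1" "R = pi_mat A B" "dt C = 1" "dt D = 1" "S =
        pi_mat C D"
      by (metis pi_mat_surj)
    then show "adjoint_rep (R \<otimes>\<^bsub>SO 4\<^esub> S) = adjoint_rep R \<otimes>\<^bsub>GL 4\<^esub> adjoint_rep S"
      by (simp add: adjoint_rep_pi_mat pi_mat_mult dt_mult)
  qed
  fix i j :: nat assume ij: "i < 4" "j < 4"
  define t where "t = (\<lambda>R\<in>carrier (SO 4). mat_trace (transpose_mat (pi_mat (quat i) 1) * R * pi_mat
      (quat j) 1 * transpose_mat R))"
  have t: "t \<in> generated_alg (carrier (SO 4)) (GL_coords 4)"
    unfolding t_def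
    by (intro poly_mat_trace poly_mat_mult poly_mat_transpose poly_mat_id poly_mat_const
        transpose_carrier_mat pi_mat_carrier)
  have "(\<lambda>A\<in>carrier (SO 4). adjoint_rep A $$ (i, j)) = (\<lambda>R\<in>carrier (SO 4). (\<lambda>R\<in>carrier (SO 4). 1 /
      4) R * t R)"
    using ij by (intro restrict_ext) (simp add: adjoint_rep_def t_def)
  then show "(\<lambda>A\<in>carrier (SO 4). adjoint_rep A $$ (i, j)) \<in> generated_alg (carrier (SO 4))
      (GL_coords 4)"
    using generated_alg.mult[OF generated_alg.const t] by (simp only:)
qed

text \<open>This separates the two factors of the double cover: the square of the trace of a word in
  one factor alone is in the full trace algebra, which lets it contain antisymmetric functions.\<close>

lemma lifted_adjoint:
  assumes w: "w \<in> carrier F2" and q: "word_trace w q"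
  shows "(\<lambda>v. q (fst v) * q (fst v)) \<in> lifted (Hom_alg rep_traces)"
proof (rule lifted_gen)
  show "(\<lambda>\<rho>. mat_trace (adjoint_rep (\<rho> w))) \<in> rep_traces" using w adjoint_rep_algebraic by blast
  show "lifts (\<lambda>\<rho>. mat_trace (adjoint_rep (\<rho> w))) (\<lambda>v. q (fst v) * q (fst v))"
    using w q by (auto simp: lifts_def rep_apply adjoint_rep_pi_mat dt_word_mat mat_trace_pi_mat
        word_trace_def)
qed

lemma Q4_self_rep_traces:
  assumes w: "w \<in> carrier F2" "w @ w \<in> carrier F2" and q: "word_trace w q"
  shows "Q4_fun w w \<in> Hom_alg rep_traces"
proof -
  let ?FT = "lifted (Hom_alg rep_traces)"
  define a s where "a = (\<lambda>v::triple \<times> triple. q (fst v) * q (fst v))" and "s = (\<lambda>v::triple \<times> triple.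
      q (fst v) * q (fst v) + q (snd v) * q (snd v))"
  have a: "a \<in> ?FT" unfolding a_def by (rule lifted_adjoint[OF w(1) q])
  have s: "s \<in> ?FT"
    using lifted_square_sum[OF w q] word_traces_rep_traces unfolding s_def lifted_def by blast
  have "(\<lambda>v. 8 * (s v - 2 * a v)) \<in> ?FT" by (intro lifted_intros a s)
  also have "(\<lambda>v. 8 * (s v - 2 * a v)) = (\<lambda>v. 8 * (q (snd v) * q (snd v) - q (fst v) * q (fst v)))"
    by (simp add: s_def a_def fun_eq_iff)
  finally obtain f where f: "f \<in> Hom_alg rep_traces" "lifts f (\<lambda>v. 8 * (q (snd v) * q (snd v) - q
      (fst v) * q (fst v)))"
    unfolding lifted_def by blast
  have "Q4_fun w w = f"
    by (rule lifts_unique_left[OF lifts_Q4_self[OF w(1) q] f(2) Q4_extensional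
        generated_alg_extensional[OF f(1)]])
  then show ?thesis using f(1) by simp
qed

section \<open>Independence over the full trace algebra\<close>

definition scale3 :: "complex \<Rightarrow> triple \<Rightarrow> triple" where
  "scale3 t = (\<lambda>(x, y, z). (t * x, t * y, t * z))"

text \<open>The independence proof compares the third coefficients of a function along two curves of
  representations that are exchanged by swapping the triples of traces. The conditions on the
  other coefficients make the comparison compatible with products: in the third coefficient of a
  product, the second coefficients, which need not agree, are multiplied by the vanishing first
  ones.\<close>

definition matched :: "complex poly \<Rightarrow> complex poly \<Rightarrow> bool" where
  "matched p q \<longleftrightarrow> coeff p 0 = coeff q 0 \<and> coeff p 1 = 0 \<and> coeff q 1 = 0 \<and> coeff p 3 = coeff q 3"

lemma coeff_mult_low:
  "coeff (p * q) 0 = coeff p 0 * coeff q 0"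
  "coeff (p * q) 1 = coeff p 0 * coeff q 1 + coeff p 1 * coeff q 0"
  "coeff (p * q) 3 = coeff p 0 * coeff q 3 + coeff p 1 * coeff q 2 + coeff p 2 * coeff q 1 + coeff p
      3 * coeff q 0"
  by (simp_all add: coeff_mult numeral_eq_Suc)

lemma matched_const: "matched [:c:] [:c:]"
  by (simp add: matched_def numeral_3_eq_3)

lemma matched_add: "matched p q \<Longrightarrow> matched p' q' \<Longrightarrow> matched (p + p') (q + q')"
  by (simp add: matched_def)

lemma matched_mult: "matched p q \<Longrightarrow> matched p' q' \<Longrightarrow> matched (p * p') (q * q')"
  unfolding matched_def coeff_mult_low by simp

text \<open>The curves are straight lines through the origin in the directions \<open>(u, u')\<close> and \<open>(u', u)\<close>
  of the space of six traces.\<close>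

definition balanced :: "triple \<Rightarrow> triple \<Rightarrow> ((nat letter list \<Rightarrow> complex mat) \<Rightarrow> complex) \<Rightarrow> bool" where
  "balanced u u' f \<longleftrightarrow> (\<exists>p q. matched p q \<and> (\<forall>a\<in>SL2_pairs. \<forall>b\<in>SL2_pairs. \<forall>t.
       (trs a = scale3 t u \<and> trs b = scale3 t u' \<longrightarrow> f (rep a b) = poly p t) \<and>
       (trs a = scale3 t u' \<and> trs b = scale3 t u \<longrightarrow> f (rep a b) = poly q t)))"

lemma balanced_const: "balanced u u' (\<lambda>\<rho>\<in>Hom F2 (SO 4). c)"
  unfolding balanced_def by (intro exI[of _ "[:c:]"]) (simp add: rep_Hom matched_const)

lemma balanced_add:
  assumes "balanced u u' f" "balanced u u' g"
  shows "balanced u u' (\<lambda>\<rho>\<in>Hom F2 (SO 4). f \<rho> + g \<rho>)"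
proof -
  from assms(1)[unfolded balanced_def] obtain p q where 1: "matched p q" "\<forall>a\<in>SL2_pairs.
      \<forall>b\<in>SL2_pairs. \<forall>t.
       (trs a = scale3 t u \<and> trs b = scale3 t u' \<longrightarrow> f (rep a b) = poly p t) \<and>
       (trs a = scale3 t u' \<and> trs b = scale3 t u \<longrightarrow> f (rep a b) = poly q t)" by (elim exE conjE)
           (rule that)
  from assms(2)[unfolded balanced_def] obtain p' q' where 2: "matched p' q'" "\<forall>a\<in>SL2_pairs.
      \<forall>b\<in>SL2_pairs. \<forall>t.
       (trs a = scale3 t u \<and> trs b = scale3 t u' \<longrightarrow> g (rep a b) = poly p' t) \<and>
       (trs a = scale3 t u' \<and> trs b = scale3 t u \<longrightarrow> g (rep a b) = poly q' t)" by (elim exE conjE)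
           (rule that)
  show ?thesis
    unfolding balanced_def
    by (rule exI[of _ "p + p'"], rule exI[of _ "q + q'"], rule conjI[OF matched_add[OF 1(1) 2(1)]])
      (use 1(2) 2(2) in \<open>simp add: rep_Hom\<close>)
qed

lemma balanced_mult:
  assumes "balanced u u' f" "balanced u u' g"
  shows "balanced u u' (\<lambda>\<rho>\<in>Hom F2 (SO 4). f \<rho> * g \<rho>)"
proof -
  from assms(1)[unfolded balanced_def] obtain p q where 1: "matched p q" "\<forall>a\<in>SL2_pairs.
      \<forall>b\<in>SL2_pairs. \<forall>t.
       (trs a = scale3 t u \<and> trs b = scale3 t u' \<longrightarrow> f (rep a b) = poly p t) \<and>
       (trs a = scale3 t u' \<and> trs b = scale3 t u \<longrightarrow> f (rep a b) = poly q t)" by (elim exE conjE)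
           (rule that)
  from assms(2)[unfolded balanced_def] obtain p' q' where 2: "matched p' q'" "\<forall>a\<in>SL2_pairs.
      \<forall>b\<in>SL2_pairs. \<forall>t.
       (trs a = scale3 t u \<and> trs b = scale3 t u' \<longrightarrow> g (rep a b) = poly p' t) \<and>
       (trs a = scale3 t u' \<and> trs b = scale3 t u \<longrightarrow> g (rep a b) = poly q' t)" by (elim exE conjE)
           (rule that)
  show ?thesis
    unfolding balanced_def
    by (rule exI[of _ "p * p'"], rule exI[of _ "q * q'"], rule conjI[OF matched_mult[OF 1(1) 2(1)]])
      (use 1(2) 2(2) in \<open>simp add: rep_Hom\<close>)
qed

lemma even_poly_coeff:
  fixes p :: "complex poly"
  assumes "\<And>t. poly p (- t) = poly p t" "odd n"
  shows "coeff p n = 0"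
proof -
  have "poly (p \<circ>\<^sub>p [:0, - 1:]) t = poly p t" for t by (simp add: poly_pcompose assms(1))
  then have "p \<circ>\<^sub>p [:0, - 1:] = p" by (simp add: poly_eq_poly_eq_iff[symmetric] fun_eq_iff)
  then have "coeff p n = (- 1) ^ n * coeff p n" by (metis coeff_pcompose_linear)
  then show ?thesis using assms(2) by (simp add: eq_neg_iff_add_eq_0)
qed

definition coords3 :: "(triple \<Rightarrow> complex) set" where
  "coords3 = {\<lambda>t. tx t, \<lambda>t. ty t, \<lambda>t. tz t}"

lemma word_mat_polys:
  "e \<in> {e11, e12, e21, e22} \<Longrightarrow> (\<lambda>l. e (word_mat (fst l) w)) \<in> polys coords_m2"
proof (induction w arbitrary: e)
  case Nil
  then show ?case by (elim insertE emptyE) (simp_all only: word_mat_simps polys_const)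
next
  case (Cons l w)
  have w: "(\<lambda>l. e11 (word_mat (fst l) w)) \<in> polys coords_m2" "(\<lambda>l. e12 (word_mat (fst l) w)) \<in> polys
      coords_m2"
    "(\<lambda>l. e21 (word_mat (fst l) w)) \<in> polys coords_m2" "(\<lambda>l. e22 (word_mat (fst l) w)) \<in> polys
        coords_m2"
    by (rule Cons.IH, simp)+
  consider "\<And>a. letter_mat a l = fst a" | "\<And>a. letter_mat a l = adj (fst a)"
    | "\<And>a. letter_mat a l = snd a" | "\<And>a. letter_mat a l = adj (snd a)"
    unfolding letter_mat_def Let_def by (cases "fst l = 1"; cases "snd l") simp_all
  then have l: "(\<lambda>a. e11 (letter_mat (fst a) l)) \<in> polys coords_m2 \<and> (\<lambda>a. e12 (letter_mat (fst a)
      l)) \<in> polys coords_m2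
    \<and> (\<lambda>a. e21 (letter_mat (fst a) l)) \<in> polys coords_m2 \<and> (\<lambda>a. e22 (letter_mat (fst a) l)) \<in> polys
        coords_m2"
    by cases (simp_all only: adj_def m2.sel, (intro conjI polys_uminus coords_m2_gens)+)
  note l = l[THEN conjunct1] l[THEN conjunct2, THEN conjunct1] l[THEN conjunct2, THEN conjunct2,
      THEN conjunct1]
    l[THEN conjunct2, THEN conjunct2, THEN conjunct2]
  show ?case
    using Cons.prems
    by (elim insertE emptyE; simp only: word_mat_simps times_m2_def m2.sel; intro polys_add
        polys_mult w l)
qed

lemma word_trace_exists: "\<exists>h\<in>polys coords3. word_trace w h"
proof -
  have "(\<lambda>l. tr (word_mat (fst l) w)) \<in> polys coords_m2"
    unfolding tr_def by (rule polys_add; rule word_mat_polys; simp)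
  then have "\<exists>H\<in>polys coords6. \<forall>a\<in>SL2_pairs. \<forall>b\<in>SL2_pairs. tr (word_mat (fst (a, b)) w) = H (trs a,
      trs b)"
    by (rule SL2_invariants) (simp add: word_mat_conj tr_conj)
  then obtain H where H: "H \<in> polys coords6"
    and eq: "\<forall>a\<in>SL2_pairs. \<forall>b\<in>SL2_pairs. tr (word_mat (fst (a, b)) w) = H (trs a, trs b)" by (rule
        bexE)
  obtain b where b: "b \<in> SL2_pairs" "trs b = (0, 0, 0)" using trs_surj by metis
  have gens: "(\<lambda>t. tx t) \<in> polys coords3" "(\<lambda>t. ty t) \<in> polys coords3" "(\<lambda>t. tz t) \<in> polys coords3"
    by (rule polys_gen, simp add: coords3_def)+
  have "(\<lambda>t. H (t, 0, 0, 0)) \<in> polys coords3"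
  proof (rule polys_subst[OF H])
    fix f assume "f \<in> coords6"
    then show "(\<lambda>t. f (t, 0, 0, 0)) \<in> polys coords3"
      unfolding coords6_def by (elim insertE emptyE; simp only: fst_conv snd_conv gens polys_const)
  qed
  moreover have "word_trace w (\<lambda>t. H (t, 0, 0, 0))"
    using eq b unfolding word_trace_def by (metis fst_conv)
  ultimately show ?thesis by (intro bexI)
qed

lemma word_trace_sign:
  assumes "word_trace w h"
  obtains r where "\<And>v. h (sign_trs s t v) = flip r (h v)"
proof -
  obtain r where r: "\<And>a. word_mat (sign_pair s t a) w = flip r (word_mat a w)"
    using word_mat_sign by blast
  have "h (sign_trs s t v) = flip r (h v)" for v
  proof -
    obtain a where a: "a \<in> SL2_pairs" "v = trs a" using trs_surj by metis
    have "h (sign_trs s t v) = tr (word_mat (sign_pair s t a) w)"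
      using assms a sign_pair_SL2 unfolding word_trace_def by (simp add: trs_sign_pair)
    also have "\<dots> = flip r (tr (word_mat a w))" by (simp add: r flip_def m2_uminus)
    finally show ?thesis using assms a unfolding word_trace_def by simp
  qed
  then show thesis by (rule that)
qed

text \<open>Reversal of the line is a sign change of the generators, which changes the trace of a word
  at most by its sign.\<close>

lemma word_trace_line:
  assumes h: "h \<in> polys coords3" "word_trace w h" and u: "sign_trs s s' u = scale3 (- 1) u"
  obtains \<alpha> r where "\<And>t. h (scale3 t u) = poly \<alpha> t" "\<And>t. poly \<alpha> (- t) = flip r (poly \<alpha> t)"
proof -
  have "(\<lambda>t. h (scale3 t u)) \<in> polys {\<lambda>t. t}"
  proof (rule polys_subst[OF h(1)])
    fix f assume "f \<in> coords3"
    moreover have "(\<lambda>t. t * c) \<in> polys {\<lambda>t. t}" for c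
      by (rule polys_mult[OF polys_gen polys_const]) simp
    ultimately show "(\<lambda>t. f (scale3 t u)) \<in> polys {\<lambda>t. t}"
      unfolding coords3_def scale3_def case_prod_beta by (elim insertE emptyE) simp_all
  qed
  then obtain \<alpha> where "(\<lambda>t. h (scale3 t u)) = poly \<alpha>" using polys_poly by blast
  then have \<alpha>: "h (scale3 t u) = poly \<alpha> t" for t by (rule fun_cong)
  obtain r where r: "\<And>v. h (sign_trs s s' v) = flip r (h v)" using word_trace_sign[OF h(2)] by metis
  have "scale3 (- t) u = scale3 t (scale3 (- 1) u)" for t
    by (simp add: scale3_def case_prod_beta)
  moreover have "scale3 t (sign_trs s s' u) = sign_trs s s' (scale3 t u)" for t
    by (simp add: scale3_def sign_trs_def case_prod_beta flip_def)
  ultimately have "poly \<alpha> (- t) = flip r (poly \<alpha> t)" for t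
    by (metis \<alpha> r u)
  then show thesis using \<alpha> by (intro that)
qed

definition reversible :: "triple \<Rightarrow> bool" where
  "reversible u \<longleftrightarrow> (\<exists>s s'. sign_trs s s' u = scale3 (- 1) u)"

text \<open>The character of a representation at a word is an even polynomial in the two traces \<open>\<alpha>\<close>
  and \<open>\<beta>\<close> of the word, which are exchanged between the two curves. Products of generators are
  treated by compatibility, so the squares and \<open>\<alpha> \<beta>\<close> suffice. The squares are even functions on
  the lines and have no odd coefficients at all; \<open>\<alpha> \<beta>\<close> is the same on both curves.\<close>

lemma balanced_rep_trace:
  assumes rev: "reversible u" "reversible u'" and \<phi>: "algebraic_rep 4 (SO 4) n \<phi>" and w: "w \<in>
      carrier F2"
  shows "balanced u u' (\<lambda>\<rho>\<in>Hom F2 (SO 4). mat_trace (\<phi> (\<rho> w)))"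
proof -
  obtain P where P: "P \<in> polys square_coords"
    and P_eq: "\<And>A B. dt A = 1 \<Longrightarrow> dt B = 1 \<Longrightarrow> (\<lambda>A\<in>carrier (SO 4). mat_trace (\<phi> A)) (pi_mat A B) = P (tr
        A, tr B)"
    using class_function_lift[OF character_class_function[OF \<phi>]] by metis
  obtain h where h: "h \<in> polys coords3" "word_trace w h" using word_trace_exists by (rule bexE)
  obtain \<alpha> r where \<alpha>: "\<And>t. h (scale3 t u) = poly \<alpha> t" "\<And>t. poly \<alpha> (- t) = flip r (poly \<alpha> t)"
    using rev(1) word_trace_line[OF h] unfolding reversible_def by metis
  obtain \<beta> r' where \<beta>: "\<And>t. h (scale3 t u') = poly \<beta> t" "\<And>t. poly \<beta> (- t) = flip r' (poly \<beta> t)"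
    using rev(2) word_trace_line[OF h] unfolding reversible_def by metis
  have "scale3 0 u = scale3 0 u'" by (simp add: scale3_def case_prod_beta)
  then have c0: "coeff \<alpha> 0 = coeff \<beta> 0" using \<alpha>(1)[of 0] \<beta>(1)[of 0] by (simp add: poly_0_coeff_0)
  have even: "coeff (\<alpha> * \<alpha>) n = 0" "coeff (\<beta> * \<beta>) n = 0" if "odd n" for n
    using that by (auto intro!: even_poly_coeff simp: \<alpha>(2) \<beta>(2) flip_def)
  \<comment> \<open>Either both constant terms vanish, or neither does and then both factors are even.\<close>
  have c1: "coeff (\<alpha> * \<beta>) 1 = 0"
  proof (cases "coeff \<alpha> 0 = 0")
    case True
    then show ?thesis using c0 by (simp only: coeff_mult_low mult_zero_left mult_zero_right add_0)
  next
    case False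
    then have "poly \<alpha> 0 \<noteq> 0" "poly \<beta> 0 \<noteq> 0" using c0 by (simp_all add: poly_0_coeff_0)
    then have "r = False" "r' = False"
      using \<alpha>(2)[of 0] \<beta>(2)[of 0] by (auto simp: flip_def eq_neg_iff_add_eq_0 split: if_splits)
    then show ?thesis by (intro even_poly_coeff) (simp_all add: \<alpha>(2) \<beta>(2))
  qed
  have "\<exists>p q. matched p q \<and> (\<forall>t. P (poly \<alpha> t, poly \<beta> t) = poly p t \<and> P (poly \<beta> t, poly \<alpha> t) = poly q
      t)"
    using P
  proof (induction rule: polys_induct)
    case (const c)
    show ?case by (intro exI[of _ "[:c:]"]) (simp add: matched_const)
  next
    case (gen f)
    then consider "f = (\<lambda>v. fst v * fst v)" | "f = (\<lambda>v. fst v * snd v)" | "f = (\<lambda>v. snd v * snd v)"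
      unfolding square_coords_def by blast
    then show ?case
    proof cases
      case 1
      have "matched (\<alpha> * \<alpha>) (\<beta> * \<beta>)"
        using even[of 1] even[of 3] by (simp add: matched_def coeff_mult_low(1) c0)
      then show ?thesis by (intro exI[of _ "\<alpha> * \<alpha>"] exI[of _ "\<beta> * \<beta>"]) (simp add: 1)
    next
      case 2
      have "matched (\<alpha> * \<beta>) (\<alpha> * \<beta>)" using c1 by (simp add: matched_def)
      then show ?thesis by (intro exI[of _ "\<alpha> * \<beta>"]) (simp add: 2)
    next
      case 3
      have "matched (\<beta> * \<beta>) (\<alpha> * \<alpha>)"
        using even[of 1] even[of 3] by (simp add: matched_def coeff_mult_low(1) c0)
      then show ?thesis by (intro exI[of _ "\<beta> * \<beta>"] exI[of _ "\<alpha> * \<alpha>"]) (simp add: 3)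
    qed
  next
    case (add f g)
    then obtain p q p' q' where "matched p q" "matched p' q'"
      "\<forall>t. f (poly \<alpha> t, poly \<beta> t) = poly p t \<and> f (poly \<beta> t, poly \<alpha> t) = poly q t"
      "\<forall>t. g (poly \<alpha> t, poly \<beta> t) = poly p' t \<and> g (poly \<beta> t, poly \<alpha> t) = poly q' t" by metis
    then show ?case by (intro exI[of _ "p + p'"] exI[of _ "q + q'"]) (simp add: matched_add)
  next
    case (mult f g)
    then obtain p q p' q' where "matched p q" "matched p' q'"
      "\<forall>t. f (poly \<alpha> t, poly \<beta> t) = poly p t \<and> f (poly \<beta> t, poly \<alpha> t) = poly q t"
      "\<forall>t. g (poly \<alpha> t, poly \<beta> t) = poly p' t \<and> g (poly \<beta> t, poly \<alpha> t) = poly q' t" by metis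
    then show ?case by (intro exI[of _ "p * p'"] exI[of _ "q * q'"]) (simp add: matched_mult)
  qed
  then obtain p q where pq: "matched p q"
    "\<forall>t. P (poly \<alpha> t, poly \<beta> t) = poly p t \<and> P (poly \<beta> t, poly \<alpha> t) = poly q t" by metis
  have "mat_trace (\<phi> (rep a b w)) = P (h (trs a), h (trs b))" if "a \<in> SL2_pairs" "b \<in> SL2_pairs" for
      a b
    using P_eq[of "word_mat a w" "word_mat b w"] that h(2) w
    by (simp add: rep_apply dt_word_mat pi_mat_SO word_trace_def)
  then show ?thesis
    unfolding balanced_def
    by (intro exI[of _ p] exI[of _ q]) (use pq in \<open>simp add: rep_Hom \<alpha>(1) \<beta>(1)\<close>)
qed

lemma balanced_rep_traces:
  assumes "reversible u" "reversible u'" "f \<in> Hom_alg rep_traces"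
  shows "balanced u u' f"
  using assms(3)
proof (induction rule: generated_alg.induct)
  case (gen f)
  then obtain \<phi> n w where "f = (\<lambda>\<rho>. mat_trace (\<phi> (\<rho> w)))" "algebraic_rep 4 (SO 4) n \<phi>" "w \<in> carrier
      F2" by blast
  then show ?case using balanced_rep_trace[OF assms(1,2)] by (simp only:)
qed (rule balanced_const balanced_add balanced_mult; assumption)+

text \<open>On the two curves the other generators vanish or are constant, so a linear combination of
  them is balanced, whereas \<open>Q\<close> has opposite third coefficients.\<close>

lemma not_in_span:
  assumes rev: "reversible u" "reversible u'" and Q: "lifts Q K"
    and K: "\<And>t. K (scale3 t u, scale3 t u') = c * t ^ 3" "\<And>t. K (scale3 t u', scale3 t u) = - c * t
        ^ 3" "c \<noteq> 0"
    and M: "\<And>m. m \<in> M \<Longrightarrow> m = one_fun \<or> (\<exists>L. lifts m L \<and> (\<forall>t. L (scale3 t u, scale3 t u') = 0 \<and> L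
        (scale3 t u', scale3 t u) = 0))"
  shows "Q \<notin> Hom_span (Hom_alg rep_traces) M"
proof
  assume "Q \<in> Hom_span (Hom_alg rep_traces) M"
  then have "balanced u u' Q"
  proof (induction rule: module_span_induct)
    case zero
    show ?case by (rule balanced_const)
  next
    case (add_term f a m)
    have a: "balanced u u' a" using rev add_term(2) by (rule balanced_rep_traces)
    have "balanced u u' (\<lambda>\<rho>\<in>Hom F2 (SO 4). a \<rho> * m \<rho>)"
      using M[OF add_term(3)]
    proof (elim disjE exE conjE)
      assume "m = one_fun"
      then show ?thesis using balanced_mult[OF a balanced_const[of u u' 1]] by (simp only:
          one_fun_def)
    next
      fix L assume "lifts m L" "\<forall>t. L (scale3 t u, scale3 t u') = 0 \<and> L (scale3 t u', scale3 t u) =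
          0"
      then show ?thesis
        unfolding balanced_def by (intro exI[of _ "[:0:]"] conjI matched_const) (simp add: lifts_def
            rep_Hom)
    qed
    from balanced_add[OF this add_term(1)] show ?case
      by (rule back_subst[of "balanced u u'"]) (intro restrict_ext, simp)
  qed
  from this[unfolded balanced_def] obtain p q where "matched p q" and pq: "\<forall>a\<in>SL2_pairs.
      \<forall>b\<in>SL2_pairs. \<forall>t.
       (trs a = scale3 t u \<and> trs b = scale3 t u' \<longrightarrow> Q (rep a b) = poly p t) \<and>
       (trs a = scale3 t u' \<and> trs b = scale3 t u \<longrightarrow> Q (rep a b) = poly q t)"
    by (elim exE conjE) (rule that)
  have "poly p t = poly (monom c 3) t \<and> poly q t = poly (monom (- c) 3) t" for t
  proof -
    obtain a b where ab: "a \<in> SL2_pairs" "trs a = scale3 t u" "b \<in> SL2_pairs" "trs b = scale3 t u'"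
      using trs_surj by metis
    then have "Q (rep a b) = poly p t" "Q (rep b a) = poly q t" using pq by blast+
    moreover have "Q (rep a b) = c * t ^ 3" "Q (rep b a) = - c * t ^ 3"
      using Q ab K unfolding lifts_def by metis+
    ultimately show ?thesis by (simp add: poly_monom)
  qed
  then have "p = monom c 3" "q = monom (- c) 3" by (simp_all add: poly_eq_poly_eq_iff[symmetric]
      fun_eq_iff)
  then show False using \<open>matched p q\<close> K(3) by (simp add: matched_def eq_neg_iff_add_eq_0)
qed

text \<open>At a representation whose lift has all six traces zero, every \<open>Q\<^sub>4\<close> among the generators
  vanishes.\<close>

lemma one_not_in_span:
  assumes M: "\<And>m. m \<in> M \<Longrightarrow> \<exists>L. lifts m L \<and> L ((0, 0, 0), (0, 0, 0)) = 0"
  shows "one_fun \<notin> Hom_span (Hom_alg rep_traces) M"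
proof
  obtain a where a: "a \<in> SL2_pairs" "trs a = (0, 0, 0)" using trs_surj by metis
  assume "one_fun \<in> Hom_span (Hom_alg rep_traces) M"
  then have "one_fun (rep a a) = 0"
  proof (induction rule: module_span_induct)
    case zero
    show ?case using a by (simp add: rep_Hom)
  next
    case (add_term f b m)
    obtain L where "lifts m L" "L ((0, 0, 0), (0, 0, 0)) = 0" using M[OF add_term(3)] by blast
    then have "m (rep a a) = 0" using a by (simp add: lifts_def)
    then show ?case using a add_term(1) by (simp add: rep_Hom)
  qed
  then show False using a by (simp add: one_fun_def rep_Hom)
qed

section \<open>The coordinate ring of the character variety\<close>

lemma reversible_axes:
  "reversible (1, 1, 0)" "reversible (0, 0, 1)" "reversible (0, 1, 1)" "reversible (1, 0, 0)"
  "reversible (1, 0, 1)" "reversible (0, 1, 0)"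
proof -
  have "reversible (1, 1, 0)" unfolding reversible_def
    by (intro exI[of _ True]) (simp add: sign_trs_def scale3_def)
  moreover have "reversible (0, 0, 1)" "reversible (1, 0, 0)" "reversible (1, 0, 1)" unfolding
      reversible_def
    by (intro exI[of _ True] exI[of _ False], simp add: sign_trs_def scale3_def)+
  moreover have "reversible (0, 1, 1)" "reversible (0, 1, 0)" unfolding reversible_def
    by (intro exI[of _ False] exI[of _ True], simp add: sign_trs_def scale3_def)+
  ultimately show "reversible (1, 1, 0)" "reversible (0, 0, 1)" "reversible (0, 1, 1)" "reversible
      (1, 0, 0)"
    "reversible (1, 0, 1)" "reversible (0, 1, 0)" by blast+
qed

lemma F2_words:
  "\<gamma> 1 = [la]" "\<gamma> 2 = [lb]" "\<gamma> 1 \<otimes>\<^bsub>F2\<^esub> \<gamma> 2 = [la, lb]"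
  "\<gamma> 1 \<otimes>\<^bsub>F2\<^esub> inv\<^bsub>F2\<^esub> \<gamma> 2 = [la, lb']" "\<gamma> 2 \<otimes>\<^bsub>F2\<^esub> inv\<^bsub>F2\<^esub> \<gamma> 1 = [lb, la']"
proof -
  have inv: "inv\<^bsub>F2\<^esub> [(i, True)] = [(i, False)]" if "i \<in> {1, 2}" for i
    by (rule group.inv_equality[OF group_F2]) (use gen_carrier[OF that] in \<open>simp_all add:
        inv_letter_def\<close>)
  show "\<gamma> 1 = [la]" "\<gamma> 2 = [lb]" by (simp_all add: \<gamma>_def free_gen_def)
  then show "\<gamma> 1 \<otimes>\<^bsub>F2\<^esub> \<gamma> 2 = [la, lb]" "\<gamma> 1 \<otimes>\<^bsub>F2\<^esub> inv\<^bsub>F2\<^esub> \<gamma> 2 = [la, lb']"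
    "\<gamma> 2 \<otimes>\<^bsub>F2\<^esub> inv\<^bsub>F2\<^esub> \<gamma> 1 = [lb, la']"
    using inv[of 1] inv[of 2] by (simp_all add: inv_letter_def)
qed

lemma one_fun_char_ring: "one_fun \<in> char_ring"
  unfolding one_fun_def by (rule char_ring_const)

lemma Q_gens_char_ring: "Q_gens \<subseteq> char_ring"
  unfolding Q_gens_def by (intro insert_subsetI empty_subsetI one_fun_char_ring Q4_char_ring
      word_carriers)

theorem theorem2:
  shows
    "let CX = coord_ring_X 4 (SO 4) F2 {\<gamma> 1, \<gamma> 2};
         T = trace_alg (SO 4) F2;
         FT = full_trace_alg 4 (SO 4) F2;
         span = module_span (Hom F2 (SO 4));
         \<gamma>12 = \<gamma> 1 \<otimes>\<^bsub>F2\<^esub> \<gamma> 2;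
         \<gamma>12' = \<gamma> 1 \<otimes>\<^bsub>F2\<^esub> inv\<^bsub>F2\<^esub> \<gamma> 2;
         \<gamma>21' = \<gamma> 2 \<otimes>\<^bsub>F2\<^esub> inv\<^bsub>F2\<^esub> \<gamma> 1;
         gens = [one_fun, Q4_fun (\<gamma> 1) (\<gamma> 2), Q4_fun \<gamma>12' (\<gamma> 2), Q4_fun \<gamma>21' (\<gamma> 1)]
     in CX = span T ({one_fun}
               \<union> {Q4_fun (\<gamma> i) (\<gamma> j) | i j. 1 \<le> i \<and> i \<le> j \<and> j \<le> 2}
               \<union> {Q4_fun \<gamma>12 \<gamma>12, Q4_fun \<gamma>12' \<gamma>12', Q4_fun \<gamma>12' (\<gamma> 2), Q4_fun \<gamma>21' (\<gamma> 1)})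
        \<and> CX = span FT (set gens)
        \<and> (\<forall>i<4. gens ! i \<notin> span FT {gens ! j | j. j < 4 \<and> j \<noteq> i})
        \<and> FT \<subset> CX"
proof -
  let ?X = "Hom F2 (SO 4)" and ?T = "Hom_alg word_traces" and ?FT = "Hom_alg rep_traces"
  let ?Q12 = "Q4_fun [la] [lb]" and ?Q1 = "Q4_fun [la, lb'] [lb]" and ?Q2 = "Q4_fun [lb, la'] [la]"
  let ?gens = "[one_fun, ?Q12, ?Q1, ?Q2]"
  have T: "trace_alg (SO 4) F2 = ?T" and FT: "full_trace_alg 4 (SO 4) F2 = ?FT"
    by (simp_all only: trace_alg_def full_trace_alg_def)
  have "{Q4_fun (\<gamma> i) (\<gamma> j) | i j. 1 \<le> i \<and> i \<le> j \<and> j \<le> 2}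
      = {Q4_fun (\<gamma> 1) (\<gamma> 1), Q4_fun (\<gamma> 1) (\<gamma> 2), Q4_fun (\<gamma> 2) (\<gamma> 2)}"
  proof -
    have "1 \<le> i \<and> i \<le> j \<and> j \<le> 2 \<longleftrightarrow> i = 1 \<and> j = 1 \<or> i = 1 \<and> j = 2 \<or> i = 2 \<and> j = 2" for i j :: nat
      by auto
    then show ?thesis by auto
  qed
  then have Q: "{one_fun} \<union> {Q4_fun (\<gamma> i) (\<gamma> j) | i j. 1 \<le> i \<and> i \<le> j \<and> j \<le> 2}
      \<union> {Q4_fun [la, lb] [la, lb], Q4_fun [la, lb'] [la, lb'], ?Q1, ?Q2} = Q_gens"
    by (simp only: Q_gens_def F2_words) blast
  have gens: "set ?gens = {one_fun, ?Q12, ?Q1, ?Q2}" by simp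
  have part1: "char_ring = module_span ?X ?T Q_gens"
  proof
    show "char_ring \<subseteq> module_span ?X ?T Q_gens" using char_ring_in_trace_span by blast
    show "module_span ?X ?T Q_gens \<subseteq> char_ring"
      using word_traces_rep_traces rep_traces_char_ring Q_gens_char_ring by (intro
          module_span_subset_char_ring) auto
  qed
  have part2: "char_ring = module_span ?X ?FT (set ?gens)"
  proof
    have gen: "m \<in> module_span ?X ?FT (set ?gens)" if "m \<in> set ?gens" for m
      using that one_fun_char_ring Q4_extensional by (intro module_span_gen) (auto simp:
          char_ring_extensional)
    have alg: "f \<in> module_span ?X ?FT (set ?gens)" if f: "f \<in> ?FT" for f
    proof -
      have "(\<lambda>\<rho>\<in>?X. f \<rho> * one_fun \<rho>) = f"
        using generated_alg_extensional[OF f] by (auto simp: one_fun_def restrict_def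
            extensional_def fun_eq_iff)
      then show ?thesis using module_span_mult[OF f gen[of one_fun]] by simp
    qed
    have "Q_gens \<subseteq> module_span ?X ?FT (set ?gens)"
      unfolding Q_gens_def
      by (intro insert_subsetI empty_subsetI)
        (rule alg[OF Q4_self_rep_traces[OF word_carriers(1,8) traces_of_words(1)]]
          alg[OF Q4_self_rep_traces[OF word_carriers(2,9) traces_of_words(2)]]
          alg[OF Q4_self_rep_traces[OF word_carriers(3,10) traces_of_words(3)]]
          alg[OF Q4_self_rep_traces[OF word_carriers(4,11) traces_of_words(4)]] | (rule gen, simp))+
    then show "char_ring \<subseteq> module_span ?X ?FT (set ?gens)"
      unfolding part1 using word_traces_rep_traces by (intro module_span_subset)
    have "set ?gens \<subseteq> char_ring" unfolding gens by (intro insert_subsetI empty_subsetI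
        one_fun_char_ring Q4_char_ring word_carriers)
    then show "module_span ?X ?FT (set ?gens) \<subseteq> char_ring" using rep_traces_char_ring by (intro
        module_span_subset_char_ring)
  qed
  \<comment> \<open>For each mixed generator there is a pair of directions along which it is a nonzero multiple of
    \<open>t\<^sup>3\<close> while the other two vanish.\<close>
  have part3: "?gens ! i \<notin> module_span ?X ?FT {?gens ! j | j. j < 4 \<and> j \<noteq> i}" if "i < 4" for i
  proof -
    have sub: "{?gens ! j | j. j < 4 \<and> j \<noteq> i} = (!) ?gens ` ({0, 1, 2, 3} - {i})"
      by (auto simp: less4)
    consider "i = 0" | "i = 1" | "i = 2" | "i = 3" using \<open>i < 4\<close> by linarith
    then show ?thesis
    proof cases
      case 1
      have "one_fun \<notin> module_span ?X ?FT {?Q12, ?Q1, ?Q2}"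
      proof (rule one_not_in_span)
        fix m assume "m \<in> {?Q12, ?Q1, ?Q2}"
        then show "\<exists>L. lifts m L \<and> L ((0, 0, 0), (0, 0, 0)) = 0"
          by (elim insertE emptyE) (simp only:, rule exI, rule conjI, rule lifts_Q_mixed, simp)+
      qed
      then show ?thesis unfolding sub unfolding 1 by (simp add: insert_commute insert_Diff_if)
    next
      case 2
      have "?Q12 \<notin> module_span ?X ?FT {one_fun, ?Q1, ?Q2}"
      proof (rule not_in_span[OF reversible_axes(1,2) lifts_Q_mixed(1), of 4])
        fix m assume "m \<in> {one_fun, ?Q1, ?Q2}"
        then show "m = one_fun \<or> (\<exists>L. lifts m L \<and> (\<forall>t. L (scale3 t (1, 1, 0), scale3 t (0, 0, 1)) =
            0
            \<and> L (scale3 t (0, 0, 1), scale3 t (1, 1, 0)) = 0))"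
          by (elim insertE emptyE; hypsubst)
              ((rule disjI1, rule refl) | (rule disjI2, rule exI, rule conjI, rule lifts_Q_mixed,
                  simp add: scale3_def))+
      qed (simp_all add: scale3_def power3_eq_cube)
      then show ?thesis unfolding sub unfolding 2 by (simp add: insert_commute insert_Diff_if)
    next
      case 3
      have "?Q1 \<notin> module_span ?X ?FT {one_fun, ?Q12, ?Q2}"
      proof (rule not_in_span[OF reversible_axes(3,4) lifts_Q_mixed(2), of "- 4"])
        fix m assume "m \<in> {one_fun, ?Q12, ?Q2}"
        then show "m = one_fun \<or> (\<exists>L. lifts m L \<and> (\<forall>t. L (scale3 t (0, 1, 1), scale3 t (1, 0, 0)) =
            0
            \<and> L (scale3 t (1, 0, 0), scale3 t (0, 1, 1)) = 0))"
          by (elim insertE emptyE; hypsubst)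
              ((rule disjI1, rule refl) | (rule disjI2, rule exI, rule conjI, rule lifts_Q_mixed,
                  simp add: scale3_def))+
      qed (simp_all add: scale3_def power3_eq_cube)
      then show ?thesis unfolding sub unfolding 3 by (simp add: insert_commute insert_Diff_if)
    next
      case 4
      have "?Q2 \<notin> module_span ?X ?FT {one_fun, ?Q12, ?Q1}"
      proof (rule not_in_span[OF reversible_axes(5,6) lifts_Q_mixed(3), of "- 4"])
        fix m assume "m \<in> {one_fun, ?Q12, ?Q1}"
        then show "m = one_fun \<or> (\<exists>L. lifts m L \<and> (\<forall>t. L (scale3 t (1, 0, 1), scale3 t (0, 1, 0)) =
            0
            \<and> L (scale3 t (0, 1, 0), scale3 t (1, 0, 1)) = 0))"
          by (elim insertE emptyE; hypsubst)
              ((rule disjI1, rule refl) | (rule disjI2, rule exI, rule conjI, rule lifts_Q_mixed,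
                  simp add: scale3_def))+
      qed (simp_all add: scale3_def power3_eq_cube)
      then show ?thesis unfolding sub unfolding 4 by (simp add: insert_commute insert_Diff_if)
    qed
  qed
  have "?Q12 \<in> char_ring" by (intro Q4_char_ring word_carriers)
  moreover have "?Q12 \<notin> ?FT"
  proof
    assume Q12: "?Q12 \<in> ?FT"
    let ?M = "{?gens ! j | j. j < 4 \<and> j \<noteq> 1}"
    have "one_fun \<in> ?M" by (intro CollectI exI[of _ 0]) simp
    then have "one_fun \<in> module_span ?X ?FT ?M" by (rule module_span_gen[OF _
        char_ring_extensional[OF one_fun_char_ring]])
    from module_span_mult[OF Q12 this]
    have "(\<lambda>\<rho>\<in>?X. ?Q12 \<rho> * one_fun \<rho>) \<in> module_span ?X ?FT ?M" .
    also have "(\<lambda>\<rho>\<in>?X. ?Q12 \<rho> * one_fun \<rho>) = ?Q12"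
      using Q4_extensional by (auto simp: one_fun_def restrict_def extensional_def fun_eq_iff)
    finally have "?Q12 \<in> module_span ?X ?FT ?M" .
    then show False using part3[of 1] by simp
  qed
  ultimately have part4: "?FT \<subset> char_ring" using rep_traces_char_ring by blast
  show ?thesis
    unfolding Let_def T FT F2_words(3-5) unfolding F2_words(1,2) Q
    using part1 part2 part3 part4 unfolding F2_words(1,2) by (intro conjI allI impI)
qed

end
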